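(* Let $\Bbbk$ be an algebraically closed field of characteristic zero, let $A=\Bbbk[x,y,z]$ be graded by $\deg x=a$, $\deg y=b$, $\deg z=c$ with $a,b,c$ positive integers, and let $\Omega\in A$ be a homogeneous element of degree $a+b+c$ having an isolated singularity. For $\xi\in\Bbbk$ let $P_{\Omega-\xi}=A_\Omega/(\Omega-\xi)$, and write $P_\Omega=P_{\Omega-0}$. (1) Every Poisson automorphism of $P_\Omega$ is graded, and for $\xi\neq 0$ every Poisson automorphism of $P_{\Omega-\xi}$ is linear. (2) Every Poisson automorphism of $A_\Omega$ is graded. Moreover, the automorphism groups are as follows. One has $\mathrm{Aut}_P(A_\Omega)\cong \mathrm{Aut}_{grP}(A_\Omega)\cong \mathrm{Aut}_{grP}(P_\Omega)\cong \mathrm{Aut}_P(P_\Omega)$, and: (i) If $(a,b,c)=(1,1,1)$ and $\Omega=x^3+y^3+z^3+\lambda xyz$ with $(-\lambda)^3\ne 27$, there are short exact sequences $1\to G\to \mathrm{Aut}_P(P_\Omega)\to C_3\to 1$ and $1\to G'\to \mathrm{Aut}_P(P_{\Omega-1})\to C_3\to 1$, where $G=\{(\alpha_1,\alpha_2,\alpha_3)\in(\Bbbk^\times)^3 : \alpha_1^3=\alpha_2^3=\alpha_3^3=\alpha_1\alpha_2\alpha_3\}$ and $G'=\{(\alpha_1,\alpha_2,\alpha_3)\in(\Bbbk^\times)^3 : \alpha_1^3=\alpha_2^3=\alpha_3^3=\alpha_1\alpha_2\alpha_3=1\}$; moreover $\mathrm{Aut}_P(P_\Omega)\cong C_3\ltimes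 G$ and $\mathrm{Aut}_P(P_{\Omega-1})\cong C_3\ltimes G'$. (ii) If $(a,b,c)=(1,1,2)$ and $\Omega=x^4+y^4+z^2+\lambda xyz$ with $(-\lambda)^4\ne 64$, there are short exact sequences $1\to G\to \mathrm{Aut}_P(P_\Omega)\to C_2\to 1$ and $1\to G'\to \mathrm{Aut}_P(P_{\Omega-1})\to C_2\to 1$, where $G=\{(\alpha_1,\alpha_2)\in(\Bbbk^\times)^2 : \alpha_1^2=\alpha_2^2\}$ and $G'=\{(\alpha_1,\alpha_2)\in(\Bbbk^\times)^2 : \alpha_1^4=\alpha_2^4=1,\ \alpha_1^2=\alpha_2^2\}$; moreover $\mathrm{Aut}_P(P_\Omega)\cong C_2\ltimes G$ and $\mathrm{Aut}_P(P_{\Omega-1})\cong C_2\ltimes G'$. (iii) If $(a,b,c)=(1,2,3)$ and $\Omega=x^6+y^3+z^2+\lambda xyz$ with $(-\lambda)^6\ne 432$, then every Poisson automorphism of $P_\Omega$ is of the form $x\mapsto\zeta x$, $y\mapsto\zeta^2y$, $z\mapsto\zeta^3z$ for some $\zeta\in\Bbbk^\times$, and every Poisson automorphism of $P_{\Omega-1}$ is of this form with $\zeta^6=1$.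
   Context: $A_\Omega$ denotes $A=\Bbbk[x,y,z]$ with the Poisson bracket $\{f,g\}=\det\frac{\partial(f,g,\Omega)}{\partial(x,y,z)}$ (so $\{x,y\}=\Omega_z$, $\{y,z\}=\Omega_x$, $\{z,x\}=\Omega_y$). The element $\Omega$ is Poisson central, so $P_{\Omega-\xi}$ is a quotient Poisson algebra. $\Omega$ has an isolated singularity if $\Omega_x,\Omega_y,\Omega_z$ vanish simultaneously only at the origin. $\mathrm{Aut}_P$ denotes the group of Poisson algebra automorphisms, $\mathrm{Aut}_{grP}$ the subgroup of those preserving the grading ($A_\Omega$ and $P_\Omega$ are graded by the weights $a,b,c$). A Poisson automorphism $\sigma$ of $P_{\Omega-\xi}$ ($\xi\ne0$) is linear if for every $i\geq 0$ it maps into itself the subspace of $P_{\Omega-\xi}$ spanned by the images of monomials in $x,y,z$ of weighted degree $\le i$. $C_n$ is the cyclic group of order $n$; in the semidirect products it acts on $G$, $G'$ by cyclic permutation of the coordinates. *)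

theory Defs
  imports
    "HOL-Algebra.QuotRing"
    "HOL-Algebra.Module"
    "HOL-Algebra.Bij"
    "HOL-Algebra.Elementary_Groups"
    "HOL-Computational_Algebra.Polynomial"
begin

section \<open>The polynomial ring in three variables\<close>

text \<open>
  \<open>\<bbbk>[x,y,z]\<close> is represented as the iterated polynomial ring \<open>\<bbbk>[x][y][z]\<close>;
  in the type \<open>'k poly poly poly\<close> the outermost variable is \<open>z\<close>, the innermost one is \<open>x\<close>.
\<close>

type_synonym 'k poly3 = "'k poly poly poly"

definition const3 :: "'k::comm_ring_1 \<Rightarrow> 'k poly3" where
  "const3 c = [:[:[:c:]:]:]"

definition varX :: "'k::comm_ring_1 poly3" where "varX = [:[:[:0, 1:]:]:]"
definition varY :: "'k::comm_ring_1 poly3" where "varY = [:[:0, 1:]:]"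
definition varZ :: "'k::comm_ring_1 poly3" where "varZ = [:0, 1:]"

text \<open>The coefficient of \<open>x\<^sup>i y\<^sup>j z\<^sup>k\<close>.\<close>
definition coeff3 :: "'k::comm_ring_1 poly3 \<Rightarrow> nat \<Rightarrow> nat \<Rightarrow> nat \<Rightarrow> 'k" where
  "coeff3 f i j k = poly.coeff (poly.coeff (poly.coeff f k) j) i"

definition eval3 :: "'k::comm_ring_1 poly3 \<Rightarrow> 'k \<Rightarrow> 'k \<Rightarrow> 'k \<Rightarrow> 'k" where
  "eval3 f x y z = poly (poly (poly f [:[:z:]:]) [:y:]) x"

definition partial_x :: "'k::idom poly3 \<Rightarrow> 'k poly3" where
  "partial_x f = map_poly (map_poly pderiv) f"

definition partial_y :: "'k::idom poly3 \<Rightarrow> 'k poly3" where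
  "partial_y f = map_poly pderiv f"

definition partial_z :: "'k::idom poly3 \<Rightarrow> 'k poly3" where
  "partial_z f = pderiv f"

text \<open>The homogeneous elements of degree \<open>n\<close> for the weights \<open>a, b, c\<close> (including \<open>0\<close>).\<close>
definition homogeneous3 :: "nat \<Rightarrow> nat \<Rightarrow> nat \<Rightarrow> nat \<Rightarrow> 'k::comm_ring_1 poly3 set" where
  "homogeneous3 a b c n =
     {f. \<forall>i j k. coeff3 f i j k \<noteq> 0 \<longrightarrow> a * i + b * j + c * k = n}"

definition isolated_singularity :: "'k::idom poly3 \<Rightarrow> bool" where
  "isolated_singularity \<Omega> \<longleftrightarrow>
     {(x, y, z). eval3 (partial_x \<Omega>) x y z = 0 \<and> eval3 (partial_y \<Omega>) x y z = 0 \<and>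
                 eval3 (partial_z \<Omega>) x y z = 0} = {(0, 0, 0)}"


section \<open>Poisson algebras\<close>

text \<open>The scalars are all of the type \<open>'k\<close>.\<close>

record ('k, 'a) poisson_algebra = "('k, 'a) module" +
  pbracket :: "'a \<Rightarrow> 'a \<Rightarrow> 'a"

text \<open>
  As for \<^const>\<open>rcoset_mult\<close>, the operations on cosets are formed from all representatives;
  for a Poisson ideal \<open>I\<close> each of the unions is a single coset
  (see \<open>smult_P_Omega\<close> and \<open>pbracket_P_Omega\<close> below).
\<close>
definition poisson_quotient ::
    "('k, 'a) poisson_algebra \<Rightarrow> 'a set \<Rightarrow> ('k, 'a set) poisson_algebra" where
  "poisson_quotient R I =
     \<lparr>carrier = carrier (R Quot I),
      monoid.mult = monoid.mult (R Quot I),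
      one = one (R Quot I),
      zero = zero (R Quot I),
      add = add (R Quot I),
      module.smult = (\<lambda>t U. \<Union>u\<in>U. I +>\<^bsub>R\<^esub> module.smult R t u),
      pbracket = (\<lambda>U V. \<Union>u\<in>U. \<Union>v\<in>V. I +>\<^bsub>R\<^esub> pbracket R u v)\<rparr>"

definition poisson_auts :: "('k, 'a) poisson_algebra \<Rightarrow> ('a \<Rightarrow> 'a) set" where
  "poisson_auts R =
     {\<sigma> \<in> Bij (carrier R). \<sigma> \<in> ring_hom R R \<and>
        (\<forall>t. \<forall>f\<in>carrier R. \<sigma> (module.smult R t f) = module.smult R t (\<sigma> f)) \<and>
        (\<forall>f\<in>carrier R. \<forall>g\<in>carrier R. \<sigma> (pbracket R f g) = pbracket R (\<sigma> f) (\<sigma> g))}"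

definition preserves :: "(nat \<Rightarrow> 'a set) \<Rightarrow> ('a \<Rightarrow> 'a) \<Rightarrow> bool" where
  "preserves V \<sigma> \<longleftrightarrow> (\<forall>n. \<sigma> ` V n \<subseteq> V n)"

definition AutP :: "('k, 'a) poisson_algebra \<Rightarrow> ('a \<Rightarrow> 'a) monoid" where
  "AutP R = BijGroup (carrier R) \<lparr>carrier := poisson_auts R\<rparr>"

definition AutgrP :: "('k, 'a) poisson_algebra \<Rightarrow> (nat \<Rightarrow> 'a set) \<Rightarrow> ('a \<Rightarrow> 'a) monoid" where
  "AutgrP R V = BijGroup (carrier R) \<lparr>carrier := {\<sigma> \<in> poisson_auts R. preserves V \<sigma>}\<rparr>"

inductive_set lin_span :: "('k, 'a) poisson_algebra \<Rightarrow> 'a set \<Rightarrow> 'a set"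
  for R :: "('k, 'a) poisson_algebra" and S :: "'a set" where
  zero: "\<zero>\<^bsub>R\<^esub> \<in> lin_span R S"
| gen: "s \<in> S \<Longrightarrow> s \<in> lin_span R S"
| add: "u \<in> lin_span R S \<Longrightarrow> v \<in> lin_span R S \<Longrightarrow> u \<oplus>\<^bsub>R\<^esub> v \<in> lin_span R S"
| smult: "u \<in> lin_span R S \<Longrightarrow> module.smult R t u \<in> lin_span R S"


section \<open>The Poisson algebras of a potential\<close>

text \<open>The determinant of the Jacobian matrix of \<open>(f, g, \<Omega>)\<close>, with rows the gradients.\<close>
definition jacobian3 :: "'k::idom poly3 \<Rightarrow> 'k poly3 \<Rightarrow> 'k poly3 \<Rightarrow> 'k poly3" where
  "jacobian3 f g \<Omega> =
     partial_x f * (partial_y g * partial_z \<Omega> - partial_z g * partial_y \<Omega>)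
   - partial_y f * (partial_x g * partial_z \<Omega> - partial_z g * partial_x \<Omega>)
   + partial_z f * (partial_x g * partial_y \<Omega> - partial_y g * partial_x \<Omega>)"

definition A_Omega :: "'k::idom poly3 \<Rightarrow> ('k, 'k poly3) poisson_algebra" where
  "A_Omega \<Omega> =
     \<lparr>carrier = UNIV, monoid.mult = (*), one = 1, zero = 0, add = (+),
      module.smult = (\<lambda>t f. const3 t * f),
      pbracket = (\<lambda>f g. jacobian3 f g \<Omega>)\<rparr>"

text \<open>\<open>P_Omega \<Omega> \<xi>\<close> is \<open>A\<^sub>\<Omega> / (\<Omega> - \<xi>)\<close>, and \<open>P_class \<Omega> \<xi> f\<close> is the image of \<open>f\<close> in it.\<close>

definition P_ideal :: "'k::idom poly3 \<Rightarrow> 'k \<Rightarrow> 'k poly3 set" where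
  "P_ideal \<Omega> \<xi> = PIdl\<^bsub>A_Omega \<Omega>\<^esub> (\<Omega> - const3 \<xi>)"

definition P_Omega :: "'k::idom poly3 \<Rightarrow> 'k \<Rightarrow> ('k, 'k poly3 set) poisson_algebra" where
  "P_Omega \<Omega> \<xi> = poisson_quotient (A_Omega \<Omega>) (P_ideal \<Omega> \<xi>)"

definition P_class :: "'k::idom poly3 \<Rightarrow> 'k \<Rightarrow> 'k poly3 \<Rightarrow> 'k poly3 set" where
  "P_class \<Omega> \<xi> f = P_ideal \<Omega> \<xi> +>\<^bsub>A_Omega \<Omega>\<^esub> f"

definition P_degree :: "nat \<Rightarrow> nat \<Rightarrow> nat \<Rightarrow> 'k::idom poly3 \<Rightarrow> nat \<Rightarrow> 'k poly3 set set" where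
  "P_degree a b c \<Omega> n = P_class \<Omega> 0 ` homogeneous3 a b c n"

text \<open>For \<open>\<xi> \<noteq> 0\<close>, the Poisson automorphisms preserving this filtration are the linear ones.\<close>
definition P_filtration ::
    "nat \<Rightarrow> nat \<Rightarrow> nat \<Rightarrow> 'k::idom poly3 \<Rightarrow> 'k \<Rightarrow> nat \<Rightarrow> 'k poly3 set set" where
  "P_filtration a b c \<Omega> \<xi> n =
     lin_span (P_Omega \<Omega> \<xi>)
       {P_class \<Omega> \<xi> (varX ^ i * varY ^ j * varZ ^ k) | i j k. a * i + b * j + c * k \<le> n}"


subsection \<open>Well-definedness\<close>

lemma map_poly_derivation:
  fixes D :: "'a::comm_ring_1 \<Rightarrow> 'a"
  assumes add: "\<And>x y. D (x + y) = D x + D y"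
    and mult: "\<And>x y. D (x * y) = x * D y + D x * y"
  shows "map_poly D (p + q) = map_poly D p + map_poly D q"
    and "map_poly D (p * q) = p * map_poly D q + map_poly D p * q"
proof -
  have D0: "D 0 = 0"
    using add[of 0 0] by simp
  have Dsum: "D (sum f A) = (\<Sum>x\<in>A. D (f x))" for f :: "nat \<Rightarrow> 'a" and A
    by (induction A rule: infinite_finite_induct) (simp_all add: D0 add)
  show "map_poly D (p + q) = map_poly D p + map_poly D q"
    by (rule poly_eqI) (simp add: coeff_map_poly D0 add)
  show "map_poly D (p * q) = p * map_poly D q + map_poly D p * q"
    by (rule poly_eqI)
      (simp add: coeff_map_poly D0 coeff_mult Dsum mult sum.distrib)
qed

lemma partial_derivation:
  fixes f g :: "'k::idom poly3"
  shows "partial_x (f + g) = partial_x f + partial_x g"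
    and "partial_x (f * g) = f * partial_x g + partial_x f * g"
    and "partial_y (f + g) = partial_y f + partial_y g"
    and "partial_y (f * g) = f * partial_y g + partial_y f * g"
    and "partial_z (f + g) = partial_z f + partial_z g"
    and "partial_z (f * g) = f * partial_z g + partial_z f * g"
proof -
  have d: "pderiv (p + q) = pderiv p + pderiv q" "pderiv (p * q) = p * pderiv q + pderiv p * q"
    for p q :: "'b::idom poly"
    by (simp_all add: pderiv_add pderiv_mult algebra_simps)
  note m = map_poly_derivation[of "pderiv :: 'k poly \<Rightarrow> _", OF d]
    map_poly_derivation[of "pderiv :: 'k poly poly \<Rightarrow> _", OF d]
  note mm = map_poly_derivation[of "map_poly pderiv :: 'k poly poly \<Rightarrow> _",
      OF map_poly_derivation[of "pderiv :: 'k poly \<Rightarrow> _", OF d]]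
  show "partial_x (f + g) = partial_x f + partial_x g"
    "partial_x (f * g) = f * partial_x g + partial_x f * g"
    by (simp_all only: partial_x_def mm)
  show "partial_y (f + g) = partial_y f + partial_y g"
    "partial_y (f * g) = f * partial_y g + partial_y f * g"
    by (simp_all only: partial_y_def
        map_poly_derivation[of "pderiv :: 'k poly poly \<Rightarrow> _", OF d])
  show "partial_z (f + g) = partial_z f + partial_z g"
    "partial_z (f * g) = f * partial_z g + partial_z f * g"
    by (simp_all only: partial_z_def d)
qed

lemma partial_const3 [simp]:
  "partial_x (const3 t) = 0" "partial_y (const3 t) = 0" "partial_z (const3 t) = 0"
  by (simp_all add: partial_x_def partial_y_def partial_z_def const3_def
      map_poly_pCons pderiv_pCons)

lemma partial_generators:
  "partial_x varX = 1" "partial_x varY = 0" "partial_x varZ = 0"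
  "partial_y varX = 0" "partial_y varY = 1" "partial_y varZ = 0"
  "partial_z varX = 0" "partial_z varY = 0" "partial_z varZ = 1"
  by (simp_all add: partial_x_def partial_y_def partial_z_def varX_def varY_def varZ_def
      map_poly_pCons pderiv_pCons one_pCons)

lemma pbracket_generators:
  "pbracket (A_Omega \<Omega>) varX varY = partial_z \<Omega>"
  "pbracket (A_Omega \<Omega>) varY varZ = partial_x \<Omega>"
  "pbracket (A_Omega \<Omega>) varZ varX = partial_y \<Omega>"
  by (simp_all add: A_Omega_def jacobian3_def partial_generators)

lemma P_class_eq_iff:
  "P_class \<Omega> \<xi> f = P_class \<Omega> \<xi> g \<longleftrightarrow> (\<Omega> - const3 \<xi>) dvd (f - g)"
proof -
  have cl: "P_class \<Omega> \<xi> h = {h + r * (\<Omega> - const3 \<xi>) | r. True}" for h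
    by (auto simp: P_class_def P_ideal_def a_r_coset_def r_coset_def cgenideal_def
        A_Omega_def add.commute)
  show ?thesis
  proof
    assume "P_class \<Omega> \<xi> f = P_class \<Omega> \<xi> g"
    moreover have "f \<in> P_class \<Omega> \<xi> f"
      unfolding cl by (auto intro: exI[of _ 0])
    ultimately show "(\<Omega> - const3 \<xi>) dvd (f - g)"
      unfolding cl by auto
  next
    assume "(\<Omega> - const3 \<xi>) dvd (f - g)"
    then obtain r where r: "f - g = r * (\<Omega> - const3 \<xi>)"
      by (metis dvdE mult.commute)
    have f: "f = g + r * (\<Omega> - const3 \<xi>)"
      using r by (simp add: algebra_simps)
    show "P_class \<Omega> \<xi> f = P_class \<Omega> \<xi> g"
      unfolding cl
    proof (intro subset_antisym subsetI; elim CollectE exE conjE)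
      fix h s
      assume "h = f + s * (\<Omega> - const3 \<xi>)"
      then have "h = g + (r + s) * (\<Omega> - const3 \<xi>)"
        by (simp add: f ring_distribs)
      then show "h \<in> {g + r * (\<Omega> - const3 \<xi>) | r. True}"
        by blast
    next
      fix h s
      assume "h = g + s * (\<Omega> - const3 \<xi>)"
      then have "h = f + (s - r) * (\<Omega> - const3 \<xi>)"
        by (simp add: f ring_distribs)
      then show "h \<in> {f + r * (\<Omega> - const3 \<xi>) | r. True}"
        by blast
    qed
  qed
qed

lemma mem_P_class_iff: "u \<in> P_class \<Omega> \<xi> f \<longleftrightarrow> (\<Omega> - const3 \<xi>) dvd (u - f)"
proof
  assume "u \<in> P_class \<Omega> \<xi> f"
  then show "(\<Omega> - const3 \<xi>) dvd (u - f)"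
    by (auto simp: P_class_def P_ideal_def a_r_coset_def r_coset_def cgenideal_def A_Omega_def)
next
  assume "(\<Omega> - const3 \<xi>) dvd (u - f)"
  then have "P_class \<Omega> \<xi> u = P_class \<Omega> \<xi> f"
    by (simp add: P_class_eq_iff)
  moreover have "u \<in> P_class \<Omega> \<xi> u"
    by (auto simp: P_class_def P_ideal_def a_r_coset_def r_coset_def cgenideal_def A_Omega_def
        intro: exI[of _ 0])
  ultimately show "u \<in> P_class \<Omega> \<xi> f"
    by simp
qed

lemma carrier_P_Omega: "carrier (P_Omega \<Omega> \<xi>) = range (P_class \<Omega> \<xi>)"
  by (auto simp: P_Omega_def poisson_quotient_def FactRing_def A_RCOSETS_defs P_class_def
      a_r_coset_def r_coset_def A_Omega_def)

lemma smult_P_Omega: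
  "module.smult (P_Omega \<Omega> \<xi>) t (P_class \<Omega> \<xi> f) = P_class \<Omega> \<xi> (const3 t * f)"
proof -
  have "module.smult (P_Omega \<Omega> \<xi>) t (P_class \<Omega> \<xi> f) =
      (\<Union>u\<in>P_class \<Omega> \<xi> f. P_class \<Omega> \<xi> (const3 t * u))"
    by (simp add: P_Omega_def poisson_quotient_def P_class_def A_Omega_def)
  also have "\<dots> = (\<Union>u\<in>P_class \<Omega> \<xi> f. P_class \<Omega> \<xi> (const3 t * f))"
    by (intro SUP_cong refl) (simp add: mem_P_class_iff P_class_eq_iff flip: right_diff_distrib)
  also have "\<dots> = P_class \<Omega> \<xi> (const3 t * f)"
    using mem_P_class_iff[of f \<Omega> \<xi> f] by (intro cSUP_const) auto
  finally show ?thesis .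
qed

lemma pbracket_P_Omega:
  "pbracket (P_Omega \<Omega> \<xi>) (P_class \<Omega> \<xi> f) (P_class \<Omega> \<xi> g) =
     P_class \<Omega> \<xi> (pbracket (A_Omega \<Omega>) f g)"
proof -
  let ?w = "\<Omega> - const3 \<xi>"
  have "P_class \<Omega> \<xi> (jacobian3 u v \<Omega>) = P_class \<Omega> \<xi> (jacobian3 f g \<Omega>)"
    if "u \<in> P_class \<Omega> \<xi> f" "v \<in> P_class \<Omega> \<xi> g" for u v
  proof -
    from that obtain r s where "u - f = ?w * r" "v - g = ?w * s"
      unfolding mem_P_class_iff by (metis dvdE)
    then have uv: "u = f + ?w * r" "v = g + ?w * s"
      by (simp_all add: algebra_simps)
    have w: "partial_x ?w = partial_x \<Omega>" "partial_y ?w = partial_y \<Omega>" "partial_z ?w = partial_z \<Omega>"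
      using partial_derivation(1,3,5)[of ?w "const3 \<xi>"] by simp_all
    define w where "w = ?w"
    note w' = w[folded w_def]
    have "jacobian3 u v \<Omega> - jacobian3 f g \<Omega> =
        w * (jacobian3 f s \<Omega> + jacobian3 r g \<Omega> + w * jacobian3 r s \<Omega>)"
      unfolding uv w_def[symmetric] jacobian3_def partial_derivation w'
      by (simp add: algebra_simps)
    then show ?thesis
      by (simp add: P_class_eq_iff w_def)
  qed
  note * = this
  have ne: "P_class \<Omega> \<xi> h \<noteq> {}" for h
    using mem_P_class_iff[of h \<Omega> \<xi> h] by auto
  have "pbracket (P_Omega \<Omega> \<xi>) (P_class \<Omega> \<xi> f) (P_class \<Omega> \<xi> g) =
      (\<Union>u\<in>P_class \<Omega> \<xi> f. \<Union>v\<in>P_class \<Omega> \<xi> g. P_class \<Omega> \<xi> (jacobian3 u v \<Omega>))"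
    by (simp add: P_Omega_def poisson_quotient_def P_class_def A_Omega_def)
  also have "\<dots> = (\<Union>u\<in>P_class \<Omega> \<xi> f. \<Union>v\<in>P_class \<Omega> \<xi> g. P_class \<Omega> \<xi> (jacobian3 f g \<Omega>))"
    by (intro SUP_cong refl *)
  also have "\<dots> = P_class \<Omega> \<xi> (jacobian3 f g \<Omega>)"
    by (simp only: cSUP_const[OF ne])
  finally show ?thesis
    by (simp add: A_Omega_def)
qed


section \<open>Groups\<close>

definition unit_group :: "'k::field monoid" where
  "unit_group = \<lparr>carrier = UNIV - {0}, monoid.mult = (*), one = 1\<rparr>"

definition G_111 :: "('k::field \<times> 'k \<times> 'k) monoid" where
  "G_111 = (unit_group \<times>\<times> unit_group \<times>\<times> unit_group)
     \<lparr>carrier := {(\<alpha>1, \<alpha>2, \<alpha>3). \<alpha>1 \<noteq> 0 \<and> \<alpha>2 \<noteq> 0 \<and> \<alpha>3 \<noteq> 0 \<and>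
        \<alpha>1 ^ 3 = \<alpha>2 ^ 3 \<and> \<alpha>2 ^ 3 = \<alpha>3 ^ 3 \<and> \<alpha>3 ^ 3 = \<alpha>1 * \<alpha>2 * \<alpha>3}\<rparr>"

definition G'_111 :: "('k::field \<times> 'k \<times> 'k) monoid" where
  "G'_111 = (unit_group \<times>\<times> unit_group \<times>\<times> unit_group)
     \<lparr>carrier := {(\<alpha>1, \<alpha>2, \<alpha>3). \<alpha>1 \<noteq> 0 \<and> \<alpha>2 \<noteq> 0 \<and> \<alpha>3 \<noteq> 0 \<and>
        \<alpha>1 ^ 3 = 1 \<and> \<alpha>2 ^ 3 = 1 \<and> \<alpha>3 ^ 3 = 1 \<and> \<alpha>1 * \<alpha>2 * \<alpha>3 = 1}\<rparr>"

definition G_112 :: "('k::field \<times> 'k) monoid" where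
  "G_112 = (unit_group \<times>\<times> unit_group)
     \<lparr>carrier := {(\<alpha>1, \<alpha>2). \<alpha>1 \<noteq> 0 \<and> \<alpha>2 \<noteq> 0 \<and> \<alpha>1 ^ 2 = \<alpha>2 ^ 2}\<rparr>"

definition G'_112 :: "('k::field \<times> 'k) monoid" where
  "G'_112 = (unit_group \<times>\<times> unit_group)
     \<lparr>carrier := {(\<alpha>1, \<alpha>2). \<alpha>1 \<noteq> 0 \<and> \<alpha>2 \<noteq> 0 \<and>
        \<alpha>1 ^ 4 = 1 \<and> \<alpha>2 ^ 4 = 1 \<and> \<alpha>1 ^ 2 = \<alpha>2 ^ 2}\<rparr>"

text \<open>
  \<open>H \<ltimes> N\<close> for an action \<open>\<phi>\<close> of \<open>H\<close> on \<open>N\<close>: the pair \<open>(h, n)\<close> stands for the product \<open>n h\<close>,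
  and \<open>h n h\<^sup>-\<^sup>1 = \<phi> h n\<close>.
\<close>
definition semidirect ::
    "('h, 'm) monoid_scheme \<Rightarrow> ('n, 'l) monoid_scheme \<Rightarrow> ('h \<Rightarrow> 'n \<Rightarrow> 'n) \<Rightarrow> ('h \<times> 'n) monoid" where
  "semidirect H N \<phi> =
     \<lparr>carrier = carrier H \<times> carrier N,
      monoid.mult = (\<lambda>(h1, n1) (h2, n2). (h1 \<otimes>\<^bsub>H\<^esub> h2, n1 \<otimes>\<^bsub>N\<^esub> \<phi> h1 n2)),
      one = (\<one>\<^bsub>H\<^esub>, \<one>\<^bsub>N\<^esub>)\<rparr>"

text \<open>The elements of \<^term>\<open>integer_mod_group n\<close> are the integers \<open>0, \<dots>, n - 1\<close>.\<close>

definition cyclic3 :: "int \<Rightarrow> 'a \<times> 'a \<times> 'a \<Rightarrow> 'a \<times> 'a \<times> 'a" where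
  "cyclic3 i = (\<lambda>(\<alpha>1, \<alpha>2, \<alpha>3). (\<alpha>2, \<alpha>3, \<alpha>1)) ^^ nat i"

definition cyclic2 :: "int \<Rightarrow> 'a \<times> 'a \<Rightarrow> 'a \<times> 'a" where
  "cyclic2 i = (\<lambda>(\<alpha>1, \<alpha>2). (\<alpha>2, \<alpha>1)) ^^ nat i"

text \<open>
  There is a short exact sequence \<open>1 \<rightarrow> N \<rightarrow> E \<rightarrow> Q \<rightarrow> 1\<close>. The library's
  \<open>short_exact_sequence\<close> requires all groups to have elements of the same type.
\<close>
definition short_exact ::
    "('n, 'p) monoid_scheme \<Rightarrow> ('e, 'q) monoid_scheme \<Rightarrow> ('h, 'r) monoid_scheme \<Rightarrow> bool" where
  "short_exact N E Q \<longleftrightarrow>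
     (\<exists>f g. f \<in> mon N E \<and> g \<in> epi E Q \<and> f ` carrier N = kernel E Q g)"

end

theory Submission
  imports Defs "Berlekamp_Zassenhaus.Unique_Factorization_Poly"
begin

text \<open>
  Two homogeneous factors of \<open>\<Omega>\<close> would have a common zero outside the origin, so \<open>\<Omega>\<close> is prime. A
  Poisson endomorphism of the surface \<open>\<Omega> = 0\<close> that is not constant is injective: some bracket
  of \<open>X, Y, Z\<close> does not vanish, hence two of them are algebraically independent on the surface.
  This applies to the leading (or lowest) forms of a Poisson automorphism, taken with respect to the
  extremal ratio \<open>p / q\<close> of the degrees of \<open>X, Y, Z\<close> to the weights, which therefore scale degrees
  by \<open>p / q\<close>; surjectivity and the existence of a smallest positive degree bound this ratio by \<open>1\<close>.
  So an automorphism of \<open>P\<^bsub>\<Omega> - \<xi>\<^esub>\<close> is given by \<open>X, Y, Z\<close> of degrees at most \<open>a, b, c\<close>. As these are less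
  than \<open>a + b + c\<close>, all relations hold in \<open>A\<close>, and every automorphism lifts to a Poisson automorphism
  of \<open>A\<^sub>\<Omega>\<close>, which multiplies \<open>\<Omega>\<close> by the Jacobian determinant and is graded.
\<close>


section \<open>Monomials and substitution\<close>

text \<open>Since \<Omega> has degree a + b + c, the bracket adds degrees, and in each relation such
  as {X, Y} = \<Omega>_z(X, Y, Z) both sides scale alike. Leading forms therefore satisfy the same
  relations, but only modulo \<Omega>, whatever \<xi> is; this is why injectivity is studied on the
  cone \<Omega> = 0 even for \<xi> \<noteq> 0. Two obstacles shape the argument. In a quotient a
  degree has a meaning only for representatives whose extreme component is not divisible by \<Omega>
  (\<open>red\<close>). And for \<xi> \<noteq> 0 lowest forms say nothing modulo \<Omega> - \<xi>,
  whose lowest form is a constant. So upper bounds come first; they make the lift to A exact, and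
  only in A do lowest forms give the lower bounds. An automorphism of A has to be bounded from above
  separately: if the ratio exceeded 1, its leading forms would satisfy \<Omega>(X0, Y0, Z0) = 0
  identically, and the map they define kills \<Omega>. It is then regarded as a map from the algebra
  of the cone to that of the surface \<Omega> = 1.\<close>

definition mon3 :: "'k::comm_ring_1 \<Rightarrow> nat \<Rightarrow> nat \<Rightarrow> nat \<Rightarrow> 'k poly3" where
  "mon3 e i j k = monom (monom (monom e i) j) k"

lemma poly3_eq_iff: "f = g \<longleftrightarrow> (\<forall>i j k. coeff3 f i j k = coeff3 g i j k)"
  by (auto simp: coeff3_def poly_eq_iff)

lemma poly3_eqI: "(\<And>i j k. coeff3 f i j k = coeff3 g i j k) \<Longrightarrow> f = g"
  by (simp add: poly3_eq_iff)

lemma coeff3_simps [simp]: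
  "coeff3 0 i j k = 0"
  "coeff3 (f + g) i j k = coeff3 f i j k + coeff3 g i j k"
  "coeff3 (f - g) i j k = coeff3 f i j k - coeff3 g i j k"
  "coeff3 (- f) i j k = - coeff3 f i j k"
  by (simp_all add: coeff3_def)

lemma coeff3_sum: "coeff3 (sum f A) i j k = (\<Sum>x\<in>A. coeff3 (f x) i j k)"
  by (induction A rule: infinite_finite_induct) simp_all

lemma coeff3_mon3: "coeff3 (mon3 e i j k) i' j' k' = (if i = i' \<and> j = j' \<and> k = k' then e else 0)"
  by (simp add: coeff3_def mon3_def)

lemma coeff3_const3_mult [simp]: "coeff3 (const3 e * f) i j k = e * coeff3 f i j k"
  by (simp add: coeff3_def const3_def)

lemma mon3_eq:
  fixes e :: "'k::comm_ring_1"
  shows "mon3 e i j k = const3 e * varX ^ i * varY ^ j * varZ ^ k"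
proof -
  have v: "const3 e = monom (monom (monom e 0) 0) 0" "(varX :: 'k poly3) = monom (monom (monom 1 1) 0) 0"
    "(varY :: 'k poly3) = monom (monom 1 1) 0" "(varZ :: 'k poly3) = monom 1 1"
    by (simp_all add: const3_def varX_def varY_def varZ_def monom_0 x_as_monom monom_Suc)
  show ?thesis
    unfolding v mon3_def by (simp add: monom_power mult_monom)
qed

lemma poly_additive_induct:
  assumes "P 0" "\<And>p q. P p \<Longrightarrow> P q \<Longrightarrow> P (p + q)" "\<And>c n. P (monom c n)"
  shows "P p"
proof -
  have "P (\<Sum>i\<in>A. monom (coeff p i) i)" for A
    by (induction A rule: infinite_finite_induct) (simp_all add: assms)
  then show ?thesis
    by (metis poly_as_sum_of_monoms)
qed

lemma poly3_induct_mon [case_names zero add mon]: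
  assumes "P 0" "\<And>f g. P f \<Longrightarrow> P g \<Longrightarrow> P (f + g)" "\<And>e i j k. P (mon3 e i j k)"
  shows "P f"
proof (rule poly_additive_induct[of P])
  fix c :: "'a poly poly" and k
  show "P (monom c k)"
  proof (rule poly_additive_induct[where P = "\<lambda>c. P (monom c k)"])
    fix d :: "'a poly" and j
    show "P (monom (monom d j) k)"
      by (rule poly_additive_induct[where P = "\<lambda>c. P (monom (monom c j) k)"])
        (use assms in \<open>auto simp: add_monom[symmetric] mon3_def\<close>)
  qed (use assms in \<open>auto simp: add_monom[symmetric]\<close>)
qed (use assms(1,2) in blast)+

lemma poly3_induct [case_names const X Y Z add mult]:
  assumes "\<And>e. P (const3 e)" "P varX" "P varY" "P varZ"
    "\<And>f g. P f \<Longrightarrow> P g \<Longrightarrow> P (f + g)" "\<And>f g. P f \<Longrightarrow> P g \<Longrightarrow> P (f * g)"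
  shows "P f"
proof (rule poly3_induct_mon[of P])
  have "const3 1 = (1 :: 'a poly3)"
    by (simp add: const3_def flip: one_pCons)
  then have one: "P 1"
    using assms(1)[of 1] by simp
  have pow: "P (g ^ n)" if "P g" for g n
  proof (induction n)
    case 0
    show ?case
      unfolding power_0 by (rule one)
  next
    case (Suc n)
    show ?case
      unfolding power_Suc by (rule assms(6)[OF that Suc])
  qed
  show "P (mon3 e i j k)" for e i j k
    unfolding mon3_eq
    by (rule assms(6)[OF assms(6)[OF assms(6)[OF assms(1) pow[OF assms(2)]] pow[OF assms(3)]] pow[OF assms(4)]])
  have "const3 0 = (0 :: 'a poly3)"
    by (simp add: const3_def)
  then show "P 0"
    using assms(1)[of 0] by simp
qed (rule assms(5))

lemma const3_simps:
  "const3 0 = 0" "const3 1 = 1" "const3 (x + y) = const3 x + const3 y"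
  "const3 (x - y) = const3 x - const3 y" "const3 (- x) = - const3 x"
  "const3 (x * y) = const3 x * const3 y"
  by (simp_all add: const3_def flip: one_pCons)

lemma const3_hom: "comm_ring_hom const3"
  by unfold_locales (simp_all add: const3_simps)

lemma const3_power: "const3 (x ^ n) = const3 x ^ n"
  by (induction n) (simp_all add: const3_simps)

lemma const3_numeral: "const3 (numeral n) = numeral n"
proof -
  interpret comm_ring_hom const3 by (rule const3_hom)
  show ?thesis
    using hom_of_nat[of "numeral n"] by simp
qed

lemma const3_eq_iff [simp]: "const3 x = const3 y \<longleftrightarrow> x = y" "const3 x = 0 \<longleftrightarrow> x = 0"
  by (simp_all add: const3_def)

lemma comm_ring_hom_poly:
  assumes "comm_ring_hom h"
  shows "comm_ring_hom (\<lambda>p. poly (map_poly h p) x)"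
proof -
  interpret h: comm_ring_hom h by fact
  interpret m: map_poly_comm_ring_hom h ..
  show ?thesis
    by unfold_locales (simp_all add: m.hom_add m.hom_mult m.hom_one)
qed

text \<open>The universal property of the polynomial ring, for an arbitrary commutative target:
  besides substitution into the ring itself it yields \<open>gr\<close>, whose values are
  polynomials in one more variable.\<close>

definition ext3 :: "('k::comm_ring_1 \<Rightarrow> 'r::comm_ring_1) \<Rightarrow> 'r \<Rightarrow> 'r \<Rightarrow> 'r \<Rightarrow> 'k poly3 \<Rightarrow> 'r" where
  "ext3 h X Y Z f = poly (map_poly (\<lambda>p. poly (map_poly (\<lambda>q. poly (map_poly h q) X) p) Y) f) Z"

lemma ext3_hom: "comm_ring_hom h \<Longrightarrow> comm_ring_hom (ext3 h X Y Z)"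
  unfolding ext3_def [abs_def] by (intro comm_ring_hom_poly)

lemma ext3_gen:
  assumes "comm_ring_hom h"
  shows "ext3 h X Y Z (const3 e) = h e" "ext3 h X Y Z varX = X" "ext3 h X Y Z varY = Y"
    "ext3 h X Y Z varZ = Z"
proof -
  interpret h: comm_ring_hom h by fact
  show "ext3 h X Y Z (const3 e) = h e"
    by (cases "e = 0") (simp_all add: ext3_def const3_def map_poly_pCons)
  show "ext3 h X Y Z varX = X" "ext3 h X Y Z varY = Y" "ext3 h X Y Z varZ = Z"
    by (simp_all add: ext3_def varX_def varY_def varZ_def map_poly_pCons flip: one_pCons)
qed

lemma comm_ring_hom_eqI:
  assumes "comm_ring_hom \<phi>" "comm_ring_hom \<psi>"
    and "\<And>e. \<phi> (const3 e) = \<psi> (const3 e)" "\<phi> varX = \<psi> varX" "\<phi> varY = \<psi> varY" "\<phi> varZ = \<psi> varZ"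
  shows "\<phi> f = \<psi> f"
proof -
  interpret \<phi>: comm_ring_hom \<phi> by fact
  interpret \<psi>: comm_ring_hom \<psi> by fact
  show ?thesis
    by (induction f rule: poly3_induct) (simp_all add: assms \<phi>.hom_add \<phi>.hom_mult \<psi>.hom_add \<psi>.hom_mult)
qed

lemma comm_ring_hom_comp: "comm_ring_hom f \<Longrightarrow> comm_ring_hom g \<Longrightarrow> comm_ring_hom (\<lambda>x. f (g x))"
proof -
  assume "comm_ring_hom f" "comm_ring_hom g"
  then interpret f: comm_ring_hom f + g: comm_ring_hom g by auto
  show ?thesis
    by unfold_locales (simp_all add: f.hom_add f.hom_mult g.hom_add g.hom_mult)
qed

definition sub :: "'k::comm_ring_1 poly3 \<Rightarrow> 'k poly3 \<Rightarrow> 'k poly3 \<Rightarrow> 'k poly3 \<Rightarrow> 'k poly3" where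
  "sub X Y Z f = ext3 const3 X Y Z f"

lemma sub_hom: "comm_ring_hom (sub X Y Z)"
  unfolding sub_def [abs_def] by (intro ext3_hom const3_hom)

lemma sub_simps [simp]:
  "sub X Y Z (const3 e) = const3 e" "sub X Y Z varX = X" "sub X Y Z varY = Y"
  "sub X Y Z varZ = Z" "sub X Y Z (f + g) = sub X Y Z f + sub X Y Z g"
  "sub X Y Z (f * g) = sub X Y Z f * sub X Y Z g" "sub X Y Z 0 = 0" "sub X Y Z 1 = 1"
  "sub X Y Z (- f) = - sub X Y Z f" "sub X Y Z (f - g) = sub X Y Z f - sub X Y Z g"
  "sub X Y Z (f ^ n) = sub X Y Z f ^ n" "sub X Y Z (numeral m) = numeral m"
proof -
  interpret comm_ring_hom "sub X Y Z" by (rule sub_hom)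
  show "sub X Y Z (f + g) = sub X Y Z f + sub X Y Z g"
    "sub X Y Z (f * g) = sub X Y Z f * sub X Y Z g" "sub X Y Z 0 = 0" "sub X Y Z 1 = 1"
    "sub X Y Z (- f) = - sub X Y Z f" "sub X Y Z (f - g) = sub X Y Z f - sub X Y Z g"
    "sub X Y Z (f ^ n) = sub X Y Z f ^ n"
    by (simp_all add: hom_add hom_mult hom_uminus hom_minus hom_power)
  show "sub X Y Z (numeral m) = numeral m"
    using hom_of_nat[of "numeral m"] by simp
qed (simp_all add: sub_def ext3_gen const3_hom)

lemma sub_sum: "sub X Y Z (sum f A) = (\<Sum>x\<in>A. sub X Y Z (f x))"
  by (induction A rule: infinite_finite_induct) simp_all

lemma sub_sub: "sub X Y Z (sub U V W f) = sub (sub X Y Z U) (sub X Y Z V) (sub X Y Z W) f"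
  by (rule comm_ring_hom_eqI[OF comm_ring_hom_comp[OF sub_hom sub_hom] sub_hom]) simp_all

lemma sub_id [simp]: "sub varX varY varZ f = f"
  by (rule comm_ring_hom_eqI[OF sub_hom]) (unfold_locales, simp_all)

lemma sub_dvd: "f dvd g \<Longrightarrow> sub X Y Z f dvd sub X Y Z g"
  by (auto elim!: dvdE)

lemma eval3_hom: "comm_ring_hom (\<lambda>f. eval3 f x y z)"
  by unfold_locales (simp_all add: eval3_def)

lemma eval3_simps [simp]:
  "eval3 (const3 e) x y z = e" "eval3 varX x y z = x" "eval3 varY x y z = y" "eval3 varZ x y z = z"
  "eval3 (f + g) x y z = eval3 f x y z + eval3 g x y z"
  "eval3 (f * g) x y z = eval3 f x y z * eval3 g x y z"
  "eval3 0 x y z = 0" "eval3 1 x y z = 1" "eval3 (- f) x y z = - eval3 f x y z"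
  "eval3 (f - g) x y z = eval3 f x y z - eval3 g x y z" "eval3 (f ^ n) x y z = eval3 f x y z ^ n"
  by (simp_all add: eval3_def const3_def varX_def varY_def varZ_def)

lemma eval3_sub:
  "eval3 (sub X Y Z f) x y z = eval3 f (eval3 X x y z) (eval3 Y x y z) (eval3 Z x y z)"
  by (rule comm_ring_hom_eqI[OF comm_ring_hom_comp[OF eval3_hom sub_hom] eval3_hom]) simp_all

lemma poly_zero_of_roots:
  fixes p :: "'a::{idom, ring_char_0} poly"
  assumes "\<And>x. poly p (h x) = 0" "inj (h :: nat \<Rightarrow> 'a)"
  shows "p = 0"
proof (rule ccontr)
  assume "p \<noteq> 0"
  then have "finite {x. poly p x = 0}"
    by (rule poly_roots_finite)
  moreover have "range h \<subseteq> {x. poly p x = 0}"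
    using assms by auto
  ultimately show False
    using assms(2) finite_subset range_inj_infinite by blast
qed

text \<open>Characteristic zero supplies infinitely many arguments \<open>of_nat n\<close>. The
  variables are removed one after another, each time from a polynomial with infinitely many roots in
  a domain.\<close>

lemma eval3_zero_imp_zero:
  fixes f :: "'k::{idom, ring_char_0} poly3"
  assumes "\<And>x y z. eval3 f x y z = 0"
  shows "f = 0"
proof -
  have "poly (poly f [:[:z:]:]) [:y:] = 0" for y z
    by (rule poly_zero_of_roots[of _ of_nat]) (use assms in \<open>auto simp: eval3_def inj_on_def\<close>)
  then have "poly f [:[:z:]:] = 0" for z
    by (intro poly_zero_of_roots[of _ "\<lambda>n. [:of_nat n:]"]) (auto simp: inj_on_def)
  then show ?thesis
    by (intro poly_zero_of_roots[of _ "\<lambda>n. [:[:of_nat n:]:]"]) (auto simp: inj_on_def)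
qed

section \<open>Derivations\<close>

lemma partial_simps [simp]:
  "partial_x 0 = 0" "partial_y 0 = 0" "partial_z 0 = 0"
  by (simp_all add: partial_x_def partial_y_def partial_z_def)

lemma coeff3_partial:
  "coeff3 (partial_x f) i j k = of_nat (Suc i) * coeff3 f (Suc i) j k"
  "coeff3 (partial_y f) i j k = of_nat (Suc j) * coeff3 f i (Suc j) k"
  "coeff3 (partial_z f) i j k = of_nat (Suc k) * coeff3 f i j (Suc k)"
  by (simp_all add: coeff3_def partial_x_def partial_y_def partial_z_def coeff_map_poly coeff_pderiv
      of_nat_poly mult_poly_add_left flip: of_nat_Suc)

lemma partial_minus:
  "partial_x (f - g) = partial_x f - partial_x g" "partial_x (- f) = - partial_x f"
  "partial_y (f - g) = partial_y f - partial_y g" "partial_y (- f) = - partial_y f"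
  "partial_z (f - g) = partial_z f - partial_z g" "partial_z (- f) = - partial_z f"
  by (simp_all add: poly3_eq_iff coeff3_partial algebra_simps)

text \<open>The chain rule: both sides are additive and obey the Leibniz rule along
  \<open>sub X Y Z\<close>, so comparing them on generators suffices. \<open>Dx\<close>,
  \<open>Dy\<close>, \<open>Dz\<close> stand for the partial derivatives and \<open>D\<close> for
  any one of them, so that a single induction serves all three claims of
  \<open>partial_sub\<close>.\<close>

lemma derivation_sub:
  fixes D :: "'k::comm_ring_1 poly3 \<Rightarrow> 'k poly3"
  assumes "\<And>f g. D (f + g) = D f + D g" "\<And>f g. D (f * g) = f * D g + D f * g"
    and "\<And>e. D (const3 e) = 0"
  and "\<And>f g. Dx (f + g) = Dx f + Dx g" "\<And>f g. Dx (f * g) = f * Dx g + Dx f * g"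
    "\<And>e. Dx (const3 e) = 0" "Dx varX = 1" "Dx varY = 0" "Dx varZ = 0"
  and "\<And>f g. Dy (f + g) = Dy f + Dy g" "\<And>f g. Dy (f * g) = f * Dy g + Dy f * g"
    "\<And>e. Dy (const3 e) = 0" "Dy varX = 0" "Dy varY = 1" "Dy varZ = 0"
  and "\<And>f g. Dz (f + g) = Dz f + Dz g" "\<And>f g. Dz (f * g) = f * Dz g + Dz f * g"
    "\<And>e. Dz (const3 e) = 0" "Dz varX = 0" "Dz varY = 0" "Dz varZ = 1"
  shows "D (sub X Y Z f) = sub X Y Z (Dx f) * D X + sub X Y Z (Dy f) * D Y + sub X Y Z (Dz f) * D Z"
  by (induction f rule: poly3_induct) (simp_all add: assms algebra_simps)

lemma partial_sub:
  fixes X Y Z :: "'k::idom poly3"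
  shows "partial_x (sub X Y Z f) = sub X Y Z (partial_x f) * partial_x X
      + sub X Y Z (partial_y f) * partial_x Y + sub X Y Z (partial_z f) * partial_x Z"
    "partial_y (sub X Y Z f) = sub X Y Z (partial_x f) * partial_y X
      + sub X Y Z (partial_y f) * partial_y Y + sub X Y Z (partial_z f) * partial_y Z"
    "partial_z (sub X Y Z f) = sub X Y Z (partial_x f) * partial_z X
      + sub X Y Z (partial_y f) * partial_z Y + sub X Y Z (partial_z f) * partial_z Z"
  by (rule derivation_sub; (rule partial_derivation partial_const3 partial_generators))+

text \<open>Bracketing with g is a derivation that kills constants. In this form it turns a
  polynomial relation between X, Y, Z into a linear relation between their brackets.\<close>

lemma jacobian3_sub:
  fixes X Y Z g \<Omega> :: "'k::idom poly3"
  shows "jacobian3 (sub X Y Z f) g \<Omega> = sub X Y Z (partial_x f) * jacobian3 X g \<Omega>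
      + sub X Y Z (partial_y f) * jacobian3 Y g \<Omega> + sub X Y Z (partial_z f) * jacobian3 Z g \<Omega>"
  unfolding jacobian3_def partial_sub by (simp add: algebra_simps)

lemma jacobian3_simps:
  fixes f g h \<Omega> :: "'k::idom poly3"
  shows "jacobian3 0 g \<Omega> = 0" "jacobian3 f 0 \<Omega> = 0"
    "jacobian3 (f + h) g \<Omega> = jacobian3 f g \<Omega> + jacobian3 h g \<Omega>"
    "jacobian3 f (g + h) \<Omega> = jacobian3 f g \<Omega> + jacobian3 f h \<Omega>"
    "jacobian3 (f * h) g \<Omega> = f * jacobian3 h g \<Omega> + h * jacobian3 f g \<Omega>"
    "jacobian3 f g \<Omega> = - jacobian3 g f \<Omega>" "jacobian3 f f \<Omega> = 0"
    "jacobian3 (const3 e) g \<Omega> = 0" "jacobian3 \<Omega> g \<Omega> = 0"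
  unfolding jacobian3_def partial_derivation by (simp_all add: algebra_simps)

section \<open>Weighted gradings\<close>

text \<open>\<open>gr a b c\<close> sends a homogeneous element \<open>f\<close> of degree \<open>n\<close> to \<open>f t\<^sup>n\<close>.\<close>
definition gr :: "nat \<Rightarrow> nat \<Rightarrow> nat \<Rightarrow> 'k::comm_ring_1 poly3 \<Rightarrow> 'k poly3 poly" where
  "gr a b c f = ext3 (\<lambda>e. [:const3 e:]) (monom varX a) (monom varY b) (monom varZ c) f"

lemma gr_hom: "comm_ring_hom (gr a b c)"
  unfolding gr_def [abs_def]
  by (intro ext3_hom) (unfold_locales, simp_all add: const3_simps flip: one_pCons)

lemma gr_simps [simp]:
  "gr a b c (const3 e) = [:const3 e:]" "gr a b c varX = monom varX a"
  "gr a b c varY = monom varY b" "gr a b c varZ = monom varZ c"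
  "gr a b c (f + g) = gr a b c f + gr a b c g" "gr a b c (f * g) = gr a b c f * gr a b c g"
  "gr a b c 0 = 0" "gr a b c 1 = 1" "gr a b c (- f) = - gr a b c f"
  "gr a b c (f - g) = gr a b c f - gr a b c g" "gr a b c (f ^ n) = gr a b c f ^ n"
proof -
  interpret comm_ring_hom "gr a b c" by (rule gr_hom)
  show "gr a b c (f + g) = gr a b c f + gr a b c g" "gr a b c (f * g) = gr a b c f * gr a b c g"
    "gr a b c 0 = 0" "gr a b c 1 = 1" "gr a b c (- f) = - gr a b c f"
    "gr a b c (f - g) = gr a b c f - gr a b c g" "gr a b c (f ^ n) = gr a b c f ^ n"
    by (simp_all add: hom_add hom_mult hom_uminus hom_minus hom_power)
  have h: "comm_ring_hom (\<lambda>e. [:const3 e:])"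
    by unfold_locales (simp_all add: const3_simps flip: one_pCons)
  show "gr a b c (const3 e) = [:const3 e:]" "gr a b c varX = monom varX a"
    "gr a b c varY = monom varY b" "gr a b c varZ = monom varZ c"
    by (simp_all add: gr_def ext3_gen[OF h])
qed

lemma gr_mon3: "gr a b c (mon3 e i j k) = monom (mon3 e i j k) (a * i + b * j + c * k)"
  by (simp add: mon3_eq monom_power mult_monom smult_monom algebra_simps)

lemma coeff3_coeff_gr:
  "coeff3 (coeff (gr a b c f) n) i j k = (if a * i + b * j + c * k = n then coeff3 f i j k else 0)"
  by (induction f rule: poly3_induct_mon) (auto simp: gr_mon3 coeff3_mon3)

lemma poly_gr_1: "poly (gr a b c f) 1 = f"
  by (induction f rule: poly3_induct_mon) (simp_all add: gr_mon3 poly_monom)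

text \<open>As \<open>gr\<close> is a ring homomorphism, a product of homogeneous elements becomes a
  product of monomials in the auxiliary variable.\<close>

lemma homogeneous3_iff_gr: "f \<in> homogeneous3 a b c n \<longleftrightarrow> gr a b c f = monom f n"
proof
  assume *: "f \<in> homogeneous3 a b c n"
  show "gr a b c f = monom f n"
  proof (rule poly_eqI, rule poly3_eqI)
    show "coeff3 (coeff (gr a b c f) m) i j k = coeff3 (coeff (monom f n) m) i j k" for m i j k
      using * by (auto simp: coeff3_coeff_gr homogeneous3_def)
  qed
next
  assume *: "gr a b c f = monom f n"
  have "a * i + b * j + c * k = n" if "coeff3 f i j k \<noteq> 0" for i j k
  proof (rule ccontr)
    assume "a * i + b * j + c * k \<noteq> n"
    then have "coeff (gr a b c f) (a * i + b * j + c * k) = 0"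
      by (simp add: *)
    then show False
      using coeff3_coeff_gr[of a b c f "a * i + b * j + c * k" i j k] that by simp
  qed
  then show "f \<in> homogeneous3 a b c n"
    by (auto simp: homogeneous3_def)
qed


text \<open>Degrees are integers because partial derivatives and complementary degrees
  \<open>n - i\<close> can lead below 0; components there are 0, which avoids side
  conditions.\<close>

definition cmp :: "nat \<Rightarrow> nat \<Rightarrow> nat \<Rightarrow> int \<Rightarrow> 'k::comm_ring_1 poly3 \<Rightarrow> 'k poly3" where
  "cmp a b c n f = (if n < 0 then 0 else coeff (gr a b c f) (nat n))"

lemma coeff3_cmp:
  "coeff3 (cmp a b c n f) i j k = (if int (a * i + b * j + c * k) = n then coeff3 f i j k else 0)"
proof (cases n)
  case (nonneg m)
  then show ?thesis
    by (simp add: cmp_def coeff3_coeff_gr del: of_nat_add of_nat_mult)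
next
  case (neg m)
  then have "n < 0" "int (a * i + b * j + c * k) \<noteq> n"
    by linarith+
  then show ?thesis
    by (simp add: cmp_def)
qed

locale weights =
  fixes a b c :: nat
  assumes pos: "a > 0" "b > 0" "c > 0"
begin

abbreviation C :: "int \<Rightarrow> 'k::comm_ring_1 poly3 \<Rightarrow> 'k poly3" where "C \<equiv> cmp a b c"

definition hom :: "int \<Rightarrow> 'k::comm_ring_1 poly3 \<Rightarrow> bool" where "hom n f \<longleftrightarrow> C n f = f"

definition supp :: "'k::comm_ring_1 poly3 \<Rightarrow> int set" where "supp f = {n. C n f \<noteq> 0}"

lemma cmp_simps [simp]:
  "C n 0 = 0" "C n (f + g) = C n f + C n g" "C n (f - g) = C n f - C n g" "C n (- f) = - C n f"
  "C n (const3 e * f) = const3 e * C n f"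
  by (simp_all add: poly3_eq_iff coeff3_cmp)

lemma cmp_sum: "C n (sum f A) = (\<Sum>x\<in>A. C n (f x))"
  by (induction A rule: infinite_finite_induct) simp_all

lemma cmp_cmp: "C n (C m f) = (if n = m then C m f else 0)"
  by (auto simp: poly3_eq_iff coeff3_cmp)

lemma hom_cmp [simp]: "hom n (C n f)"
  by (simp add: hom_def cmp_cmp)

lemma hom_iff: "hom n f \<longleftrightarrow> (\<forall>i j k. coeff3 f i j k \<noteq> 0 \<longrightarrow> int (a * i + b * j + c * k) = n)"
  unfolding hom_def poly3_eq_iff coeff3_cmp by metis

lemma hom_homogeneous3: "hom (int n) f \<longleftrightarrow> f \<in> homogeneous3 a b c n"
  by (auto simp: hom_iff homogeneous3_def simp del: of_nat_add of_nat_mult)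

lemma cmp_hom: "hom m f \<Longrightarrow> C n f = (if n = m then f else 0)"
  by (metis cmp_cmp hom_def)

lemma hom_mon3: "hom (int (a * i + b * j + c * k)) (mon3 e i j k)"
  by (simp add: hom_iff coeff3_mon3)

lemma cmp_mon3: "C n (mon3 e i j k) = (if n = int (a * i + b * j + c * k) then mon3 e i j k else 0)"
  using cmp_hom hom_mon3 by blast

lemma hom_0 [simp]: "hom n 0"
  by (simp add: hom_def)

lemma hom_add: "hom n f \<Longrightarrow> hom n g \<Longrightarrow> hom n (f + g)" and hom_diff: "hom n f \<Longrightarrow> hom n g \<Longrightarrow> hom n (f - g)"
  and hom_uminus: "hom n f \<Longrightarrow> hom n (- f)" and hom_const_mult: "hom n f \<Longrightarrow> hom n (const3 e * f)"
  by (simp_all add: hom_def)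

lemma hom_gen: "hom (int a) varX" "hom (int b) varY" "hom (int c) varZ" "hom 0 (const3 e)"
  using hom_mon3[of 1 0 0 1] hom_mon3[of 0 1 0 1] hom_mon3[of 0 0 1 1] hom_mon3[of 0 0 0 e]
  by (simp_all add: mon3_eq const3_simps)

lemma hom_neg: "hom n f \<Longrightarrow> n < 0 \<Longrightarrow> f = 0"
  by (simp add: hom_def cmp_def)

lemma cmp_neg: "n < 0 \<Longrightarrow> C n f = 0"
  by (simp add: cmp_def)

lemma hom_unique: "hom m f \<Longrightarrow> hom n f \<Longrightarrow> f \<noteq> 0 \<Longrightarrow> m = n"
  by (metis cmp_hom hom_def)

text \<open>This rests on the positivity of the weights: a monomial with a positive exponent has
  positive degree.\<close>

lemma hom_zero_const: "hom 0 f \<Longrightarrow> \<exists>e. f = const3 e"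
proof
  assume "hom 0 f"
  then have *: "coeff3 f i j k \<noteq> 0 \<Longrightarrow> a * i + b * j + c * k = 0" for i j k
    unfolding hom_iff by (metis of_nat_eq_0_iff)
  have "f = mon3 (coeff3 f 0 0 0) 0 0 0"
    by (rule poly3_eqI) (use * pos in \<open>fastforce simp: coeff3_mon3\<close>)
  then show "f = const3 (coeff3 f 0 0 0)"
    by (simp add: mon3_eq)
qed

lemma supp_eq: "supp f \<subseteq> int ` {..degree (gr a b c f)}"
proof
  fix n assume "n \<in> supp f"
  then have "n \<ge> 0" "coeff (gr a b c f) (nat n) \<noteq> 0"
    by (auto simp: supp_def cmp_def split: if_splits)
  then show "n \<in> int ` {..degree (gr a b c f)}"
    by (intro image_eqI[of _ _ "nat n"]) (auto simp: le_degree)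
qed

lemma finite_supp [simp]: "finite (supp f)"
  using supp_eq by (rule finite_subset) simp

lemma sum_cmp: "(\<Sum>n\<in>supp f. C n f) = f"
proof -
  have "f = (\<Sum>i\<le>degree (gr a b c f). coeff (gr a b c f) i)"
    using poly_gr_1[of a b c f] by (simp add: poly_altdef)
  also have "\<dots> = (\<Sum>n\<in>int ` {..degree (gr a b c f)}. C n f)"
    by (subst sum.reindex) (auto simp: cmp_def)
  also have "\<dots> = (\<Sum>n\<in>supp f. C n f)"
    by (rule sum.mono_neutral_right) (use supp_eq in \<open>auto simp: supp_def\<close>)
  finally show ?thesis by simp
qed

lemma eq_of_cmp: "(\<And>n. C n f = C n g) \<Longrightarrow> f = g"
proof -
  assume *: "\<And>n. C n f = C n g"
  then have "supp f = supp g"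
    by (simp add: supp_def)
  then have "(\<Sum>n\<in>supp f. C n f) = (\<Sum>n\<in>supp g. C n g)"
    by (simp add: *)
  then show ?thesis
    by (simp only: sum_cmp)
qed

lemma hom_mult:
  assumes "hom m f" "hom n g"
  shows "hom (m + n) (f * g)"
proof (cases "m < 0 \<or> n < 0")
  case True
  then show ?thesis
    using assms hom_neg by fastforce
next
  case False
  then obtain m' n' where [simp]: "m = int m'" "n = int n'"
    by (metis nat_0_le not_less)
  have "hom (int (m' + n')) (f * g)"
    using assms unfolding \<open>m = _\<close> \<open>n = _\<close> hom_homogeneous3 homogeneous3_iff_gr
    by (simp add: mult_monom)
  then show ?thesis by simp
qed

lemma hom_partial:
  assumes "hom n f"
  shows "hom (n - int a) (partial_x f)" "hom (n - int b) (partial_y f)" "hom (n - int c) (partial_z f)"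
proof -
  have *: "coeff3 f i j k \<noteq> 0 \<Longrightarrow> n = int (a * i + b * j + c * k)" for i j k
    using assms by (metis hom_iff)
  show "hom (n - int a) (partial_x f)" "hom (n - int b) (partial_y f)" "hom (n - int c) (partial_z f)"
    unfolding hom_iff coeff3_partial
    by (intro allI impI; drule mult_not_zero; elim conjE; drule *; simp add: algebra_simps)+
qed

lemma hom_jacobian3:
  assumes "hom m f" "hom n g" "hom (int (a + b + c)) \<Omega>"
  shows "hom (m + n) (jacobian3 f g \<Omega>)"
proof -
  have m: "hom k (u * (v * w))" if "hom i u" "hom j v" "hom l w" "k = i + j + l" for i j k l u v w
    using hom_mult[OF that(1) hom_mult[OF that(2,3)]] that(4) by (simp add: algebra_simps)
  note h = hom_partial[OF assms(1)] hom_partial[OF assms(2)] hom_partial[OF assms(3)]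
  show ?thesis
    unfolding jacobian3_def right_diff_distrib
    by (intro hom_add hom_diff; rule m, (rule h)+) simp_all
qed

end

text \<open>Multiplication and bracket are both biadditive and add degrees; for the bracket the
  degree a + b + c of \<Omega> makes up for what the three differentiations take away. Extreme
  components are thus treated once for both products.\<close>

locale graded_product = weights +
  fixes B :: "'k::comm_ring_1 poly3 \<Rightarrow> 'k poly3 \<Rightarrow> 'k poly3"
  assumes Badd: "B (f + g) h = B f h + B g h" "B h (f + g) = B h f + B h g"
    and Bhom: "hom m f \<Longrightarrow> hom n g \<Longrightarrow> hom (m + n) (B f g)"
begin

lemma B0 [simp]: "B 0 h = 0" "B h 0 = 0"
  using Badd(1)[of 0 0 h] Badd(2)[of h 0 0] by simp_all

lemma Bsum: "B (sum f A) h = (\<Sum>x\<in>A. B (f x) h)" "B h (sum f A) = (\<Sum>x\<in>A. B h (f x))"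
  by (induction A rule: infinite_finite_induct) (simp_all add: Badd)

lemma cmp_B: "C n (B f g) = (\<Sum>i\<in>supp f. B (C i f) (C (n - i) g))"
proof -
  have "B f g = (\<Sum>i\<in>supp f. \<Sum>j\<in>supp g. B (C i f) (C j g))"
    using Bsum(1)[of "\<lambda>i. C i f" "supp f" g] Bsum(2)[of _ "\<lambda>i. C i g" "supp g"]
    by (simp only: sum_cmp)
  then have "C n (B f g) = (\<Sum>i\<in>supp f. \<Sum>j\<in>supp g. C n (B (C i f) (C j g)))"
    by (simp add: cmp_sum)
  also have "\<dots> = (\<Sum>i\<in>supp f. \<Sum>j\<in>supp g. if n - i = j then B (C i f) (C j g) else 0)"
    by (intro sum.cong refl) (auto simp: cmp_hom[OF Bhom[OF hom_cmp hom_cmp]])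
  also have "\<dots> = (\<Sum>i\<in>supp f. B (C i f) (C (n - i) g))"
  proof (intro sum.cong refl)
    fix i
    show "(\<Sum>j\<in>supp g. if n - i = j then B (C i f) (C j g) else 0) = B (C i f) (C (n - i) g)"
      by (subst sum.delta'[OF finite_supp]) (auto simp: supp_def)
  qed
  finally show ?thesis .
qed

end

context weights
begin

text \<open>
  \<open>lead \<epsilon> q r f f0\<close>: all components of \<open>f\<close> have degree at most (for \<open>\<epsilon> = 1\<close>) or at least
  (for \<open>\<epsilon> = -1\<close>) \<open>r / q\<close>, and \<open>f0\<close> is the component of degree \<open>r / q\<close>, which is \<open>0\<close> if this is
  not an integer.
\<close>
definition lead :: "int \<Rightarrow> int \<Rightarrow> int \<Rightarrow> 'k::comm_ring_1 poly3 \<Rightarrow> 'k poly3 \<Rightarrow> bool" where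
  "lead \<epsilon> q r f f0 \<longleftrightarrow> (\<forall>n. C n f \<noteq> 0 \<longrightarrow> 0 \<le> \<epsilon> * (r - q * n)) \<and>
     f0 = (if q dvd r then C (r div q) f else 0)"

text \<open>The defects \<open>\<epsilon> * (r - q * i)\<close> and
  \<open>\<epsilon> * (s - q * (n - i))\<close> are nonnegative and add up to that of the product,
  so its extreme component receives only the term for which both vanish. \<open>B f0 g0\<close> may
  be 0: the bound need not be attained.\<close>

lemma lead_product:
  assumes "graded_product a b c B" and "\<epsilon> \<noteq> 0" "q > 0"
    and f: "lead \<epsilon> q r f f0" and g: "lead \<epsilon> q s g g0"
  shows "lead \<epsilon> q (r + s) (B f g) (B f0 g0)"
proof -
  interpret graded_product a b c B by fact
  have key: "0 \<le> \<epsilon> * (r - q * i)" "0 \<le> \<epsilon> * (s - q * (n - i))"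
    "\<epsilon> * (r + s - q * n) = \<epsilon> * (r - q * i) + \<epsilon> * (s - q * (n - i))"
    if "B (C i f) (C (n - i) g) \<noteq> 0" for i n
  proof -
    from that have "C i f \<noteq> 0" "C (n - i) g \<noteq> 0"
      by auto
    then show "0 \<le> \<epsilon> * (r - q * i)" "0 \<le> \<epsilon> * (s - q * (n - i))"
      using f g by (auto simp: lead_def)
    show "\<epsilon> * (r + s - q * n) = \<epsilon> * (r - q * i) + \<epsilon> * (s - q * (n - i))"
      by (simp add: algebra_simps)
  qed
  have 1: "0 \<le> \<epsilon> * (r + s - q * n)" if "C n (B f g) \<noteq> 0" for n
  proof -
    from that obtain i where "B (C i f) (C (n - i) g) \<noteq> 0"
      unfolding cmp_B by (metis (mono_tags, lifting) sum.neutral)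
    from key[OF this] show ?thesis by linarith
  qed
  have 2: "B f0 g0 = (if q dvd (r + s) then C ((r + s) div q) (B f g) else 0)"
  proof (cases "q dvd (r + s)")
    case False
    then have "\<not> q dvd r \<or> \<not> q dvd s"
      by auto
    then have "f0 = 0 \<or> g0 = 0"
      using f g by (auto simp: lead_def)
    then show ?thesis
      using False by auto
  next
    case True
    define n where "n = (r + s) div q"
    have n: "q * n = r + s"
      using True by (simp add: n_def)
    have nz: "r = q * i" if "B (C i f) (C (n - i) g) \<noteq> 0" for i
    proof -
      have "\<epsilon> * (r - q * i) = 0"
        using key[OF that] n by (simp only: n diff_self mult_zero_right)
      then show ?thesis
        using \<open>\<epsilon> \<noteq> 0\<close> by (simp only: mult_eq_0_iff) auto
    qed
    show ?thesis
    proof (cases "q dvd r")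
      case False
      then have "B (C i f) (C (n - i) g) = 0" for i
        using nz[of i] by (metis dvd_triv_left)
      then have "C n (B f g) = 0" "f0 = 0"
        unfolding cmp_B using False f by (auto simp: lead_def)
      then show ?thesis
        using True by (simp add: n_def)
    next
      case qr: True
      define i where "i = r div q"
      have i: "q * i = r" using qr by (simp add: i_def)
      have "q * (n - i) = s"
        using n i by (simp add: algebra_simps)
      then have "s div q = n - i" "q dvd s"
        using \<open>q > 0\<close> by auto
      then have fg: "f0 = C i f" "g0 = C (n - i) g"
        using f g qr by (auto simp: lead_def i_def)
      have "C n (B f g) = (\<Sum>j\<in>supp f. if j = i then B (C j f) (C (n - j) g) else 0)"
        unfolding cmp_B
      proof (intro sum.cong refl)
        fix j
        have "B (C j f) (C (n - j) g) = 0" if "j \<noteq> i"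
          using nz[of j] i \<open>q > 0\<close> that by (metis mult_cancel_left less_irrefl)
        then show "B (C j f) (C (n - j) g) = (if j = i then B (C j f) (C (n - j) g) else 0)"
          by simp
      qed
      also have "\<dots> = B f0 g0"
        by (subst sum.delta[OF finite_supp]) (auto simp: supp_def fg)
      finally show ?thesis
        using True by (simp add: n_def)
    qed
  qed
  show ?thesis
    unfolding lead_def using 1 2 by blast
qed

lemma graded_product_mult: "graded_product a b c (*)"
  by unfold_locales (simp_all add: ring_distribs hom_mult)

lemma graded_product_jacobian3:
  fixes \<Omega> :: "'k::idom poly3"
  shows "hom (int (a + b + c)) \<Omega> \<Longrightarrow> graded_product a b c (\<lambda>f g. jacobian3 f g \<Omega>)"
  by unfold_locales (simp_all add: jacobian3_simps(3,4) hom_jacobian3)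

lemmas lead_mult = lead_product[OF graded_product_mult]
lemmas lead_jacobian3 = lead_product[OF graded_product_jacobian3]

lemma lead_add: "lead \<epsilon> q r f f0 \<Longrightarrow> lead \<epsilon> q r g g0 \<Longrightarrow> lead \<epsilon> q r (f + g) (f0 + g0)"
  unfolding lead_def cmp_simps by (metis add_0)

lemma lead_diff: "lead \<epsilon> q r f f0 \<Longrightarrow> lead \<epsilon> q r g g0 \<Longrightarrow> lead \<epsilon> q r (f - g) (f0 - g0)"
  unfolding lead_def cmp_simps by (metis diff_0_right diff_self)

lemma lead_0 [simp]: "lead \<epsilon> q r 0 0"
  by (simp add: lead_def)

lemma lead_sum: "(\<And>x. x \<in> A \<Longrightarrow> lead \<epsilon> q r (f x) (f0 x)) \<Longrightarrow> lead \<epsilon> q r (sum f A) (sum f0 A)"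
  by (induction A rule: infinite_finite_induct) (simp_all add: lead_add)

lemma lead_hom: "hom n f \<Longrightarrow> q > 0 \<Longrightarrow> lead \<epsilon> q (q * n) f f"
  by (auto simp: lead_def cmp_hom hom_def)

lemma lead_const: "q > 0 \<Longrightarrow> lead \<epsilon> q 0 (const3 e) (const3 e)"
  using lead_hom[OF hom_gen(4), of q \<epsilon> e] by simp

text \<open>Relative to a bound that is not attained the leading form is 0. This is how the terms
  that are not extreme are dropped from a sum.\<close>

lemma lead_weaken: "lead \<epsilon> q r f f0 \<Longrightarrow> 0 < \<epsilon> * (s - r) \<Longrightarrow> lead \<epsilon> q s f 0"
  unfolding lead_def
proof (intro conjI allI impI; elim conjE)
  fix n
  assume *: "\<forall>n. C n f \<noteq> 0 \<longrightarrow> 0 \<le> \<epsilon> * (r - q * n)" and s: "0 < \<epsilon> * (s - r)"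
  have e: "\<epsilon> * (s - q * n) = \<epsilon> * (s - r) + \<epsilon> * (r - q * n)" for n
    by (simp add: algebra_simps)
  show "C n f \<noteq> 0 \<Longrightarrow> 0 \<le> \<epsilon> * (s - q * n)"
    using * s e by fastforce
  have "C (s div q) f = 0" if "q dvd s"
  proof (rule ccontr)
    assume "C (s div q) f \<noteq> 0"
    then have "0 \<le> \<epsilon> * (r - q * (s div q))"
      using * by blast
    then show False
      using e[of "s div q"] s that by simp
  qed
  then show "0 = (if q dvd s then C (s div q) f else 0)"
    by simp
qed

lemma lead_power: "\<epsilon> \<noteq> 0 \<Longrightarrow> q > 0 \<Longrightarrow> lead \<epsilon> q r f f0 \<Longrightarrow> lead \<epsilon> q (r * int n) (f ^ n) (f0 ^ n)"
proof (induction n)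
  case 0
  then show ?case
    using lead_const[of q \<epsilon> 1] by (simp add: const3_simps)
next
  case (Suc n)
  then show ?case
    using lead_mult[of \<epsilon> q r f f0 "r * int n" "f ^ n" "f0 ^ n"] by (simp add: algebra_simps)
qed

text \<open>Additive induction does not stay among homogeneous elements, so the claim is proved for
  the component \<open>C m f\<close> of an arbitrary f.\<close>

lemma hom_induct [consumes 1, case_names zero add mon]:
  assumes "hom m f" "P 0" "\<And>f g. hom m f \<Longrightarrow> hom m g \<Longrightarrow> P f \<Longrightarrow> P g \<Longrightarrow> P (f + g)"
    and "\<And>e i j k. m = int (a * i + b * j + c * k) \<Longrightarrow> P (mon3 e i j k)"
  shows "P f"
proof -
  have "P (C m f)"
  proof (induction f rule: poly3_induct_mon)
    case (mon e i j k)
    show ?case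
      unfolding cmp_mon3 using assms(2,4) by presburger
  qed (use assms(2,3) in \<open>simp_all\<close>)
  then show ?thesis
    using assms(1) by (simp add: hom_def)
qed

text \<open>If X, Y, Z are bounded by one multiple p / q of the weights, every monomial of degree m
  receives the same bound p * m / q, and substitution commutes with taking leading forms. This
  common ratio is the reason for the denominator in \<open>lead\<close>.\<close>

lemma lead_sub:
  assumes "hom m f" "\<epsilon> \<noteq> 0" "q > 0"
    and "lead \<epsilon> q (p * int a) X X0" "lead \<epsilon> q (p * int b) Y Y0" "lead \<epsilon> q (p * int c) Z Z0"
  shows "lead \<epsilon> q (p * m) (sub X Y Z f) (sub X0 Y0 Z0 f)"
  using assms(1)
proof (induction f rule: hom_induct)
  case (mon e i j k)
  have "lead \<epsilon> q (0 + p * int a * int i + p * int b * int j + p * int c * int k)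
      (const3 e * X ^ i * Y ^ j * Z ^ k) (const3 e * X0 ^ i * Y0 ^ j * Z0 ^ k)"
    by (intro lead_mult lead_power lead_const assms)
  then show ?case
    unfolding mon3_eq mon by (simp add: algebra_simps)
qed (simp_all add: lead_add)

lemma ex_lead:
  fixes \<epsilon> :: int
  assumes "f \<noteq> 0" "\<epsilon> \<noteq> 0"
  obtains n where "n \<ge> 0" "lead \<epsilon> 1 n f (C n f)" "C n f \<noteq> 0"
proof -
  have "supp f \<noteq> {}"
    using sum_cmp[of f] assms by auto
  then have "Max ((\<lambda>n. \<epsilon> * n) ` supp f) \<in> (\<lambda>n. \<epsilon> * n) ` supp f"
    by (intro Max_in) simp_all
  then obtain n where n0: "n \<in> supp f" "\<epsilon> * n = Max ((\<lambda>n. \<epsilon> * n) ` supp f)"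
    by auto
  have "\<epsilon> * m \<le> Max ((\<lambda>n. \<epsilon> * n) ` supp f)" if "m \<in> supp f" for m
    using that by (intro Max_ge) auto
  then have n: "n \<in> supp f" "\<And>m. m \<in> supp f \<Longrightarrow> \<not> \<epsilon> * n < \<epsilon> * m"
    using n0 by (auto simp: not_less)
  then have "C n f \<noteq> 0" "n \<ge> 0"
    using cmp_neg[of n f] by (auto simp: supp_def not_less[symmetric])
  moreover have "lead \<epsilon> 1 n f (C n f)"
    using n(2) by (force simp: lead_def supp_def right_diff_distrib)
  ultimately show ?thesis
    using that by blast
qed

lemma cmp_mult_hom:
  assumes "hom m u"
  shows "C n (u * h) = u * C (n - m) h"
proof -
  interpret graded_product a b c "(*)" by (rule graded_product_mult)
  have "supp u \<subseteq> {m}"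
    by (auto simp: supp_def cmp_hom[OF assms] split: if_splits)
  then have "C n (u * h) = (\<Sum>i\<in>{m}. C i u * C (n - i) h)"
    unfolding cmp_B by (intro sum.mono_neutral_left) (auto simp: supp_def)
  then show ?thesis
    using assms by (simp add: hom_def)
qed

lemma hom_dvd_cmp: "hom m u \<Longrightarrow> u dvd f \<Longrightarrow> u dvd C n f"
  by (auto simp: cmp_mult_hom elim!: dvdE)

text \<open>In a domain the highest components of f and g have a nonzero product, and so have the
  lowest ones. Both products must lie in degree n, so highest and lowest degree of f
  coincide.\<close>

lemma hom_factor:
  fixes f g :: "'k::idom poly3"
  assumes "hom n (f * g)" "f \<noteq> 0" "g \<noteq> 0"
  obtains m where "hom m f"
proof -
  have ex: "\<exists>n0 m0. C n0 f \<noteq> 0 \<and> C m0 g \<noteq> 0 \<and> lead \<epsilon> 1 n0 f (C n0 f) \<and> n0 + m0 = n \<and>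
      lead \<epsilon> 1 m0 g (C m0 g)" if \<epsilon>: "\<epsilon> \<noteq> 0" for \<epsilon> :: int
  proof -
    obtain n0 where n0: "lead \<epsilon> 1 n0 f (C n0 f)" "C n0 f \<noteq> 0"
      using ex_lead assms(2) \<epsilon> by metis
    obtain m0 where m0: "lead \<epsilon> 1 m0 g (C m0 g)" "C m0 g \<noteq> 0"
      using ex_lead assms(3) \<epsilon> by metis
    have "C (n0 + m0) (f * g) = C n0 f * C m0 g"
      using lead_mult[of \<epsilon> 1 n0 f "C n0 f" m0 g "C m0 g"] \<epsilon> n0(1) m0(1) by (simp add: lead_def)
    then have "n0 + m0 = n"
      using assms(1) n0 m0 by (metis cmp_hom mult_eq_0_iff)
    then show ?thesis
      using n0 m0 by blast
  qed
  obtain n1 m1 where 1: "C n1 f \<noteq> 0" "C m1 g \<noteq> 0" "lead 1 1 n1 f (C n1 f)" "n1 + m1 = n"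
    "lead 1 1 m1 g (C m1 g)"
    using ex[of 1] by auto
  obtain n2 m2 where 2: "C n2 f \<noteq> 0" "C m2 g \<noteq> 0" "lead (-1) 1 n2 f (C n2 f)" "n2 + m2 = n"
    "lead (-1) 1 m2 g (C m2 g)"
    using ex[of "-1"] by auto
  have "n2 \<le> n1" "m2 \<le> m1"
    using 1(3,5) 2(1,2) by (auto simp: lead_def)
  then have "n1 = n2"
    using 1 2 by linarith
  have "C i f = (if i = n1 then C n1 f else 0)" for i
  proof -
    have "i = n1" if "C i f \<noteq> 0"
      using 1(3) 2(3) \<open>n1 = n2\<close> that unfolding lead_def by (smt (verit, best))
    then show ?thesis by metis
  qed
  then have "C i f = C i (C n1 f)" for i
    unfolding cmp_cmp .
  then have "f = C n1 f"
    by (rule eq_of_cmp)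
  then show ?thesis
    using that hom_cmp by metis
qed

end


section \<open>Elimination modulo a prime\<close>

lemma homogeneous_system:
  fixes M :: "'j \<Rightarrow> 'i \<Rightarrow> 'k::field"
  assumes "finite J" "finite I" "card J < card I"
  shows "\<exists>v. (\<exists>i\<in>I. v i \<noteq> 0) \<and> (\<forall>j\<in>J. (\<Sum>i\<in>I. M j i * v i) = 0)"
  using assms
proof (induction J arbitrary: M I rule: finite_induct)
  case empty
  then have "\<exists>i. i \<in> I"
    by (metis card.empty equals0I less_irrefl)
  then show ?case
    by (intro exI[of _ "\<lambda>_. 1"]) auto
next
  case (insert j0 J)
  show ?case
  proof (cases "\<forall>i\<in>I. M j0 i = 0")
    case True
    have "card J < card I"
      using insert by simp
    then obtain v where "\<exists>i\<in>I. v i \<noteq> 0" "\<forall>j\<in>J. (\<Sum>i\<in>I. M j i * v i) = 0"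
      using insert.IH[of I M] insert.prems by blast
    with True show ?thesis
      by (intro exI[of _ v]) simp
  next
    case False
    then obtain i0 where i0: "i0 \<in> I" "M j0 i0 \<noteq> 0"
      by blast
    \<comment> \<open>Gaussian elimination: \<open>M'\<close> is the system after the unknown
      \<open>i0\<close> has been eliminated with the equation \<open>j0\<close>, and
      \<open>v\<close> below recovers \<open>i0\<close> from that equation.\<close>
    define M' where "M' j i = M j i - M j i0 * M j0 i / M j0 i0" for j i
    have "card J < card (I - {i0})"
      using insert i0 by simp
    then obtain v' where v': "\<exists>i\<in>I - {i0}. v' i \<noteq> 0"
      "\<forall>j\<in>J. (\<Sum>i\<in>I - {i0}. M' j i * v' i) = 0"
      using insert.IH[of "I - {i0}" M'] insert.prems by blast
    define S where "S j = (\<Sum>i\<in>I - {i0}. M j i * v' i)" for j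
    define v where "v i = (if i = i0 then - S j0 / M j0 i0 else v' i)" for i
    have sum: "(\<Sum>i\<in>I. M j i * v i) = S j - M j i0 * S j0 / M j0 i0" for j
    proof -
      have "(\<Sum>i\<in>I - {i0}. M j i * v i) = S j"
        unfolding S_def by (intro sum.cong) (auto simp: v_def)
      then show ?thesis
        using sum.remove[OF insert.prems(1) i0(1), of "\<lambda>i. M j i * v i"] by (simp add: v_def)
    qed
    have "(\<Sum>i\<in>I - {i0}. M' j i * v' i) = S j - M j i0 * S j0 / M j0 i0" for j
      unfolding S_def M'_def
      by (simp add: left_diff_distrib sum_subtractf sum_distrib_left sum_divide_distrib mult.assoc)
    then have "\<forall>j\<in>insert j0 J. (\<Sum>i\<in>I. M j i * v i) = 0"
      using v'(2) sum i0 by auto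
    moreover have "\<exists>i\<in>I. v i \<noteq> 0"
      using v'(1) by (auto simp: v_def)
    ultimately show ?thesis
      by blast
  qed
qed

text \<open>The degree in x and y together. The weight 0 leaves z to be measured by
  \<open>degree\<close>, the degree in the outermost variable.\<close>

abbreviation dxy :: "'k::comm_ring_1 poly3 \<Rightarrow> nat" where "dxy f \<equiv> degree (gr 1 1 0 f)"

lemma dxy_le_iff: "dxy f \<le> N \<longleftrightarrow> (\<forall>i j k. coeff3 f i j k \<noteq> 0 \<longrightarrow> i + j \<le> N)"
proof
  assume *: "dxy f \<le> N"
  show "\<forall>i j k. coeff3 f i j k \<noteq> 0 \<longrightarrow> i + j \<le> N"
  proof (intro allI impI)
    fix i j k assume "coeff3 f i j k \<noteq> 0"
    then have "coeff3 (coeff (gr 1 1 0 f) (i + j)) i j k \<noteq> 0"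
      by (simp add: coeff3_coeff_gr)
    then have "coeff (gr 1 1 0 f) (i + j) \<noteq> 0"
      by auto
    then show "i + j \<le> N"
      using * le_degree le_trans by blast
  qed
next
  assume *: "\<forall>i j k. coeff3 f i j k \<noteq> 0 \<longrightarrow> i + j \<le> N"
  have "coeff (gr 1 1 0 f) n = 0" if "n > N" for n
  proof (rule poly3_eqI)
    fix i j k
    show "coeff3 (coeff (gr 1 1 0 f) n) i j k = coeff3 0 i j k"
      using *[rule_format, of i j k] that by (cases "coeff3 f i j k = 0") (auto simp: coeff3_coeff_gr)
  qed
  then show "dxy f \<le> N"
    by (simp add: degree_le)
qed

lemma dxy_mult_le: "dxy f \<le> m \<Longrightarrow> dxy g \<le> n \<Longrightarrow> dxy (f * g) \<le> m + n"
  using degree_mult_le[of "gr 1 1 0 f" "gr 1 1 0 g"] by (simp add: gr_simps)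

lemma dxy_power_le: "dxy f \<le> m \<Longrightarrow> dxy (f ^ n) \<le> m * n"
  using degree_power_le[of "gr 1 1 0 f" n]
  by (simp add: gr_simps) (meson le_trans mult_le_mono1)

text \<open>Pseudo-division by \<Omega> as a polynomial in z: each of the s steps multiplies by the
  leading coefficient, lowers the bound on the z-degree by one and raises the degree in x and y by
  at most \<open>dxy \<Omega>\<close>. The count in \<open>algebraic_dependence\<close> relies on
  this last, linear growth.\<close>

lemma pseudo_reduction:
  fixes \<Omega> f :: "'k::idom poly3"
  assumes "degree f < degree \<Omega> + s"
  shows "\<exists>r. \<Omega> dvd [:lead_coeff \<Omega>:] ^ s * f - r \<and> (r = 0 \<or> degree r < degree \<Omega>) \<and> dxy r \<le> dxy f + s * dxy \<Omega>"
  using assms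
proof (induction s arbitrary: f)
  case 0
  then show ?case
    by (intro exI[of _ f]) simp
next
  case (Suc s)
  define m where "m = degree \<Omega>"
  define l where "l = [:lead_coeff \<Omega>:]"
  define c where "c = monom (coeff f (m + s)) s"
  define f1 where "f1 = l * f - c * \<Omega>"
  have l: "dxy l \<le> dxy \<Omega>"
    unfolding dxy_le_iff
  proof (intro allI impI)
    fix i j k assume *: "coeff3 l i j k \<noteq> 0"
    then have "k = 0"
      by (cases k) (auto simp: l_def coeff3_def)
    with * have "coeff3 \<Omega> i j (degree \<Omega>) \<noteq> 0"
      by (simp add: l_def coeff3_def)
    then show "i + j \<le> dxy \<Omega>"
      using dxy_le_iff[of \<Omega> "dxy \<Omega>"] by blast
  qed
  have c: "dxy c \<le> dxy f"
    unfolding dxy_le_iff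
  proof (intro allI impI)
    fix i j k assume *: "coeff3 c i j k \<noteq> 0"
    then have "coeff3 f i j (m + s) \<noteq> 0"
      by (auto simp: c_def coeff3_def split: if_splits)
    then show "i + j \<le> dxy f"
      using dxy_le_iff[of f "dxy f"] by blast
  qed
  have "dxy (l * f) \<le> dxy \<Omega> + dxy f" "dxy (c * \<Omega>) \<le> dxy f + dxy \<Omega>"
    using l c dxy_mult_le by blast+
  then have d1: "dxy f1 \<le> dxy f + dxy \<Omega>"
    unfolding f1_def gr_simps by (intro degree_diff_le) (simp_all add: add.commute)
  have "coeff f1 n = 0" if "n \<ge> m + s" for n
  proof (cases "n = m + s")
    case True
    have "coeff (c * \<Omega>) (m + s) = coeff f (m + s) * lead_coeff \<Omega>"
      unfolding c_def by (subst coeff_monom_mult) (simp add: m_def)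
    then show ?thesis
      by (simp add: True f1_def l_def mult.commute)
  next
    case False
    then have "n > m + s" using that by simp
    then have "coeff f n = 0" "coeff (c * \<Omega>) n = 0"
      using Suc.prems by (auto simp: m_def c_def coeff_monom_mult intro!: coeff_eq_0)
    then show ?thesis
      by (simp add: f1_def l_def)
  qed
  moreover have "m + s > 0 \<or> f1 = 0"
    using calculation by (auto simp: poly_eq_iff)
  ultimately have "f1 = 0 \<or> degree f1 < m + s"
    by (metis leading_coeff_0_iff not_le)
  then show ?case
  proof
    assume "f1 = 0"
    then have "\<Omega> dvd l ^ Suc s * f"
      by (simp add: f1_def mult.assoc mult.left_commute[of l])
    then show ?thesis
      by (intro exI[of _ 0]) (simp add: l_def)
  next
    assume "degree f1 < m + s"
    from Suc.IH[of f1, folded m_def l_def, OF this]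
    obtain r where r: "\<Omega> dvd l ^ s * f1 - r" "r = 0 \<or> degree r < m" "dxy r \<le> dxy f1 + s * dxy \<Omega>"
      by blast
    have "l ^ Suc s * f - r = (l ^ s * f1 - r) + \<Omega> * (l ^ s * c)"
      by (simp add: f1_def algebra_simps)
    then have "\<Omega> dvd l ^ Suc s * f - r"
      using r(1) by (metis dvd_add dvd_triv_left)
    then show ?thesis
      using r d1 by (intro exI[of _ r]) (auto simp: l_def m_def)
  qed
qed

lemma const3_dvd_unit: "e \<noteq> 0 \<Longrightarrow> const3 (e::'k::field) dvd 1"
  by (metis const3_simps(2,6) dvd_triv_left right_inverse)

text \<open>The quotient by \<Omega> has transcendence degree at most 2, by counting: there are
  \<open>N ^ 3\<close> monomials in g1, g2, g3 with exponents below N, while their remainders modulo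
  \<Omega> lie in a space whose dimension grows like \<open>N ^ 2\<close>.\<close>

lemma algebraic_dependence:
  fixes \<Omega> g1 g2 g3 :: "'k::field poly3"
  assumes prime: "\<And>f g. \<Omega> dvd f * g \<Longrightarrow> \<Omega> dvd f \<or> \<Omega> dvd g" and deg: "degree \<Omega> > 0"
  shows "\<exists>p. p \<noteq> 0 \<and> \<Omega> dvd sub g1 g2 g3 p"
proof -
  define m where "m = degree \<Omega>"
  define l where "l = [:lead_coeff \<Omega>:]"
  \<comment> \<open>D bounds all degrees, \<open>s = 3 * D * N\<close> division steps are enough for
    each of the monomials, and E is made so that \<open>s + s * dxy \<Omega> = N * E\<close> bounds
    the remainders. They have at most \<open>(N * E + 1)^2 * m\<close> coefficients, which is at
    most \<open>N^2 * (E + 1)^2 * m\<close> and so less than \<open>N^3\<close> by the choice of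
    N.\<close>
  define D where "D = Max {degree g1, degree g2, degree g3, dxy g1, dxy g2, dxy g3}"
  define E where "E = 3 * D + 3 * D * dxy \<Omega>"
  define N where "N = (E + 1)\<^sup>2 * m + 1"
  define s where "s = 3 * D * N"
  define I where "I = {..<N} \<times> {..<N} \<times> {..<N}"
  define J where "J = {..N * E} \<times> {..N * E} \<times> {..<m}"
  define h where "h t = (case t of (i, j, k) \<Rightarrow> g1 ^ i * g2 ^ j * g3 ^ k)" for t
  have D: "degree g1 \<le> D" "degree g2 \<le> D" "degree g3 \<le> D" "dxy g1 \<le> D" "dxy g2 \<le> D" "dxy g3 \<le> D"
    unfolding D_def by (simp_all add: Max_ge_iff)
  have "\<exists>r. \<Omega> dvd l ^ s * h t - r \<and> (r = 0 \<or> degree r < m) \<and> dxy r \<le> N * E" if tI: "t \<in> I" for t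
  proof -
    obtain i j k where t: "t = (i, j, k)" "i < N" "j < N" "k < N"
      using tI by (cases t) (auto simp: I_def)
    have le: "D * i + D * j + D * k \<le> s"
    proof -
      have "D * i \<le> D * N" "D * j \<le> D * N" "D * k \<le> D * N"
        using t by (simp_all add: less_imp_le)
      moreover have "s = D * N + D * N + D * N"
        by (simp add: s_def)
      ultimately show ?thesis
        by linarith
    qed
    have pw: "degree (g ^ n) \<le> D * n" if "degree g \<le> D" for g :: "'k poly3" and n
      using degree_power_le[of g n] that by (meson le_trans mult_le_mono1)
    have "degree (h t) \<le> D * i + D * j + D * k"
      unfolding h_def t prod.case
      by (intro order.trans[OF degree_mult_le] add_mono pw D)
    moreover have "dxy (h t) \<le> D * i + D * j + D * k"
      unfolding h_def t prod.case by (intro dxy_mult_le dxy_power_le D)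
    ultimately have "degree (h t) < m + s" "dxy (h t) \<le> s"
      using le deg by (auto simp: m_def)
    moreover from this(1) obtain r where "\<Omega> dvd l ^ s * h t - r" "r = 0 \<or> degree r < m"
      "dxy r \<le> dxy (h t) + s * dxy \<Omega>"
      using pseudo_reduction[of "h t" \<Omega> s] by (auto simp: m_def l_def)
    moreover have "s + s * dxy \<Omega> = N * E"
      by (simp add: s_def E_def algebra_simps)
    ultimately show ?thesis
      by (intro exI[of _ r]) auto
  qed
  then obtain r where r: "\<And>t. t \<in> I \<Longrightarrow> \<Omega> dvd l ^ s * h t - r t"
    "\<And>t. t \<in> I \<Longrightarrow> r t = 0 \<or> degree (r t) < m" "\<And>t. t \<in> I \<Longrightarrow> dxy (r t) \<le> N * E"
    by metis
  have "(N * E + 1) \<le> N * (E + 1)"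
    by (simp add: N_def)
  then have "(N * E + 1) * (N * E + 1) * m \<le> N * (E + 1) * (N * (E + 1)) * m"
    by (intro mult_le_mono le_refl)
  also have "\<dots> < N * N * N"
    by (simp add: N_def power2_eq_square algebra_simps)
  finally have "card J < card I"
    by (simp add: I_def J_def card_cartesian_product algebra_simps)
  moreover have "finite I" "finite J"
    by (simp_all add: I_def J_def)
  ultimately obtain v where v: "\<exists>t\<in>I. v t \<noteq> 0"
    "\<forall>u\<in>J. (\<Sum>t\<in>I. (case u of (i, j, k) \<Rightarrow> coeff3 (r t) i j k) * v t) = 0"
    using homogeneous_system[of J I "\<lambda>u t. case u of (i, j, k) \<Rightarrow> coeff3 (r t) i j k"] by blast
  define p where "p = (\<Sum>t\<in>I. case t of (i, j, k) \<Rightarrow> mon3 (v t) i j k)"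
  have cp: "coeff3 p i j k = (if (i, j, k) \<in> I then v (i, j, k) else 0)" for i j k
  proof -
    have "coeff3 p i j k = (\<Sum>t\<in>I. if t = (i, j, k) then v t else 0)"
      unfolding p_def coeff3_sum by (intro sum.cong refl) (simp add: coeff3_mon3 split: prod.splits)
    then show ?thesis
      using \<open>finite I\<close> by (simp add: sum.delta)
  qed
  have "p \<noteq> 0"
  proof
    assume "p = 0"
    then have "v (i, j, k) = 0" if "(i, j, k) \<in> I" for i j k
      using cp[of i j k] that by simp
    then show False
      using v(1) by auto
  qed
  have r0: "(\<Sum>t\<in>I. const3 (v t) * r t) = 0"
  proof (rule poly3_eqI)
    fix i j k
    show "coeff3 (\<Sum>t\<in>I. const3 (v t) * r t) i j k = coeff3 0 i j k"
    proof (cases "(i, j, k) \<in> J")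
      case True
      then show ?thesis
        using bspec[OF v(2) True] by (simp add: coeff3_sum mult.commute[of _ "v _"])
    next
      case False
      have "coeff3 (r t) i j k = 0" if "t \<in> I" for t
      proof (rule ccontr)
        assume nz: "coeff3 (r t) i j k \<noteq> 0"
        then have "i + j \<le> N * E"
          using r(3)[OF that] unfolding dxy_le_iff by blast
        moreover have "coeff (r t) k \<noteq> 0"
          using nz by (auto simp: coeff3_def)
        then have "k < m"
          using r(2)[OF that] le_degree by fastforce
        ultimately show False
          using False by (auto simp: J_def)
      qed
      then show ?thesis
        by (simp add: coeff3_sum)
    qed
  qed
  have "sub g1 g2 g3 p = (\<Sum>t\<in>I. const3 (v t) * h t)"
    unfolding p_def sub_sum by (intro sum.cong refl) (auto simp: h_def mon3_eq)
  \<comment> \<open>By the choice of v the remainders cancel, so \<Omega> divides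
    \<open>l ^ s\<close> times the relation. As \<open>l ^ s\<close> is free of z, \<Omega> does not
    divide it, and primality removes it.\<close>
  then have "l ^ s * sub g1 g2 g3 p = (\<Sum>t\<in>I. const3 (v t) * (l ^ s * h t - r t))"
    using r0 by (simp add: sum_distrib_left right_diff_distrib sum_subtractf mult.left_commute)
  also have "\<Omega> dvd \<dots>"
    by (intro dvd_sum dvd_mult r)
  finally have "\<Omega> dvd l ^ s \<or> \<Omega> dvd sub g1 g2 g3 p"
    by (rule prime)
  moreover have "\<not> \<Omega> dvd l ^ s"
  proof
    assume "\<Omega> dvd l ^ s"
    moreover have "l ^ s \<noteq> 0"
      using deg by (auto simp: l_def)
    ultimately have "degree \<Omega> \<le> degree (l ^ s)"
      by (rule dvd_imp_degree_le)
    also have "degree (l ^ s) = 0"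
      using degree_power_le[of l s] by (simp add: l_def)
    finally show False
      using deg by simp
  qed
  ultimately show ?thesis
    using \<open>p \<noteq> 0\<close> by blast
qed

lemma sub_const_z: "sub X Y Z [:r:] = sub X Y 0 [:r:]"
  by (cases "r = 0") (simp_all add: sub_def ext3_def map_poly_pCons)

lemma pCons_eq_varZ: "pCons r p = [:r:] + varZ * p"
  by (simp add: varZ_def)

text \<open>Modulo \<Omega> there is a relation between g1, g2 and f. Powers of f can be cancelled
  from it, f being nonzero modulo a prime, until a nonzero part r free of the third variable
  remains. Geometrically, g1 and g2 become dependent on the curve f = 0 of the surface.\<close>

lemma elimination:
  fixes \<Omega> g1 g2 f :: "'k::field poly3"
  assumes prime: "\<And>f g. \<Omega> dvd f * g \<Longrightarrow> \<Omega> dvd f \<or> \<Omega> dvd g" and deg: "degree \<Omega> > 0"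
    and "\<not> \<Omega> dvd f"
  obtains r h where "r \<noteq> 0" "\<Omega> dvd sub g1 g2 0 [:r:] + f * h"
proof -
  have *: "p \<noteq> 0 \<Longrightarrow> \<Omega> dvd sub g1 g2 f p \<Longrightarrow> \<exists>r h. r \<noteq> 0 \<and> \<Omega> dvd sub g1 g2 0 [:r:] + f * h" for p
  proof (induction p)
    case (pCons r p)
    have eq: "sub g1 g2 f (pCons r p) = sub g1 g2 0 [:r:] + f * sub g1 g2 f p"
      unfolding pCons_eq_varZ[of r p] by (simp add: sub_const_z[of _ _ f])
    show ?case
    proof (cases "r = 0")
      case True
      then have "\<Omega> dvd f * sub g1 g2 f p"
        using pCons.prems eq by simp
      then have "\<Omega> dvd sub g1 g2 f p"
        using prime assms(3) by blast
      then show ?thesis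
        using pCons True by auto
    next
      case False
      then show ?thesis
        using pCons.prems eq by metis
    qed
  qed simp
  obtain p where "p \<noteq> 0" "\<Omega> dvd sub g1 g2 f p"
    using algebraic_dependence[OF prime deg] by blast
  then show ?thesis
    using * that by blast
qed

text \<open>Bracketing a relation r(X, Y) = 0 with Y leaves r_x(X, Y) {X, Y}, and bracketing it with
  X leaves r_y(X, Y) {Y, X}. So derivatives of relations are again relations, and one ends with a
  nonzero constant divisible by w, although w is no unit. Brackets pass to the quotient because w is
  a Casimir element, and characteristic 0 makes polynomials with derivative 0 constant.\<close>

lemma algebraic_independence:
  fixes w X Y \<Omega> :: "'k::field_char_0 poly3"
  assumes prime: "\<And>f g. w dvd f * g \<Longrightarrow> w dvd f \<or> w dvd g" and nunit: "\<not> w dvd 1"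
    and cas: "\<And>g. jacobian3 w g \<Omega> = 0" and ind: "\<not> w dvd jacobian3 X Y \<Omega>"
    and dvd: "w dvd sub X Y 0 [:r:]"
  shows "r = 0"
proof -
  have jac: "w dvd jacobian3 f g \<Omega>" if "w dvd f" for f g
  proof -
    from that obtain h where "f = w * h" ..
    then show ?thesis
      by (simp add: jacobian3_simps(5) cas)
  qed
  have 1: "w dvd sub X Y 0 (partial_x f)" if "w dvd sub X Y 0 f" for f
  proof -
    have "w dvd sub X Y 0 (partial_x f) * jacobian3 X Y \<Omega>"
      using jac[OF that, of Y] by (simp add: jacobian3_sub jacobian3_simps(1,7))
    then show ?thesis
      using prime ind by blast
  qed
  have 2: "w dvd sub X Y 0 (partial_y f)" if "w dvd sub X Y 0 f" for f
  proof -
    have "w dvd sub X Y 0 (partial_y f) * jacobian3 Y X \<Omega>"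
      using jac[OF that, of X] by (simp add: jacobian3_sub jacobian3_simps(1,7))
    then show ?thesis
      using prime ind jacobian3_simps(6)[of X Y \<Omega>] by (metis dvd_minus_iff)
  qed
  have s0: "s = 0" if "w dvd sub X Y 0 [:[:s:]:]" for s
    using that
  proof (induction "degree s" arbitrary: s rule: less_induct)
    case less
    have "w dvd sub X Y 0 [:[:pderiv s:]:]"
      using 1[OF less.prems] by (cases "s = 0") (simp_all add: partial_x_def map_poly_pCons)
    then have "degree s \<noteq> 0 \<Longrightarrow> pderiv s = 0"
      by (intro less.hyps) (simp_all add: degree_pderiv)
    then have "degree s = 0"
      by (auto simp: pderiv_eq_0_iff)
    then obtain e where s: "s = [:e:]"
      by (metis degree_eq_zeroE)
    then have "[:[:s:]:] = const3 e"
      by (simp add: const3_def)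
    then have "w dvd const3 e"
      using less.prems by simp
    then show ?case
      using const3_dvd_unit[of e] nunit s dvd_trans by (cases "e = 0") auto
  qed
  show ?thesis
    using dvd
  proof (induction "degree r" arbitrary: r rule: less_induct)
    case less
    have "w dvd sub X Y 0 [:pderiv r:]"
      using 2[OF less.prems] by (cases "r = 0") (simp_all add: partial_y_def map_poly_pCons)
    then have "degree r \<noteq> 0 \<Longrightarrow> pderiv r = 0"
      by (intro less.hyps) (simp_all add: degree_pderiv)
    then have "degree r = 0"
      by (auto simp: pderiv_eq_0_iff)
    then obtain s where "r = [:s:]"
      by (metis degree_eq_zeroE)
    then show ?case
      using s0 less.prems by simp
  qed
qed

text \<open>The Nullstellensatz for a prime surface. Otherwise elimination would make some nonzero
  r(x, y) vanish on the surface; but the surface has a point over every (x, y) at which the leading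
  coefficient of \<Omega> in z is nonzero.\<close>

lemma vanishing_imp_dvd:
  fixes \<Omega> f :: "'k::{alg_closed_field, field_char_0} poly3"
  assumes prime: "\<And>f g. \<Omega> dvd f * g \<Longrightarrow> \<Omega> dvd f \<or> \<Omega> dvd g" and deg: "degree \<Omega> > 0"
    and van: "\<And>x y z. eval3 \<Omega> x y z = 0 \<Longrightarrow> eval3 f x y z = 0"
  shows "\<Omega> dvd f"
proof (rule ccontr)
  assume "\<not> \<Omega> dvd f"
  then obtain r h where r: "r \<noteq> 0" "\<Omega> dvd sub varX varY 0 [:r:] + f * h"
    using elimination[OF prime deg] by metis
  \<comment> \<open>The product is used to find one point (x, y) at which neither r nor the leading
    coefficient vanishes.\<close>
  have "[:r * lead_coeff \<Omega>:] \<noteq> (0 :: 'k poly3)"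
    using r deg by auto
  then obtain x y z0 where "eval3 [:r * lead_coeff \<Omega>:] x y z0 \<noteq> 0"
    using eval3_zero_imp_zero by blast
  then have xy: "poly (poly r [:y:]) x \<noteq> 0" "poly (poly (lead_coeff \<Omega>) [:y:]) x \<noteq> 0"
    by (auto simp: eval3_def)
  define \<phi> where "\<phi> c = poly (poly c [:y:]) x" for c :: "'k poly poly"
  interpret \<phi>: comm_ring_hom \<phi>
    by unfold_locales (simp_all add: \<phi>_def)
  define Q where "Q = map_poly \<phi> \<Omega>"
  have "coeff Q (degree \<Omega>) \<noteq> 0"
    using xy by (simp add: Q_def \<phi>_def coeff_map_poly)
  then have "degree Q > 0"
    using deg le_degree by fastforce
  then obtain z where "poly Q z = 0"
    using alg_closed_imp_poly_has_root by blast
  moreover have "poly Q (\<phi> [:[:z:]:]) = \<phi> (poly \<Omega> [:[:z:]:])"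
    unfolding Q_def by (rule \<phi>.poly_map_poly)
  ultimately have "eval3 \<Omega> x y z = 0"
    by (simp add: \<phi>_def eval3_def)
  then have "eval3 (sub varX varY 0 [:r:] + f * h) x y z = 0"
    using r(2) by (metis dvdE eval3_simps(6) mult_zero_left)
  moreover have "eval3 f x y z = 0"
    using van \<open>eval3 \<Omega> x y z = 0\<close> by blast
  ultimately have "eval3 (sub varX varY varZ [:r:]) x y z = 0"
    by (simp add: sub_const_z[of _ _ varZ])
  then show False
    using xy by (simp add: eval3_def)
qed


section \<open>The potential is prime\<close>

context weights
begin

lemma hom_power: "hom n f \<Longrightarrow> hom (n * int k) (f ^ k)"
proof (induction k)
  case 0
  then show ?case
    using hom_gen(4)[of 1] by (simp add: const3_simps)
next
  case (Suc k)
  then show ?case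
    using hom_mult[of n f "n * int k" "f ^ k"] by (simp add: algebra_simps)
qed

lemma hom_sub:
  assumes "hom m f" "hom (int a) X" "hom (int b) Y" "hom (int c) Z"
  shows "hom m (sub X Y Z f)"
  using assms(1)
proof (induction f rule: hom_induct)
  case (mon e i j k)
  have "hom (0 + int a * int i + int b * int j + int c * int k) (const3 e * X ^ i * Y ^ j * Z ^ k)"
    by (intro hom_mult hom_power hom_gen assms)
  then show ?case
    by (simp add: mon3_eq mon)
qed (simp_all add: hom_add)

lemma hom_eval3_0:
  assumes "hom n f" "n > 0"
  shows "eval3 f 0 0 0 = 0"
  using assms(1)
proof (induction f rule: hom_induct)
  case (mon e i j k)
  then have "i > 0 \<or> j > 0 \<or> k > 0"
    using assms(2) by (auto simp del: of_nat_add of_nat_mult)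
  then show ?case
    by (auto simp: mon3_eq zero_power)
qed simp_all

text \<open>On the z-axis only pure powers of z contribute to the value.\<close>

lemma hom_eval3_001:
  assumes "hom n f" "eval3 f 0 0 1 \<noteq> 0"
  shows "\<exists>k. n = int c * int k"
proof -
  have "eval3 f 0 0 1 \<noteq> 0 \<longrightarrow> (\<exists>k. n = int c * int k)"
    using assms(1)
  proof (induction f rule: hom_induct)
    case (mon e i j k)
    then show ?case
      by (cases "i = 0 \<and> j = 0") (auto simp: mon3_eq zero_power)
  qed auto
  then show ?thesis
    using assms(2) by blast
qed

text \<open>For n = c * k the coefficient of \<open>z ^ k\<close> is a constant, since any further
  factor would exceed the degree. So f remains nonconstant in z over every (x, y).\<close>

lemma ex_root_z:
  fixes f :: "'k::alg_closed_field poly3"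
  assumes "hom n f" "n > 0" "eval3 f 0 0 1 \<noteq> 0"
  shows "\<exists>z. eval3 f x y z = 0"
proof -
  obtain k where k: "n = int c * int k"
    using hom_eval3_001 assms by blast
  have *: "poly (poly (coeff f k) [:y:]) x = eval3 f 0 0 1"
    using assms(1)
  proof (induction f rule: hom_induct)
    case (mon e i j k')
    then have eq: "a * i + b * j + c * k' = c * k"
      using k by (metis of_nat_eq_iff of_nat_mult)
    show ?case
    proof (cases "k' = k")
      case True
      then have "i = 0" "j = 0"
        using eq pos by auto
      then show ?thesis
        using True by (simp add: mon3_eq) (simp add: mon3_eq[symmetric, of _ 0 0, simplified] mon3_def poly_monom flip: mult_1_right)
    next
      case False
      then have "i > 0 \<or> j > 0"
        using eq pos by (cases i; cases j) auto
      then show ?thesis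
        using False by (auto simp: mon3_eq) (simp_all add: mon3_eq[symmetric] mon3_def)
    qed
  qed (simp_all)
  define \<phi> where "\<phi> c = poly (poly c [:y:]) x" for c :: "'k poly poly"
  interpret \<phi>: comm_ring_hom \<phi>
    by unfold_locales (simp_all add: \<phi>_def)
  define Q where "Q = map_poly \<phi> f"
  have "coeff Q k \<noteq> 0" "k > 0"
    using * assms k by (auto simp: Q_def \<phi>_def coeff_map_poly intro!: gr0I)
  then have "degree Q > 0"
    using le_degree by fastforce
  then obtain z where "poly Q z = 0"
    using alg_closed_imp_poly_has_root by blast
  moreover have "poly Q (\<phi> [:[:z:]:]) = \<phi> (poly f [:[:z:]:])"
    unfolding Q_def by (rule \<phi>.poly_map_poly)
  ultimately show ?thesis
    by (auto simp: \<phi>_def eval3_def)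
qed

text \<open>If (0, 1, 0) is no zero, then n = b * m, the power \<open>y ^ m\<close> occurs with a
  nonzero scalar, and f(1, y, 0) is a nonconstant polynomial in y.\<close>

lemma ex_zero_xy:
  fixes f :: "'k::alg_closed_field poly3"
  assumes "hom n f" "n > 0"
  shows "\<exists>x y. (x, y) \<noteq> (0, 0) \<and> eval3 f x y 0 = 0"
proof (cases "eval3 f 0 1 0 = 0")
  case True
  then show ?thesis
    by (intro exI[of _ 0] exI[of _ 1]) simp
next
  case False
  have "eval3 f 0 1 0 \<noteq> 0 \<longrightarrow> (\<exists>k. n = int b * int k)"
    using assms(1)
  proof (induction f rule: hom_induct)
    case (mon e i j k)
    then show ?case
      by (cases "i = 0 \<and> k = 0") (auto simp: mon3_eq zero_power)
  qed auto
  then obtain m where m: "n = int b * int m"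
    using False by blast
  have *: "poly (coeff (coeff f 0) m) 1 = eval3 f 0 1 0"
    using assms(1)
  proof (induction f rule: hom_induct)
    case (mon e i j k)
    then have eq: "a * i + b * j + c * k = b * m"
      using m by (metis of_nat_eq_iff of_nat_mult)
    have ev: "eval3 (mon3 e i j k) 0 1 0 = e * 0 ^ i * 0 ^ k"
      by (simp add: mon3_eq)
    consider "k > 0" | "k = 0" "j = m" | "k = 0" "j \<noteq> m"
      by blast
    then show ?case
    proof cases
      case 1
      then show ?thesis
        unfolding ev by (simp add: mon3_def)
    next
      case 2
      then have "i = 0"
        using eq pos by auto
      then show ?thesis
        using 2 unfolding ev by (simp add: mon3_def poly_monom)
    next
      case 3
      then have "i > 0"
        using eq pos by (cases i) auto
      then show ?thesis
        using 3 unfolding ev by (simp add: mon3_def)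
    qed
  qed simp_all
  define \<phi> where "\<phi> p = poly p 1" for p :: "'k poly"
  interpret \<phi>: comm_ring_hom \<phi>
    by unfold_locales (simp_all add: \<phi>_def)
  define Q where "Q = map_poly \<phi> (coeff f 0)"
  have "coeff Q m \<noteq> 0" "m > 0"
    using * assms m False by (auto simp: Q_def \<phi>_def coeff_map_poly intro!: gr0I)
  then have "degree Q > 0"
    using le_degree by fastforce
  then obtain y where y: "poly Q y = 0"
    using alg_closed_imp_poly_has_root by blast
  have "poly Q (\<phi> [:y:]) = \<phi> (poly (coeff f 0) [:y:])"
    unfolding Q_def by (rule \<phi>.poly_map_poly)
  then have "eval3 f 1 y 0 = 0"
    using y by (simp add: \<phi>_def) (simp add: eval3_def poly_0_coeff_0)
  then show ?thesis
    by (intro exI[of _ 1] exI[of _ y]) simp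
qed

text \<open>A weighted instance of Bezout's theorem. The degree condition makes it elementary: the
  form of smaller degree is at most linear in z, so z can be eliminated by hand.\<close>

lemma common_zero:
  fixes f g :: "'k::alg_closed_field poly3"
  assumes "a \<le> c" "b \<le> c" and f: "hom e f" and g: "hom e' g"
    and e: "0 < e" "e \<le> e'" "e + e' = int (a + b + c)"
  shows "\<exists>x y z. (x, y, z) \<noteq> (0, 0, 0) \<and> eval3 f x y z = 0 \<and> eval3 g x y z = 0"
proof (cases "eval3 f 0 0 1 = 0 \<and> eval3 g 0 0 1 = 0")
  case True
  then show ?thesis
    by (intro exI[of _ 0] exI[of _ 1]) simp
next
  case False
  have mult: "int c \<le> int c * int k" "k \<noteq> 1 \<Longrightarrow> 2 * int c \<le> int c * int k" if "int c * int k > 0" for k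
  proof -
    have "k \<ge> 1"
      using that by (cases k) auto
    then show "int c \<le> int c * int k"
      using pos by simp
    show "2 * int c \<le> int c * int k" if "k \<noteq> 1"
      using that \<open>k \<ge> 1\<close> mult_left_mono[of 2 "int k" "int c"] by linarith
  qed
  \<comment> \<open>As one of the forms is nonzero at (0, 0, 1), e or e' is a multiple of c. If that
    degree is c, then \<open>e \<le> c\<close> because \<open>e \<le> e'\<close>. If it is at least
    2 * c, then \<open>e + e' \<le> 3 * c\<close> leaves at most c for the other degree, and e is
    the smaller of the two.\<close>
  have ec: "e \<le> int c"
  proof (cases "eval3 f 0 0 1 = 0")
    case True
    then obtain k where k: "e' = int c * int k"
      using False hom_eval3_001[OF g] by blast
    have "int c * int k > 0" "int a \<le> int c" "int b \<le> int c" "e + e' = int a + int b + int c"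
      using k e assms(1,2) by auto
    then show ?thesis
      using mult[of k] e k by (cases "k = 1") (simp, linarith)
  next
    case False
    then obtain k where k: "e = int c * int k"
      using hom_eval3_001[OF f] by blast
    have "int c * int k > 0" "int a \<le> int c" "int b \<le> int c" "e + e' = int a + int b + int c"
      using k e assms(1,2) by auto
    then show ?thesis
      using mult[of k] e k pos by (cases "k = 1") (simp, linarith)
  qed
  define \<alpha> where "\<alpha> = coeff3 f 0 0 1"
  define p where "p = ([:coeff f 0:] :: 'k poly3)"
  have p: "coeff3 p i j k = (if k = 0 then coeff3 f i j 0 else 0)" for i j k
    by (cases k) (simp_all add: p_def coeff3_def)
  have f': "e = int (a * i + b * j + c * k)" if "coeff3 f i j k \<noteq> 0" for i j k
    using f that by (simp add: hom_iff)
  have hp: "hom e p"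
    unfolding hom_iff p using f' by (metis)
  have p0: "eval3 p x y z = eval3 p x y 0" for x y z
    by (simp add: p_def eval3_def)
  have fp: "f = mon3 \<alpha> 0 0 1 + p"
  proof (rule poly3_eqI)
    fix i j k
    show "coeff3 f i j k = coeff3 (mon3 \<alpha> 0 0 1 + p) i j k"
    proof (cases "k = 0")
      case True
      then show ?thesis by (simp add: p coeff3_mon3)
    next
      case k: False
      have "i = 0 \<and> j = 0 \<and> k = 1" if nz: "coeff3 f i j k \<noteq> 0"
      proof -
        have "int (a * i + b * j + c * k) \<le> int c"
          using f'[OF nz] ec by simp
        then have *: "a * i + b * j + c * k \<le> c"
          by (simp only: of_nat_le_iff)
        then have "c * k \<le> c * 1"
          by linarith
        then have "k = 1"
          using k pos by simp
        then show ?thesis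
          using * pos by simp
      qed
      then show ?thesis
        using k by (auto simp: p coeff3_mon3 \<alpha>_def)
    qed
  qed
  have ev: "eval3 f x y z = \<alpha> * z + eval3 p x y 0" for x y z
    unfolding fp by (simp add: mon3_eq p0[of x y z])
  \<comment> \<open>If f is free of z, a zero of f in the plane is completed by a root of g in z.
    Otherwise f = 0 is solved for z and the solution is inserted into g.\<close>
  show ?thesis
  proof (cases "\<alpha> = 0")
    case True
    have "eval3 f 0 0 1 = 0"
      using hom_eval3_0[OF hp e(1)] True by (simp add: ev)
    then have "eval3 g 0 0 1 \<noteq> 0"
      using False by simp
    obtain x y where xy: "(x, y) \<noteq> (0, 0)" "eval3 f x y 0 = 0"
      using ex_zero_xy[OF f e(1)] by blast
    obtain z where "eval3 g x y z = 0"
      using ex_root_z[OF g _ \<open>eval3 g 0 0 1 \<noteq> 0\<close>] e by auto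
    moreover have "eval3 f x y z = 0"
      using xy ev[of x y 0] ev[of x y z] True by simp
    ultimately show ?thesis
      using xy by blast
  next
    case \<alpha>: False
    then have "e = int c"
      using f'[of 0 0 1] by (simp add: \<alpha>_def)
    define q where "q = const3 (- 1 / \<alpha>) * p"
    have "hom (int c) q"
      using hp by (simp add: q_def hom_const_mult \<open>e = int c\<close>)
    then have "hom e' (sub varX varY q g)"
      by (intro hom_sub g hom_gen)
    then obtain x y where xy: "(x, y) \<noteq> (0, 0)" "eval3 (sub varX varY q g) x y 0 = 0"
      using ex_zero_xy e by (metis less_le_trans)
    then have "eval3 g x y (eval3 q x y 0) = 0"
      by (simp add: eval3_sub)
    moreover have "eval3 f x y (eval3 q x y 0) = 0"
      using \<alpha> by (simp add: ev q_def)
    ultimately show ?thesis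
      using xy by blast
  qed
qed

end

definition singular :: "'k::idom poly3 \<Rightarrow> 'k \<Rightarrow> 'k \<Rightarrow> 'k \<Rightarrow> bool" where
  "singular f x y z \<longleftrightarrow> eval3 (partial_x f) x y z = 0 \<and> eval3 (partial_y f) x y z = 0 \<and>
     eval3 (partial_z f) x y z = 0"

lemma isolated_singularity_iff: "isolated_singularity f \<longleftrightarrow> (\<forall>x y z. singular f x y z \<longleftrightarrow> x = 0 \<and> y = 0 \<and> z = 0)"
  by (auto simp: isolated_singularity_def singular_def set_eq_iff)

lemma coeff3_swap:
  "coeff3 (sub varZ varY varX f) i j k = coeff3 f k j i"
  "coeff3 (sub varX varZ varY f) i j k = coeff3 f i k j"
proof -
  have "sub varZ varY varX (mon3 e i j k) = mon3 e k j i" "sub varX varZ varY (mon3 e i j k) = mon3 e i k j"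
    for e :: 'a and i j k
    by (simp_all add: mon3_eq algebra_simps)
  then show "coeff3 (sub varZ varY varX f) i j k = coeff3 f k j i"
    "coeff3 (sub varX varZ varY f) i j k = coeff3 f i k j"
    by (induction f rule: poly3_induct_mon) (auto simp: coeff3_mon3)
qed

lemma singular_swap:
  "singular (sub varZ varY varX f) x y z \<longleftrightarrow> singular f z y x"
  "singular (sub varX varZ varY f) x y z \<longleftrightarrow> singular f x z y"
  unfolding singular_def partial_sub by (auto simp: eval3_sub partial_generators)

lemma homogeneous3_swap:
  "f \<in> homogeneous3 a b c n \<Longrightarrow> sub varZ varY varX f \<in> homogeneous3 c b a n"
  "f \<in> homogeneous3 a b c n \<Longrightarrow> sub varX varZ varY f \<in> homogeneous3 a c b n"
  by (fastforce simp: homogeneous3_def coeff3_swap algebra_simps)+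

lemma sub_unit: "f dvd 1 \<Longrightarrow> sub X Y Z f dvd 1"
  using sub_dvd[of f 1] by simp

text \<open>At a common zero of f and g the Leibniz rule annihilates all partial derivatives of f *
  g. \<open>common_zero\<close> wants the largest weight on z, which a transposition of z with x or
  y arranges.\<close>

lemma factor_of_isolated_singularity:
  fixes f g :: "'k::{alg_closed_field, field_char_0} poly3"
  assumes "a > 0" "b > 0" "c > 0" "f * g \<in> homogeneous3 a b c (a + b + c)"
    and "isolated_singularity (f * g)"
  shows "f dvd 1 \<or> g dvd 1"
proof -
  have nz: "h \<noteq> 0" if "isolated_singularity h" for h :: "'k poly3"
  proof
    assume "h = 0"
    then have "singular h 1 0 0"
      by (simp add: singular_def)
    then show False
      using that unfolding isolated_singularity_iff by (metis one_neq_zero)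
  qed
  have main: "f dvd 1 \<or> g dvd 1" if w: "a > 0" "b > 0" "c > 0" "a \<le> c" "b \<le> c"
    and h: "f * g \<in> homogeneous3 a b c (a + b + c)" and sing: "isolated_singularity (f * g)"
    for f g :: "'k poly3" and a b c
  proof (rule ccontr)
    assume nu: "\<not> (f dvd 1 \<or> g dvd 1)"
    interpret weights a b c
      by unfold_locales (use w in auto)
    have fg: "hom (int (a + b + c)) (f * g)"
      using h by (simp only: hom_homogeneous3)
    have nz: "f \<noteq> 0" "g \<noteq> 0"
      using nz[OF sing] by auto
    obtain e where e: "hom e f"
      using hom_factor[OF fg nz] by blast
    obtain e' where e': "hom e' g"
      using hom_factor[of _ g f] fg nz by (metis mult.commute)
    have sum: "e + e' = int (a + b + c)"
      using hom_mult[OF e e'] fg nz by (meson hom_unique mult_eq_0_iff)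
    have "e > 0"
    proof (rule ccontr)
      assume "\<not> e > 0"
      then have "e = 0"
        using hom_neg[OF e] nz by linarith
      then obtain u where u: "f = const3 u"
        using hom_zero_const e by blast
      then have "u \<noteq> 0"
        using nz by (auto simp: const3_simps)
      then show False
        using u nu const3_dvd_unit by blast
    qed
    moreover have "e' > 0"
    proof (rule ccontr)
      assume "\<not> e' > 0"
      then have "e' = 0"
        using hom_neg[OF e'] nz by linarith
      then obtain u where u: "g = const3 u"
        using hom_zero_const e' by blast
      then have "u \<noteq> 0"
        using nz by (auto simp: const3_simps)
      then show False
        using u nu const3_dvd_unit by blast
    qed
    ultimately have "\<exists>x y z. (x, y, z) \<noteq> (0, 0, 0) \<and> eval3 f x y z = 0 \<and> eval3 g x y z = 0"
      using common_zero[OF w(4,5) e e'] common_zero[OF w(4,5) e' e] sum by (cases "e \<le> e'") auto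
    then obtain x y z where xyz: "(x, y, z) \<noteq> (0, 0, 0)" "eval3 f x y z = 0" "eval3 g x y z = 0"
      by blast
    then have "singular (f * g) x y z"
      by (simp add: singular_def partial_derivation)
    then show False
      using sing xyz(1) unfolding isolated_singularity_iff by simp
  qed
  consider "a \<le> c" "b \<le> c" | "b \<le> a" "c \<le> a" | "a \<le> b" "c \<le> b"
    by linarith
  then show ?thesis
  proof cases
    case 1
    then show ?thesis using main assms by blast
  next
    case 2
    let ?s = "sub varZ varY varX :: 'k poly3 \<Rightarrow> _"
    have "?s f * ?s g \<in> homogeneous3 c b a (c + b + a)" "isolated_singularity (?s f * ?s g)"
      using homogeneous3_swap(1)[OF assms(4)] assms(5) singular_swap(1)[of "f * g"]
      by (auto simp: isolated_singularity_iff add_ac)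
    then have "?s f dvd 1 \<or> ?s g dvd 1"
      using main[of c b a] 2 assms(1-3) by blast
    then have "?s (?s f) dvd 1 \<or> ?s (?s g) dvd 1"
      using sub_unit by blast
    then show ?thesis
      by (simp add: sub_sub)
  next
    case 3
    let ?s = "sub varX varZ varY :: 'k poly3 \<Rightarrow> _"
    have "?s f * ?s g \<in> homogeneous3 a c b (a + c + b)" "isolated_singularity (?s f * ?s g)"
      using homogeneous3_swap(2)[OF assms(4)] assms(5) singular_swap(2)[of "f * g"]
      by (auto simp: isolated_singularity_iff add_ac)
    then have "?s f dvd 1 \<or> ?s g dvd 1"
      using main[of a c b] 3 assms(1-3) by blast
    then have "?s (?s f) dvd 1 \<or> ?s (?s g) dvd 1"
      using sub_unit by blast
    then show ?thesis
      by (simp add: sub_sub)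
  qed
qed

locale potential = weights a b c for a b c +
  fixes \<Omega> :: "'k::{alg_closed_field, field_char_0} poly3"
  assumes hom3_\<Omega>: "\<Omega> \<in> homogeneous3 a b c (a + b + c)" and sing: "isolated_singularity \<Omega>"
begin

abbreviation d :: int where "d \<equiv> int (a + b + c)"

lemma hom_\<Omega>: "hom d \<Omega>"
  using hom3_\<Omega> by (simp only: hom_homogeneous3)

lemma singular_iff: "singular \<Omega> x y z \<longleftrightarrow> x = 0 \<and> y = 0 \<and> z = 0"
  using sing unfolding isolated_singularity_iff by blast

lemma \<Omega>_nz: "\<Omega> \<noteq> 0"
  using singular_iff[of 1 0 0] by (auto simp: singular_def)

lemma \<Omega>_0: "eval3 \<Omega> 0 0 0 = 0"
  by (rule hom_eval3_0[OF hom_\<Omega>]) (use pos in auto)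

lemma irreducible_\<Omega>: "irreducible \<Omega>"
proof (rule irreducibleI)
  show "\<not> \<Omega> dvd 1"
  proof
    assume "\<Omega> dvd 1"
    then obtain k where "1 = \<Omega> * k" ..
    from arg_cong[OF this, of "\<lambda>f. eval3 f 0 0 0"] show False
      by (simp add: \<Omega>_0)
  qed
  show "f dvd 1 \<or> g dvd 1" if "\<Omega> = f * g" for f g
    using factor_of_isolated_singularity[of a b c f g] hom3_\<Omega> sing pos that by simp
qed (rule \<Omega>_nz)

text \<open>Polynomial rings over a factorial ring are factorial, so irreducible elements are
  prime.\<close>

lemma prime_\<Omega>: "\<Omega> dvd f * g \<Longrightarrow> \<Omega> dvd f \<or> \<Omega> dvd g"
  using irreducible_\<Omega> by (metis prime_elem_dvd_multD prime_elem_iff_irreducible)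

text \<open>If z did not occur, the gradient would be constant along the z-axis and thus vanish on
  all of it.\<close>

lemma degree_\<Omega>: "degree \<Omega> > 0"
proof (rule ccontr)
  assume "\<not> degree \<Omega> > 0"
  then obtain h where h: "\<Omega> = [:h:]"
    by (metis degree_eq_zeroE gr0I)
  have "partial_x \<Omega> = [:map_poly pderiv h:]" "partial_y \<Omega> = [:pderiv h:]" "partial_z \<Omega> = 0"
    using \<Omega>_nz by (simp_all add: h partial_x_def partial_y_def partial_z_def map_poly_pCons pderiv_pCons)
  then have "eval3 (partial_x \<Omega>) 0 0 1 = eval3 (partial_x \<Omega>) 0 0 0"
    "eval3 (partial_y \<Omega>) 0 0 1 = eval3 (partial_y \<Omega>) 0 0 0" "eval3 (partial_z \<Omega>) 0 0 1 = 0"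
    by (simp_all add: eval3_def)
  then have "singular \<Omega> 0 0 1"
    using singular_iff[of 0 0 0] by (simp add: singular_def)
  then show False
    by (simp add: singular_iff)
qed

lemma cmp_\<Omega>_shift: "C n (\<Omega> - const3 \<xi>) = (if n = d then \<Omega> else 0) - (if n = 0 then const3 \<xi> else 0)"
  by (simp add: cmp_hom[OF hom_\<Omega>] cmp_hom[OF hom_gen(4)])

text \<open>The top components of two factors multiply to \<Omega>, so one of them is a unit. It
  then has degree 0, and a factor with top degree 0 is a constant.\<close>

lemma irreducible_\<Omega>_shift: "irreducible (\<Omega> - const3 \<xi>)"
proof (rule irreducibleI)
  have d: "d > 0"
    using pos by simp
  have nz: "\<Omega> - const3 \<xi> \<noteq> 0"
    using cmp_\<Omega>_shift[of d \<xi>] d \<Omega>_nz by auto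
  then show "\<Omega> - const3 \<xi> \<noteq> 0" .
  show "f dvd 1 \<or> g dvd 1" if "\<Omega> - const3 \<xi> = f * g" for f g
  proof -
    have "f \<noteq> 0" "g \<noteq> 0"
      using nz that by auto
    obtain n where n: "n \<ge> 0" "lead 1 1 n f (C n f)" "C n f \<noteq> 0"
      using ex_lead[OF \<open>f \<noteq> 0\<close>] by (metis one_neq_zero)
    obtain m where m: "m \<ge> 0" "lead 1 1 m g (C m g)" "C m g \<noteq> 0"
      using ex_lead[OF \<open>g \<noteq> 0\<close>] by (metis one_neq_zero)
    have l: "lead 1 1 (n + m) (\<Omega> - const3 \<xi>) (C n f * C m g)"
      unfolding that using n m by (intro lead_mult) auto
    have "C d (\<Omega> - const3 \<xi>) \<noteq> 0"
      using d \<Omega>_nz unfolding cmp_\<Omega>_shift by simp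
    with l have l': "C (n + m) (\<Omega> - const3 \<xi>) = C n f * C m g" "d \<le> n + m"
      unfolding lead_def by fastforce+
    then have "C n f * C m g = \<Omega>"
      using n m d unfolding cmp_\<Omega>_shift by (simp split: if_splits)
    then have u: "C n f dvd 1 \<or> C m g dvd 1"
      using irreducible_\<Omega> by (metis irreducibleD)
    have unit: "h dvd 1" if h: "lead 1 1 k h (C k h)" "C k h dvd 1" for h :: "'k poly3" and k
    proof -
      obtain u where "1 = C k h * u"
        using h(2) ..
      then have "eval3 1 0 0 0 = eval3 (C k h) 0 0 0 * eval3 u 0 0 (0::'k)"
        by (simp flip: eval3_simps(6))
      then have "\<not> k > 0"
        using hom_eval3_0[OF hom_cmp[of k h]] by auto
      then have "C i h = 0" if "i > 0" for i
        using h(1) that by (auto simp: lead_def)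
      then have "C i h = C i (C 0 h)" for i
        using cmp_neg[of i h] by (cases "i = 0"; cases "i > 0") (simp_all add: cmp_cmp)
      then have "h = C 0 h"
        by (rule eq_of_cmp)
      then obtain e where e: "h = const3 e"
        using hom_zero_const hom_cmp by metis
      then have "e \<noteq> 0"
        using h(2) by (auto simp: const3_simps)
      then show ?thesis
        using e const3_dvd_unit by blast
    qed
    show ?thesis
      using u unit n m by blast
  qed
  show "\<not> \<Omega> - const3 \<xi> dvd 1"
  proof
    assume "\<Omega> - const3 \<xi> dvd 1"
    then obtain k where k: "1 = (\<Omega> - const3 \<xi>) * k" ..
    then have "k \<noteq> 0"
      by auto
    then obtain n where n: "n \<ge> 0" "lead 1 1 n k (C n k)" "C n k \<noteq> 0"
      using ex_lead by (metis one_neq_zero)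
    have "lead 1 1 d (\<Omega> - const3 \<xi>) (\<Omega> - 0)"
      using lead_hom[OF hom_\<Omega>, of 1 1] lead_weaken[OF lead_const[of 1 1 \<xi>], of d] d
      by (intro lead_diff) auto
    then have "lead 1 1 (d + n) 1 (\<Omega> * C n k)"
      unfolding k using n by (intro lead_mult) auto
    then have "C (d + n) (1 :: 'k poly3) = \<Omega> * C n k"
      by (simp add: lead_def)
    moreover have "C (d + n) (1 :: 'k poly3) = 0"
      using cmp_hom[OF hom_gen(4)[of 1], of "d + n"] n d by (simp add: const3_simps)
    ultimately show False
      using n \<Omega>_nz by simp
  qed
qed

lemma prime_\<Omega>_shift: "\<Omega> - const3 \<xi> dvd f * g \<Longrightarrow> \<Omega> - const3 \<xi> dvd f \<or> \<Omega> - const3 \<xi> dvd g"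
  using irreducible_\<Omega>_shift by (metis prime_elem_dvd_multD prime_elem_iff_irreducible)

lemma not_unit_\<Omega>_shift: "\<not> \<Omega> - const3 \<xi> dvd 1"
  using irreducible_\<Omega>_shift irreducible_not_unit by blast

end


section \<open>Poisson triples and their leading forms\<close>

text \<open>The fractions n / w are compared by cross multiplication, all w being positive;
  \<epsilon> = 1 selects the largest and \<epsilon> = -1 the smallest.\<close>

lemma ex_extremal_ratio:
  fixes S :: "(int \<times> int) set"
  assumes "finite S" "S \<noteq> {}" "\<And>n w. (n, w) \<in> S \<Longrightarrow> w > 0"
  shows "\<exists>p q. (p, q) \<in> S \<and> (\<forall>n w. (n, w) \<in> S \<longrightarrow> \<epsilon> * (n * q) \<le> \<epsilon> * (p * w))"
  using assms
proof (induction rule: finite_ne_induct)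
  case (insert s S)
  obtain p q where pq: "(p, q) \<in> S" "\<And>n w. (n, w) \<in> S \<Longrightarrow> \<epsilon> * (n * q) \<le> \<epsilon> * (p * w)"
    using insert.IH insert.prems by blast
  obtain r t where s: "s = (r, t)"
    by (cases s)
  have "q > 0" "t > 0"
    using pq insert.prems s by blast+
  show ?case
  proof (cases "\<epsilon> * (r * q) \<le> \<epsilon> * (p * t)")
    case True
    then show ?thesis
      using pq s by (intro exI[of _ p] exI[of _ q]) auto
  next
    case False
    then have rt: "\<epsilon> * (p * t) \<le> \<epsilon> * (r * q)"
      by simp
    have "\<epsilon> * (n * t) \<le> \<epsilon> * (r * w)" if "(n, w) \<in> S" for n w
    proof -
      have "w > 0" using that insert.prems by blast
      have "(\<epsilon> * (n * q)) * t \<le> (\<epsilon> * (p * w)) * t"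
        using pq(2)[OF that] \<open>t > 0\<close> by (intro mult_right_mono) auto
      also have "\<dots> = (\<epsilon> * (p * t)) * w"
        by (simp add: algebra_simps)
      also have "\<dots> \<le> (\<epsilon> * (r * q)) * w"
        using rt \<open>w > 0\<close> by (intro mult_right_mono) auto
      finally have "(\<epsilon> * (n * t)) * q \<le> (\<epsilon> * (r * w)) * q"
        by (simp add: algebra_simps)
      then show ?thesis
        using \<open>q > 0\<close> by (simp add: mult_le_cancel_right)
    qed
    then show ?thesis
      using s by (intro exI[of _ r] exI[of _ t]) auto
  qed
next
  case (singleton s)
  then show ?case
    by (cases s) auto
qed

context weights
begin

text \<open>The fraction p / q is deliberately not reduced: q is the weight and p the degree of a
  coordinate at which the extremum is attained. The leading form of that coordinate is therefore a
  genuine nonzero component of degree p, while those of the others may be 0.\<close>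

lemma extremal:
  fixes X Y Z :: "'k::comm_ring_1 poly3"
  assumes "X \<noteq> 0 \<or> Y \<noteq> 0 \<or> Z \<noteq> 0" "\<epsilon> \<noteq> 0"
  obtains p q X0 Y0 Z0 where "q > 0" "p \<ge> 0"
    "lead \<epsilon> q (p * int a) X X0" "lead \<epsilon> q (p * int b) Y Y0" "lead \<epsilon> q (p * int c) Z Z0"
    "q = int a \<and> lead \<epsilon> 1 p X X0 \<and> X0 \<noteq> 0 \<or> q = int b \<and> lead \<epsilon> 1 p Y Y0 \<and> Y0 \<noteq> 0 \<or>
     q = int c \<and> lead \<epsilon> 1 p Z Z0 \<and> Z0 \<noteq> 0"
proof -
  define L where "L = {(int a, X), (int b, Y), (int c, Z)}"
  define S where "S = {(n, w). \<exists>F. (w, F) \<in> L \<and> lead \<epsilon> 1 n F (C n F) \<and> C n F \<noteq> 0}"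
  have "S \<subseteq> (supp X \<union> supp Y \<union> supp Z) \<times> {int a, int b, int c}"
    by (auto simp: S_def L_def supp_def)
  then have "finite S"
    by (rule finite_subset) simp
  moreover have "S \<noteq> {}"
  proof -
    obtain w F where "(w, F) \<in> L" "F \<noteq> 0"
      using assms by (auto simp: L_def)
    moreover from this obtain n where "lead \<epsilon> 1 n F (C n F)" "C n F \<noteq> 0"
      using ex_lead assms by metis
    ultimately show ?thesis
      by (auto simp: S_def)
  qed
  moreover have "w > 0" if "(n, w) \<in> S" for n w
    using that pos by (auto simp: S_def L_def)
  ultimately obtain p q where pq: "(p, q) \<in> S" "\<And>n w. (n, w) \<in> S \<Longrightarrow> \<epsilon> * (n * q) \<le> \<epsilon> * (p * w)"
    using ex_extremal_ratio[of S \<epsilon>] by blast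
  have q: "q > 0"
    using pq(1) pos by (auto simp: S_def L_def)
  define sy where "sy w F = (if q dvd p * w then C (p * w div q) F else 0)" for w and F :: "'k poly3"
  have lead: "lead \<epsilon> q (p * w) F (sy w F)" if wF: "(w, F) \<in> L" for w F
  proof (cases "F = 0")
    case True
    then show ?thesis
      by (simp add: sy_def)
  next
    case False
    then obtain n where n: "lead \<epsilon> 1 n F (C n F)" "C n F \<noteq> 0"
      using ex_lead assms by metis
    then have "(n, w) \<in> S"
      using wF by (auto simp: S_def)
    then have le: "\<epsilon> * (n * q) \<le> \<epsilon> * (p * w)"
      using pq by blast
    have "0 \<le> \<epsilon> * (p * w - q * m)" if "C m F \<noteq> 0" for m
    proof -
      have "0 \<le> \<epsilon> * (n - m)"
        using n that by (simp add: lead_def)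
      then have "0 \<le> (\<epsilon> * (n - m)) * q"
        using q by simp
      then show ?thesis
        using le by (simp add: algebra_simps)
    qed
    then show ?thesis
      by (simp add: lead_def sy_def)
  qed
  obtain F where F: "(q, F) \<in> L" "lead \<epsilon> 1 p F (C p F)" "C p F \<noteq> 0"
    using pq(1) by (auto simp: S_def)
  have syF: "sy q F = C p F"
    using q by (simp add: sy_def)
  show ?thesis
  proof (rule that[of q p "sy (int a) X" "sy (int b) Y" "sy (int c) Z"])
    show "p \<ge> 0"
      using F(3) cmp_neg[of p F] by force
    show "q = int a \<and> lead \<epsilon> 1 p X (sy (int a) X) \<and> sy (int a) X \<noteq> 0 \<or>
      q = int b \<and> lead \<epsilon> 1 p Y (sy (int b) Y) \<and> sy (int b) Y \<noteq> 0 \<or>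
      q = int c \<and> lead \<epsilon> 1 p Z (sy (int c) Z) \<and> sy (int c) Z \<noteq> 0"
      using F syF by (auto simp: L_def)
  qed (use lead q in \<open>auto simp: L_def\<close>)
qed

lemma lead_int_bound: "lead 1 q r f f0 \<Longrightarrow> C n f \<noteq> 0 \<Longrightarrow> q * n \<le> r"
  "lead (-1) q r f f0 \<Longrightarrow> C n f \<noteq> 0 \<Longrightarrow> r \<le> q * n"
  by (force simp: lead_def)+

lemma hom_of_bounds: "(\<And>m. C m f \<noteq> 0 \<Longrightarrow> m = n) \<Longrightarrow> hom n f"
proof -
  assume *: "\<And>m. C m f \<noteq> 0 \<Longrightarrow> m = n"
  have "C m f = C m (C n f)" for m
    using *[of m] by (auto simp: cmp_cmp)
  then show ?thesis
    unfolding hom_def using eq_of_cmp by metis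
qed

lemma sub_const3: "\<exists>e. sub (const3 u) (const3 v) (const3 w) f = const3 e"
proof (induction f rule: poly3_induct)
  case (add f g)
  then obtain x y where "sub (const3 u) (const3 v) (const3 w) f = const3 x"
    "sub (const3 u) (const3 v) (const3 w) g = const3 y"
    by blast
  then show ?case
    by (intro exI[of _ "x + y"]) (simp add: const3_simps)
next
  case (mult f g)
  then obtain x y where "sub (const3 u) (const3 v) (const3 w) f = const3 x"
    "sub (const3 u) (const3 v) (const3 w) g = const3 y"
    by blast
  then show ?case
    by (intro exI[of _ "x * y"]) (simp add: const3_simps)
qed (auto intro: exI)

end

context potential
begin

text \<open>The relations of a Poisson morphism on the generators, modulo w. Three moduli occur:
  \<Omega> - \<xi> for the quotients, \<Omega> for leading forms on the cone, and 0 for identities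
  in A.\<close>

definition pois :: "'k poly3 \<Rightarrow> 'k poly3 \<Rightarrow> 'k poly3 \<Rightarrow> 'k poly3 \<Rightarrow> bool" where
  "pois w X Y Z \<longleftrightarrow> w dvd jacobian3 X Y \<Omega> - sub X Y Z (partial_z \<Omega>) \<and>
     w dvd jacobian3 Y Z \<Omega> - sub X Y Z (partial_x \<Omega>) \<and>
     w dvd jacobian3 Z X \<Omega> - sub X Y Z (partial_y \<Omega>)"

lemma jacobian3_\<Omega>_shift: "jacobian3 (\<Omega> - const3 \<xi>) g \<Omega> = 0"
proof -
  have "\<Omega> - const3 \<xi> = \<Omega> + const3 (- \<xi>)"
    by (simp add: const3_simps)
  then show ?thesis
    by (simp only: jacobian3_simps(3,8,9) add_0)
qed

text \<open>X, Y, Z define an algebra homomorphism from the quotient by \<Omega> to the quotient by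
  \<Omega> - \<xi>; source and target differ if \<xi> \<noteq> 0. A kernel element f that is nonzero
  modulo \<Omega> would, by elimination, make the images of any two elements dependent, so all
  brackets of images would vanish.\<close>

lemma sub_injective_shift:
  assumes \<Omega>: "\<Omega> - const3 \<xi> dvd sub X Y Z \<Omega>" and f: "\<Omega> - const3 \<xi> dvd sub X Y Z f"
    and br: "\<not> (\<Omega> - const3 \<xi> dvd jacobian3 X Y \<Omega> \<and> \<Omega> - const3 \<xi> dvd jacobian3 Y Z \<Omega> \<and>
      \<Omega> - const3 \<xi> dvd jacobian3 Z X \<Omega>)"
  shows "\<Omega> dvd f"
proof (rule ccontr)
  assume nd: "\<not> \<Omega> dvd f"
  define w where "w = \<Omega> - const3 \<xi>"
  have main: "w dvd jacobian3 (sub X Y Z g1) (sub X Y Z g2) \<Omega>" for g1 g2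
  proof (rule ccontr)
    assume ind: "\<not> w dvd jacobian3 (sub X Y Z g1) (sub X Y Z g2) \<Omega>"
    obtain r h where r: "r \<noteq> 0" "\<Omega> dvd sub g1 g2 0 [:r:] + f * h"
      using elimination[OF prime_\<Omega> degree_\<Omega> nd, of g1 g2] by blast
    have "w dvd sub X Y Z (sub g1 g2 0 [:r:] + f * h)"
      using \<Omega> sub_dvd[OF r(2), of X Y Z] unfolding w_def by (rule dvd_trans)
    then have "w dvd sub (sub X Y Z g1) (sub X Y Z g2) 0 [:r:] + sub X Y Z f * sub X Y Z h"
      by (simp add: sub_sub)
    then have "w dvd sub (sub X Y Z g1) (sub X Y Z g2) 0 [:r:]"
      using f by (simp add: w_def dvd_add_left_iff)
    then have "r = 0"
      by (intro algebraic_independence[of w, OF _ _ _ ind])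
        (use prime_\<Omega>_shift not_unit_\<Omega>_shift jacobian3_\<Omega>_shift in \<open>auto simp: w_def\<close>)
    then show False
      using r by simp
  qed
  show False
    using br main[of varX varY] main[of varY varZ] main[of varZ varX] by (simp add: w_def)
qed

text \<open>If all brackets vanished on the cone, the gradient of \<Omega> would vanish at (X, Y, Z)
  over every point of the cone. The isolated singularity then makes X, Y, Z vanish there, so
  \<Omega> would divide all three.\<close>

lemma sub_injective:
  assumes p: "pois \<Omega> X Y Z" and \<Omega>: "\<Omega> dvd sub X Y Z \<Omega>" and nz: "\<not> (\<Omega> dvd X \<and> \<Omega> dvd Y \<and> \<Omega> dvd Z)"
    and f: "\<Omega> dvd sub X Y Z f"
  shows "\<Omega> dvd f"
proof -
  have "\<not> (\<Omega> dvd jacobian3 X Y \<Omega> \<and> \<Omega> dvd jacobian3 Y Z \<Omega> \<and> \<Omega> dvd jacobian3 Z X \<Omega>)"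
  proof
    assume *: "\<Omega> dvd jacobian3 X Y \<Omega> \<and> \<Omega> dvd jacobian3 Y Z \<Omega> \<and> \<Omega> dvd jacobian3 Z X \<Omega>"
    have d: "\<Omega> dvd u \<Longrightarrow> \<Omega> dvd u - v \<Longrightarrow> \<Omega> dvd v" for u v :: "'k poly3"
      by (simp add: dvd_diff_right_iff)
    have dv: "\<Omega> dvd sub X Y Z (partial_x \<Omega>)" "\<Omega> dvd sub X Y Z (partial_y \<Omega>)" "\<Omega> dvd sub X Y Z (partial_z \<Omega>)"
      using p * d unfolding pois_def by blast+
    have "eval3 X x y z = 0 \<and> eval3 Y x y z = 0 \<and> eval3 Z x y z = 0" if "eval3 \<Omega> x y z = 0" for x y z
    proof -
      have "singular \<Omega> (eval3 X x y z) (eval3 Y x y z) (eval3 Z x y z)"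
        using dv that unfolding singular_def eval3_sub[symmetric]
        by (metis dvdE eval3_simps(6) mult_zero_left)
      then show ?thesis
        by (simp add: singular_iff)
    qed
    then have "\<Omega> dvd X" "\<Omega> dvd Y" "\<Omega> dvd Z"
      using vanishing_imp_dvd[OF prime_\<Omega> degree_\<Omega>] by blast+
    then show False
      using nz by blast
  qed
  then show ?thesis
    using sub_injective_shift[of 0 X Y Z f] \<Omega> f by (simp add: const3_simps)
qed

lemma d_pos: "d > 0"
  using pos by simp

lemma lead_\<Omega>_shift: "lead 1 1 d (\<Omega> - const3 \<xi>) \<Omega>"
proof -
  have "lead 1 1 d (\<Omega> - const3 \<xi>) (\<Omega> - 0)"
    using lead_hom[OF hom_\<Omega>, of 1 1] lead_weaken[OF lead_const[of 1 1 \<xi>], of d] d_pos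
    by (intro lead_diff) auto
  then show ?thesis by simp
qed

text \<open>The top component of \<Omega> - \<xi> is \<Omega>, as d > 0, and top components multiply
  in a domain: the ideal degenerates to that of the cone.\<close>

lemma dvd_shift_top:
  assumes "\<Omega> - const3 \<xi> dvd g" "g \<noteq> 0"
  obtains M h where "M \<ge> 0" "C (d + M) g = \<Omega> * h" "C (d + M) g \<noteq> 0" "\<And>n. C n g \<noteq> 0 \<Longrightarrow> n \<le> d + M"
proof -
  obtain h where h: "g = (\<Omega> - const3 \<xi>) * h"
    using assms(1) ..
  then have "h \<noteq> 0"
    using assms(2) by auto
  then obtain M where M: "M \<ge> 0" "lead 1 1 M h (C M h)" "C M h \<noteq> 0"
    using ex_lead by (metis one_neq_zero)
  have "lead 1 1 (d + M) g (\<Omega> * C M h)"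
    unfolding h by (intro lead_mult lead_\<Omega>_shift M) auto
  then have "C (d + M) g = \<Omega> * C M h" "\<And>n. C n g \<noteq> 0 \<Longrightarrow> n \<le> d + M"
    by (auto simp: lead_def)
  moreover have "\<Omega> * C M h \<noteq> 0"
    using M \<Omega>_nz by simp
  ultimately show ?thesis
    using that[of M "C M h"] M by simp
qed

lemma dvd_shift_lead:
  assumes g: "\<Omega> - const3 \<xi> dvd g" and l: "lead 1 q r g g0" "q > 0"
  shows "\<Omega> dvd g0"
proof (cases "g = 0 \<or> \<not> q dvd r")
  case True
  then show ?thesis
    using l by (auto simp: lead_def)
next
  case False
  then obtain M h where M: "C (d + M) g = \<Omega> * h" "C (d + M) g \<noteq> 0" "\<And>n. C n g \<noteq> 0 \<Longrightarrow> n \<le> d + M"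
    using dvd_shift_top[OF g] by metis
  define N where "N = r div q"
  have "r = q * N"
    using False by (simp add: N_def)
  have g0: "g0 = C N g"
    using l False by (simp add: lead_def N_def)
  have "q * (d + M) \<le> q * N"
    using lead_int_bound(1)[OF l(1) M(2)] \<open>r = q * N\<close> by simp
  then have "d + M \<le> N"
    using \<open>q > 0\<close> by simp
  show ?thesis
  proof (cases "N = d + M")
    case True
    then show ?thesis
      using M(1) g0 by simp
  next
    case False
    then have "\<not> N \<le> d + M"
      using \<open>d + M \<le> N\<close> by linarith
    then have "C N g = 0"
      using M(3) by blast
    then show ?thesis
      by (simp add: g0)
  qed
qed

text \<open>The source of all identities in A: between elements with degrees below d, a congruence
  modulo \<Omega> - \<xi> is an equality.\<close>

lemma dvd_shift_small:
  assumes "\<Omega> - const3 \<xi> dvd g" "\<And>n. C n g \<noteq> 0 \<Longrightarrow> n < d"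
  shows "g = 0"
proof (rule ccontr)
  assume "g \<noteq> 0"
  then obtain M where "M \<ge> 0" "C (d + M) g \<noteq> 0"
    using dvd_shift_top[OF assms(1)] by metis
  then show False
    using assms(2) by fastforce
qed

text \<open>For \<epsilon> = 1 the number N is the degree of the class of f: a top component
  divisible by \<Omega> could be traded for terms of lower degree. The variant \<epsilon> = -1
  serves the lowest forms.\<close>

definition red :: "int \<Rightarrow> int \<Rightarrow> 'k poly3 \<Rightarrow> bool" where
  "red \<epsilon> N f \<longleftrightarrow> lead \<epsilon> 1 N f (C N f) \<and> \<not> \<Omega> dvd C N f"

lemma red_nonneg: "red \<epsilon> N f \<Longrightarrow> N \<ge> 0"
  using cmp_neg[of N f] by (force simp: red_def)

text \<open>A top component \<Omega> * k0 is traded for \<xi> * k0, which lies d degrees lower. The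
  induction is on a strict upper bound n for the degrees that occur.\<close>

lemma red_exists:
  "\<Omega> - const3 \<xi> dvd f \<or> (\<exists>f' N. \<Omega> - const3 \<xi> dvd f - f' \<and> red 1 N f')"
proof -
  have *: "\<Omega> - const3 \<xi> dvd f \<or> (\<exists>f' N. \<Omega> - const3 \<xi> dvd f - f' \<and> red 1 N f')"
    if "\<And>m. C m f \<noteq> 0 \<Longrightarrow> m < int n" for n f
    using that
  proof (induction n arbitrary: f)
    case 0
    then have "C m f = C m 0" for m
      using cmp_neg[of m f] by force
    then have "f = 0"
      by (rule eq_of_cmp)
    then show ?case by simp
  next
    case (Suc n)
    show ?case
    proof (cases "\<Omega> dvd C (int n) f")
      case False
      have "lead 1 1 (int n) f (C (int n) f)"
        using Suc.prems by (force simp: lead_def)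
      then show ?thesis
        using False by (intro disjI2 exI[of _ f] exI[of _ "int n"]) (simp add: red_def)
    next
      case True
      then obtain k where k: "C (int n) f = \<Omega> * k" ..
      \<comment> \<open>The cofactor may be replaced by its component of degree n - d, because
        \<Omega> and \<open>C (int n) f\<close> are homogeneous.\<close>
      define k0 where "k0 = C (int n - d) k"
      have k0: "C (int n) f = \<Omega> * k0"
        using arg_cong[OF k, of "C (int n)"] by (simp add: cmp_cmp cmp_mult_hom[OF hom_\<Omega>] k0_def)
      have h: "hom (int n) (\<Omega> * k0)"
        unfolding k0[symmetric] by simp
      define f1 where "f1 = f - (\<Omega> - const3 \<xi>) * k0"
      have c: "C m f1 = C m f - (if m = int n then \<Omega> * k0 else 0)
          + (if m = int n - d then const3 \<xi> * k0 else 0)" for m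
        by (simp add: f1_def left_diff_distrib cmp_hom[OF h]) (simp add: k0_def cmp_cmp)
      have "m < int n" if nz: "C m f1 \<noteq> 0" for m
      proof (rule ccontr)
        assume "\<not> m < int n"
        then have m: "m \<noteq> int n - d" "m = int n \<or> m \<ge> int (Suc n)"
          using d_pos by auto
        then have "C m f1 = 0"
          using Suc.prems[of m] k0 unfolding c by fastforce
        then show False
          using nz by simp
      qed
      from Suc.IH[OF this]
      have "\<Omega> - const3 \<xi> dvd f1 \<or> (\<exists>f' N. \<Omega> - const3 \<xi> dvd f1 - f' \<and> red 1 N f')" by blast
      moreover have f: "f = f1 + (\<Omega> - const3 \<xi>) * k0"
        by (simp add: f1_def)
      moreover have "f - f' = (f1 - f') + (\<Omega> - const3 \<xi>) * k0" for f'
        by (simp add: f1_def)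
      ultimately show ?thesis
        by (metis dvd_add dvd_triv_left)
    qed
  qed
  have "C m f \<noteq> 0 \<Longrightarrow> m < int (Suc (degree (gr a b c f)))" for m
    using supp_eq[of f] by (auto simp: supp_def)
  then show ?thesis
    by (rule *)
qed

text \<open>If N > M, the component of f - g in degree N is that of f and would be divisible by
  \<Omega>. So the degree depends on the class only.\<close>

lemma red_unique:
  assumes "red 1 N f" "red 1 M g" "\<Omega> - const3 \<xi> dvd f - g"
  shows "N = M"
proof -
  have *: "\<not> N > M" if "red 1 N f" "red 1 M g" "\<Omega> - const3 \<xi> dvd f - g" for N M f g
  proof
    assume "N > M"
    then have "lead 1 1 N (f - g) (C N f - 0)"
      using that lead_weaken[of 1 1 M g "C M g" N] by (intro lead_diff) (auto simp: red_def)
    then have "\<Omega> dvd C N f"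
      using dvd_shift_lead[OF that(3)] by simp
    then show False
      using that by (simp add: red_def)
  qed
  have "\<Omega> - const3 \<xi> dvd g - f"
    using assms(3) by (metis dvd_minus_iff minus_diff_eq)
  then show ?thesis
    using *[OF assms] *[OF assms(2,1)] by linarith
qed

text \<open>Injectivity of the leading forms on the cone keeps the extreme component of the image
  nonzero modulo \<Omega>, so substitution multiplies reduced degrees by exactly p / q.\<close>

lemma sub_red:
  assumes \<epsilon>: "\<epsilon> \<noteq> 0" and q: "q > 0" and p: "p > 0"
    and l: "lead \<epsilon> q (p * int a) X X0" "lead \<epsilon> q (p * int b) Y Y0" "lead \<epsilon> q (p * int c) Z Z0"
    and inj: "\<And>f. \<Omega> dvd sub X0 Y0 Z0 f \<Longrightarrow> \<Omega> dvd f" and u: "red \<epsilon> m u"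
  shows "q dvd p * m" "red \<epsilon> (p * m div q) (sub X Y Z u)"
proof -
  have "lead \<epsilon> q (p * m) (sub X Y Z (C n u)) (if n = m then sub X0 Y0 Z0 (C m u) else 0)"
    if n: "n \<in> supp u" for n
  proof (cases "n = m")
    case True
    then show ?thesis
      using lead_sub[OF hom_cmp \<epsilon> q l, of m u] by simp
  next
    case False
    have "0 \<le> \<epsilon> * (m - n)"
      using u n by (simp add: red_def lead_def supp_def)
    then have "0 < \<epsilon> * (m - n)"
      using False \<epsilon> by (simp add: order_less_le)
    then have "0 < p * (\<epsilon> * (m - n))"
      using p by simp
    then have "0 < \<epsilon> * (p * m - p * n)"
      by (simp add: algebra_simps)
    then show ?thesis
      using False lead_weaken[OF lead_sub[OF hom_cmp \<epsilon> q l, of n u]] by simp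
  qed
  then have "lead \<epsilon> q (p * m) (\<Sum>n\<in>supp u. sub X Y Z (C n u))
      (\<Sum>n\<in>supp u. if n = m then sub X0 Y0 Z0 (C m u) else 0)"
    by (rule lead_sum)
  moreover have "m \<in> supp u"
    using u by (auto simp: red_def supp_def)
  ultimately have L: "lead \<epsilon> q (p * m) (sub X Y Z u) (sub X0 Y0 Z0 (C m u))"
    by (simp add: sub_sum[symmetric] sum_cmp)
  have nd: "\<not> \<Omega> dvd sub X0 Y0 Z0 (C m u)"
    using u inj by (auto simp: red_def)
  then show dv: "q dvd p * m"
    using L by (auto simp: lead_def split: if_splits)
  define N where "N = p * m div q"
  have N: "p * m = q * N"
    using dv by (simp add: N_def)
  have "C N (sub X Y Z u) = sub X0 Y0 Z0 (C m u)"
    using L dv by (simp add: lead_def N_def)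
  moreover have "lead \<epsilon> 1 N (sub X Y Z u) (C N (sub X Y Z u))"
  proof -
    have "0 \<le> \<epsilon> * (N - n)" if "C n (sub X Y Z u) \<noteq> 0" for n
    proof -
      have "0 \<le> \<epsilon> * (q * N - q * n)"
        using L that unfolding lead_def N by blast
      also have "\<dots> = q * (\<epsilon> * (N - n))"
        by (simp add: algebra_simps)
      finally show ?thesis
        using q by (simp add: zero_le_mult_iff)
    qed
    then show ?thesis
      by (simp add: lead_def)
  qed
  ultimately show "red \<epsilon> (p * m div q) (sub X Y Z u)"
    using nd by (simp add: red_def N_def)
qed

text \<open>The bracket of two variables and the matching partial derivative of \<Omega> have the
  same degree, so the bounds for both sides agree.\<close>

lemma lead_pois:
  assumes \<epsilon>: "\<epsilon> \<noteq> 0" and q: "q > 0"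
    and l: "lead \<epsilon> q (p * int a) X X0" "lead \<epsilon> q (p * int b) Y Y0" "lead \<epsilon> q (p * int c) Z Z0"
  shows "lead \<epsilon> q (p * int a + p * int b) (jacobian3 X Y \<Omega> - sub X Y Z (partial_z \<Omega>))
      (jacobian3 X0 Y0 \<Omega> - sub X0 Y0 Z0 (partial_z \<Omega>))"
    "lead \<epsilon> q (p * int b + p * int c) (jacobian3 Y Z \<Omega> - sub X Y Z (partial_x \<Omega>))
      (jacobian3 Y0 Z0 \<Omega> - sub X0 Y0 Z0 (partial_x \<Omega>))"
    "lead \<epsilon> q (p * int c + p * int a) (jacobian3 Z X \<Omega> - sub X Y Z (partial_y \<Omega>))
      (jacobian3 Z0 X0 \<Omega> - sub X0 Y0 Z0 (partial_y \<Omega>))"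
proof -
  note s = lead_sub[OF _ \<epsilon> q l]
  note h = s[OF hom_partial(1)[OF hom_\<Omega>]] s[OF hom_partial(2)[OF hom_\<Omega>]] s[OF hom_partial(3)[OF hom_\<Omega>]]
  note j = lead_jacobian3[OF hom_\<Omega> \<epsilon> q]
  show "lead \<epsilon> q (p * int a + p * int b) (jacobian3 X Y \<Omega> - sub X Y Z (partial_z \<Omega>))
      (jacobian3 X0 Y0 \<Omega> - sub X0 Y0 Z0 (partial_z \<Omega>))"
    using lead_diff[OF j[OF l(1,2)]] h(3) by (simp add: distrib_left)
  show "lead \<epsilon> q (p * int b + p * int c) (jacobian3 Y Z \<Omega> - sub X Y Z (partial_x \<Omega>))
      (jacobian3 Y0 Z0 \<Omega> - sub X0 Y0 Z0 (partial_x \<Omega>))"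
    using lead_diff[OF j[OF l(2,3)]] h(1) by (simp add: distrib_left)
  show "lead \<epsilon> q (p * int c + p * int a) (jacobian3 Z X \<Omega> - sub X Y Z (partial_y \<Omega>))
      (jacobian3 Z0 X0 \<Omega> - sub X0 Y0 Z0 (partial_y \<Omega>))"
    using lead_diff[OF j[OF l(3,1)]] h(2) by (simp add: distrib_left add.commute)
qed

theorem degree_bound:
  assumes p: "pois (\<Omega> - const3 \<xi>) X Y Z" and w: "\<Omega> - const3 \<xi> dvd sub X Y Z (\<Omega> - const3 \<xi>)"
    and surj: "\<And>v. \<exists>u. \<Omega> - const3 \<xi> dvd sub X Y Z u - v"
    and rd: "X = 0 \<or> (\<exists>n. red 1 n X)" "Y = 0 \<or> (\<exists>n. red 1 n Y)" "Z = 0 \<or> (\<exists>n. red 1 n Z)"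
  shows "(\<forall>n. C n X \<noteq> 0 \<longrightarrow> n \<le> int a) \<and> (\<forall>n. C n Y \<noteq> 0 \<longrightarrow> n \<le> int b) \<and> (\<forall>n. C n Z \<noteq> 0 \<longrightarrow> n \<le> int c)"
proof -
  let ?w = "\<Omega> - const3 \<xi>"
  \<comment> \<open>A constant triple would reach constants only, and a difference
    \<open>const3 e - varX\<close> has degree below d, hence is no multiple of \<Omega> -
    \<xi>.\<close>
  have nc: "\<not> (\<exists>e1 e2 e3. X = const3 e1 \<and> Y = const3 e2 \<and> Z = const3 e3)"
  proof
    assume "\<exists>e1 e2 e3. X = const3 e1 \<and> Y = const3 e2 \<and> Z = const3 e3"
    then obtain e u where "?w dvd const3 e - varX"
      using surj[of varX] sub_const3 by metis
    moreover have cm: "C n (const3 e - varX) = (if n = 0 then const3 e else 0) - (if n = int a then varX else 0)" for n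
      by (simp add: cmp_hom[OF hom_gen(4)] cmp_hom[OF hom_gen(1)])
    ultimately have "const3 e - varX = 0"
      by (intro dvd_shift_small) (use d_pos pos in \<open>auto split: if_splits\<close>)
    then have "C (int a) (const3 e - varX) = 0"
      by simp
    then show False
      using pos unfolding cm by (simp add: varX_def)
  qed
  then have ne: "X \<noteq> 0 \<or> Y \<noteq> 0 \<or> Z \<noteq> 0"
    by (metis const3_simps(1))
  have one: "(1::int) \<noteq> 0" by simp
  obtain p0 q X0 Y0 Z0 where q: "q > 0" and p0: "p0 \<ge> 0"
    and l: "lead 1 q (p0 * int a) X X0" "lead 1 q (p0 * int b) Y Y0" "lead 1 q (p0 * int c) Z Z0"
    and ex: "q = int a \<and> lead 1 1 p0 X X0 \<and> X0 \<noteq> 0 \<or> q = int b \<and> lead 1 1 p0 Y Y0 \<and> Y0 \<noteq> 0 \<or>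
     q = int c \<and> lead 1 1 p0 Z Z0 \<and> Z0 \<noteq> 0"
    by (rule extremal[OF ne one]) blast
  have pp: "p0 > 0"
  proof (rule ccontr)
    assume "\<not> p0 > 0"
    then have "p0 = 0" using p0 by simp
    have "\<exists>e. F = const3 e" if "lead 1 q (p0 * r) F F0" for r F F0
    proof -
      have "n = 0" if nz: "C n F \<noteq> 0" for n
      proof -
        have "n \<ge> 0"
          using nz cmp_neg by force
        moreover have "q * n \<le> 0"
          using lead_int_bound(1)[OF \<open>lead 1 q (p0 * r) F F0\<close> nz] \<open>p0 = 0\<close> by simp
        ultimately show ?thesis
          using q by (simp add: mult_le_0_iff)
      qed
      then show ?thesis
        by (intro hom_zero_const hom_of_bounds)
    qed
    then show False
      using nc l by blast
  qed
  have top: "n = p0 \<and> F0 = C n F" if "lead 1 1 p0 F F0" "F0 \<noteq> 0" "red 1 n F" for n F F0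
  proof -
    have F0: "F0 = C p0 F"
      using that by (simp add: lead_def)
    moreover have "C n F \<noteq> 0"
      using that by (auto simp: red_def)
    ultimately have "n \<le> p0" "p0 \<le> n"
      using that lead_int_bound(1)[of 1 p0 F F0 n] lead_int_bound(1)[of 1 n F "C n F" p0] by (auto simp: red_def)
    then show ?thesis
      using F0 by simp
  qed
  \<comment> \<open>The coordinate that attains the extremal ratio is a reduced representative, so
    \<Omega> does not divide its leading form. This is what the choice of representatives is
    for.\<close>
  have nd: "\<not> (\<Omega> dvd X0 \<and> \<Omega> dvd Y0 \<and> \<Omega> dvd Z0)" and rp: "\<exists>u. red 1 p0 u"
  proof -
    have key: "\<not> \<Omega> dvd F0 \<and> red 1 p0 F" if h: "lead 1 1 p0 F F0" "F0 \<noteq> 0" "F = 0 \<or> (\<exists>n. red 1 n F)" for F F0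
    proof -
      have "F \<noteq> 0"
        using h by (auto simp: lead_def)
      then obtain n where "red 1 n F"
        using h by blast
      then show ?thesis
        using top[OF h(1,2)] by (auto simp: red_def)
    qed
    show "\<not> (\<Omega> dvd X0 \<and> \<Omega> dvd Y0 \<and> \<Omega> dvd Z0)" "\<exists>u. red 1 p0 u"
      using ex rd key by blast+
  qed
  have "pois \<Omega> X0 Y0 Z0"
    using p lead_pois[OF one q l] dvd_shift_lead[OF _ _ q] unfolding pois_def by blast
  \<comment> \<open>As p0 > 0, the constant \<xi> lies strictly below degree p0 * d / q and
    disappears from the leading form.\<close>
  moreover have "\<Omega> dvd sub X0 Y0 Z0 \<Omega>"
  proof -
    have "lead 1 q (p0 * d) (sub X Y Z \<Omega> - const3 \<xi>) (sub X0 Y0 Z0 \<Omega> - 0)"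
      by (intro lead_diff lead_sub[OF hom_\<Omega> one q l] lead_weaken[OF lead_const[OF q]]) (use pp d_pos in simp)
    then show ?thesis
      using dvd_shift_lead[OF w _ q] by simp
  qed
  ultimately have inj: "\<Omega> dvd sub X0 Y0 Z0 f \<Longrightarrow> \<Omega> dvd f" for f
    using sub_injective nd by blast
  note sr = sub_red[OF one q pp l inj]
  \<comment> \<open>\<open>m0\<close> is the least positive degree of a reduced element. A preimage
    of an element v of this degree has a reduced degree m with \<open>p0 * m = q * m0\<close>; it is
    positive too, so \<open>m0 \<le> m\<close>, and hence \<open>p0 \<le> q\<close>.\<close>
  define P where "P m \<longleftrightarrow> m > 0 \<and> (\<exists>u. red 1 (int m) u)" for m
  have "P (nat p0)"
    using pp rp by (simp add: P_def)
  then have LP: "P (LEAST m. P m)" and min: "\<And>m. P m \<Longrightarrow> (LEAST m. P m) \<le> m"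
    by (auto intro: LeastI Least_le)
  define m0 where "m0 = (LEAST m. P m)"
  obtain v where v: "red 1 (int m0) v" and m0: "m0 > 0"
    using LP by (auto simp: P_def m0_def)
  have "\<not> ?w dvd v"
    using dvd_shift_lead[of \<xi> v 1 "int m0" "C (int m0) v"] v by (auto simp: red_def)
  obtain u where u: "?w dvd sub X Y Z u - v"
    using surj by blast
  have subw: "?w dvd sub X Y Z f" if "?w dvd f" for f
    using w sub_dvd[OF that, of X Y Z] by (rule dvd_trans)
  have "\<not> ?w dvd u"
  proof
    assume "?w dvd u"
    then have "?w dvd v"
      using subw u by (metis dvd_diff_right_iff)
    then show False
      using \<open>\<not> ?w dvd v\<close> by blast
  qed
  then obtain u' m where u': "?w dvd u - u'" "red 1 m u'"
    using red_exists by blast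
  have "sub X Y Z u' - v = (sub X Y Z u - v) - sub X Y Z (u - u')"
    by simp
  then have "?w dvd sub X Y Z u' - v"
    using dvd_diff[OF u subw[OF u'(1)]] by (simp only:)
  then have eq: "p0 * m div q = int m0"
    using red_unique sr[OF _ u'(2)] v by blast
  have mp1: "p0 * m = q * int m0"
    using sr(1)[OF _ u'(2)] eq by (metis dvd_mult_div_cancel)
  have "q * int m0 > 0"
    using q m0 by simp
  then have "m \<noteq> 0"
    using mp1 by auto
  then have mp: "p0 * m = q * int m0" "m > 0"
    using red_nonneg[OF u'(2)] mp1 by auto
  then have "P (nat m)"
    using u' by (auto simp: P_def)
  then have "int m0 \<le> m"
    using min[of "nat m"] mp by (simp add: m0_def)
  then have "q * int m0 \<le> q * m"
    using q by simp
  then have "p0 * m \<le> q * m"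
    using mp by simp
  then have pq: "p0 \<le> q"
    by (rule mult_right_le_imp_le) (rule mp(2))
  have bound: "n \<le> int r" if "lead 1 q (p0 * int r) F F0" "C n F \<noteq> 0" for r F F0 n
  proof -
    have "q * n \<le> p0 * int r"
      using lead_int_bound(1) that by blast
    also have "\<dots> \<le> q * int r"
      using pq by (simp add: mult_right_mono)
    finally show ?thesis
      using q by simp
  qed
  show ?thesis
    using bound[OF l(1)] bound[OF l(2)] bound[OF l(3)] by blast
qed

end


section \<open>Exact Poisson automorphisms are graded\<close>

context potential
begin

definition exact_aut :: "'k poly3 \<Rightarrow> 'k poly3 \<Rightarrow> 'k poly3 \<Rightarrow> 'k poly3 \<Rightarrow> 'k poly3 \<Rightarrow> 'k poly3 \<Rightarrow> bool" where
  "exact_aut X Y Z X' Y' Z' \<longleftrightarrow> pois 0 X Y Z \<and> pois 0 X' Y' Z' \<and>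
     sub X Y Z X' = varX \<and> sub X Y Z Y' = varY \<and> sub X Y Z Z' = varZ \<and>
     sub X' Y' Z' X = varX \<and> sub X' Y' Z' Y = varY \<and> sub X' Y' Z' Z = varZ"

lemma exact_aut_sym: "exact_aut X Y Z X' Y' Z' \<Longrightarrow> exact_aut X' Y' Z' X Y Z"
  by (simp add: exact_aut_def)

lemma exact_aut_inverse: "exact_aut X Y Z X' Y' Z' \<Longrightarrow> sub X Y Z (sub X' Y' Z' f) = f"
  by (simp add: exact_aut_def sub_sub)

lemma pois_exact:
  "pois 0 X Y Z \<longleftrightarrow> jacobian3 X Y \<Omega> = sub X Y Z (partial_z \<Omega>) \<and>
     jacobian3 Y Z \<Omega> = sub X Y Z (partial_x \<Omega>) \<and> jacobian3 Z X \<Omega> = sub X Y Z (partial_y \<Omega>)"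
  by (simp add: pois_def)

definition jac_det :: "'k poly3 \<Rightarrow> 'k poly3 \<Rightarrow> 'k poly3 \<Rightarrow> 'k poly3" where
  "jac_det X Y Z = jacobian3 X Y Z"

text \<open>All brackets vanish at the origin, so the gradient of \<Omega> vanishes at its image:
  the only singular point is fixed.\<close>

lemma eval3_pois_0:
  assumes "pois 0 X Y Z"
  shows "eval3 X 0 0 0 = 0" "eval3 Y 0 0 0 = 0" "eval3 Z 0 0 0 = 0"
proof -
  have g: "eval3 (partial_x \<Omega>) 0 0 0 = 0" "eval3 (partial_y \<Omega>) 0 0 0 = 0" "eval3 (partial_z \<Omega>) 0 0 0 = 0"
    using singular_iff[of 0 0 0] by (auto simp: singular_def)
  then have j: "eval3 (jacobian3 f h \<Omega>) 0 0 0 = 0" for f h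
    by (simp add: jacobian3_def)
  have "singular \<Omega> (eval3 X 0 0 0) (eval3 Y 0 0 0) (eval3 Z 0 0 0)"
    using assms j unfolding pois_exact singular_def eval3_sub[symmetric] by metis
  then show "eval3 X 0 0 0 = 0" "eval3 Y 0 0 0 = 0" "eval3 Z 0 0 0 = 0"
    by (simp_all add: singular_iff)
qed

text \<open>Cramer's rule: the gradient of \<open>\<Omega>(X, Y, Z)\<close> is the Jacobian determinant times that of \<open>\<Omega>\<close>.\<close>
lemma partial_sub_\<Omega>:
  assumes "pois 0 X Y Z"
  shows "partial_x (sub X Y Z \<Omega>) = jac_det X Y Z * partial_x \<Omega>"
    "partial_y (sub X Y Z \<Omega>) = jac_det X Y Z * partial_y \<Omega>"
    "partial_z (sub X Y Z \<Omega>) = jac_det X Y Z * partial_z \<Omega>"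
proof -
  have e: "sub X Y Z (partial_z \<Omega>) = jacobian3 X Y \<Omega>" "sub X Y Z (partial_x \<Omega>) = jacobian3 Y Z \<Omega>"
    "sub X Y Z (partial_y \<Omega>) = jacobian3 Z X \<Omega>"
    using assms by (simp_all add: pois_exact)
  show "partial_x (sub X Y Z \<Omega>) = jac_det X Y Z * partial_x \<Omega>"
    "partial_y (sub X Y Z \<Omega>) = jac_det X Y Z * partial_y \<Omega>"
    "partial_z (sub X Y Z \<Omega>) = jac_det X Y Z * partial_z \<Omega>"
    unfolding partial_sub e jacobian3_def jac_det_def by (simp_all add: algebra_simps)
qed

text \<open>Cramer's rule for the triple and for its inverse gives grad \<Omega> = J' * J * grad
  \<Omega>, so the Jacobian determinant is a unit and thus a constant J. Then \<Omega>(X, Y, Z) - J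
  * \<Omega> has gradient 0, and it vanishes at the origin, which is fixed.\<close>

lemma sub_\<Omega>_exact_aut:
  assumes ex: "exact_aut X Y Z X' Y' Z'"
  obtains J where "J \<noteq> 0" "sub X Y Z \<Omega> = const3 J * \<Omega>" "jac_det X Y Z = const3 J"
proof -
  have p: "pois 0 X Y Z" "pois 0 X' Y' Z'"
    using ex by (simp_all add: exact_aut_def)
  let ?J = "jac_det X Y Z" and ?J' = "sub X Y Z (jac_det X' Y' Z')"
  note d = partial_sub_\<Omega>[OF p(1)] and d' = partial_sub_\<Omega>[OF p(2)]
  have \<Omega>: "\<Omega> = sub X Y Z (sub X' Y' Z' \<Omega>)"
    using exact_aut_inverse[OF ex] by simp
  have prod: "partial_x \<Omega> = ?J' * ?J * partial_x \<Omega>" "partial_y \<Omega> = ?J' * ?J * partial_y \<Omega>"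
    "partial_z \<Omega> = ?J' * ?J * partial_z \<Omega>"
  proof -
    have "partial_x \<Omega> = ?J' * partial_x (sub X Y Z \<Omega>)"
      by (subst \<Omega>) (simp add: partial_sub(1)[of X Y Z] d' algebra_simps)
    then show "partial_x \<Omega> = ?J' * ?J * partial_x \<Omega>"
      by (simp add: d)
    have "partial_y \<Omega> = ?J' * partial_y (sub X Y Z \<Omega>)"
      by (subst \<Omega>) (simp add: partial_sub(2)[of X Y Z] d' algebra_simps)
    then show "partial_y \<Omega> = ?J' * ?J * partial_y \<Omega>"
      by (simp add: d)
    have "partial_z \<Omega> = ?J' * partial_z (sub X Y Z \<Omega>)"
      by (subst \<Omega>) (simp add: partial_sub(3)[of X Y Z] d' algebra_simps)
    then show "partial_z \<Omega> = ?J' * ?J * partial_z \<Omega>"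
      by (simp add: d)
  qed
  have "partial_x \<Omega> \<noteq> 0 \<or> partial_y \<Omega> \<noteq> 0 \<or> partial_z \<Omega> \<noteq> 0"
    using singular_iff[of 1 0 0] by (auto simp: singular_def)
  then have "?J' * ?J = 1"
    using prod by (metis mult_cancel_right1)
  then have unit: "?J dvd 1" and Jnz: "?J \<noteq> 0"
    by (metis dvd_triv_right) (use \<open>?J' * ?J = 1\<close> in auto)
  \<comment> \<open>Both determinants are factors of the homogeneous element 1, so they are
    homogeneous; their degrees are nonnegative with sum 0.\<close>
  obtain J where J: "?J = const3 J"
  proof -
    have "hom 0 (?J' * ?J)"
      using hom_gen(4)[of 1] \<open>?J' * ?J = 1\<close> by (simp add: const3_simps)
    moreover have "?J' \<noteq> 0"
      using \<open>?J' * ?J = 1\<close> by auto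
    ultimately obtain n m where "hom n ?J" "hom m ?J'"
      using hom_factor[of 0 ?J ?J'] hom_factor[of 0 ?J' ?J] Jnz by (metis mult.commute)
    moreover from this have "n + m = 0"
      using hom_mult[of n ?J m ?J'] \<open>hom 0 (?J' * ?J)\<close> hom_unique Jnz \<open>?J' \<noteq> 0\<close>
      by (metis mult.commute mult_eq_0_iff)
    ultimately have "n = 0"
      using hom_neg Jnz \<open>?J' \<noteq> 0\<close> by (metis add_less_same_cancel1 add_neg_neg less_irrefl linorder_neqE_linordered_idom not_less_iff_gr_or_eq)
    then show ?thesis
      using \<open>hom n ?J\<close> hom_zero_const that by blast
  qed
  define h where "h = sub X Y Z \<Omega> - const3 J * \<Omega>"
  have "partial_x h = 0" "partial_y h = 0" "partial_z h = 0"
    by (simp_all add: h_def partial_minus partial_derivation d J)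
  then have z: "of_nat (Suc i) * coeff3 h (Suc i) j k = 0" "of_nat (Suc j) * coeff3 h i (Suc j) k = 0"
    "of_nat (Suc k) * coeff3 h i j (Suc k) = 0" for i j k
    unfolding coeff3_partial[symmetric] by simp_all
  have "coeff3 h i j k = 0" if "\<not> (i = 0 \<and> j = 0 \<and> k = 0)" for i j k
    using that z(1)[of "i - 1" j k] z(2)[of "j - 1" i k] z(3)[of "k - 1" i j]
    by (cases i; cases j; cases k) (simp_all del: of_nat_Suc)
  then have "h = mon3 (coeff3 h 0 0 0) 0 0 0"
    by (intro poly3_eqI) (auto simp: coeff3_mon3)
  then have hc: "h = const3 (coeff3 h 0 0 0)"
    by (simp add: mon3_eq)
  have "eval3 h 0 0 0 = 0"
    by (simp add: h_def eval3_sub eval3_pois_0[OF p(1)] \<Omega>_0)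
  then have "h = 0"
    using hc by (metis const3_simps(1) eval3_simps(1))
  then have "sub X Y Z \<Omega> = const3 J * \<Omega>"
    by (simp add: h_def)
  moreover have "J \<noteq> 0"
    using Jnz J by (auto simp: const3_simps)
  ultimately show ?thesis
    using that J by blast
qed

lemma exact_aut_nonzero:
  assumes "exact_aut X Y Z X' Y' Z'"
  shows "X \<noteq> 0" "Y \<noteq> 0" "Z \<noteq> 0"
  using assms by (auto simp: exact_aut_def varX_def varY_def varZ_def)

text \<open>The minimality argument is applied to an image instead of a preimage: an element of
  least positive lowest degree m0 goes to one of degree p0 * m0 / q, again positive, so
  \<open>m0 \<le> p0 * m0 / q\<close> and \<open>q \<le> p0\<close>. Together with the upper bounds
  only one degree is left for each coordinate.\<close>

lemma exact_aut_lower_bound: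
  assumes ex: "exact_aut X Y Z X' Y' Z'"
    and deg: "\<And>n. C n X \<noteq> 0 \<Longrightarrow> n \<le> int a" "\<And>n. C n Y \<noteq> 0 \<Longrightarrow> n \<le> int b" "\<And>n. C n Z \<noteq> 0 \<Longrightarrow> n \<le> int c"
  shows "hom (int a) X \<and> hom (int b) Y \<and> hom (int c) Z"
proof -
  have p: "pois 0 X Y Z"
    using ex by (simp add: exact_aut_def)
  obtain J where J: "J \<noteq> 0" "sub X Y Z \<Omega> = const3 J * \<Omega>"
    using sub_\<Omega>_exact_aut[OF ex] by blast
  have ne: "X \<noteq> 0 \<or> Y \<noteq> 0 \<or> Z \<noteq> 0"
    using exact_aut_nonzero[OF ex] by blast
  have one: "(-1::int) \<noteq> 0" by simp
  obtain p0 q X0 Y0 Z0 where q: "q > 0" and p0: "p0 \<ge> 0"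
    and l: "lead (-1) q (p0 * int a) X X0" "lead (-1) q (p0 * int b) Y Y0" "lead (-1) q (p0 * int c) Z Z0"
    and e: "q = int a \<and> lead (-1) 1 p0 X X0 \<and> X0 \<noteq> 0 \<or> q = int b \<and> lead (-1) 1 p0 Y Y0 \<and> Y0 \<noteq> 0 \<or>
     q = int c \<and> lead (-1) 1 p0 Z Z0 \<and> Z0 \<noteq> 0"
    by (rule extremal[OF ne one]) blast
  \<comment> \<open>By the upper bounds a lowest form has degree below d and cannot be a nonzero
    multiple of \<Omega>. This takes the place of reduced representatives.\<close>
  have small: "\<not> \<Omega> dvd F0" if F: "lead (-1) 1 p0 F F0" "F0 \<noteq> 0" "\<And>n. C n F \<noteq> 0 \<Longrightarrow> n < d" for F F0
  proof
    assume "\<Omega> dvd F0"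
    have F0: "F0 = C p0 F"
      using F by (simp add: lead_def)
    then have "p0 < d"
      using F by blast
    then have "C n F0 \<noteq> 0 \<Longrightarrow> n < d" for n
      by (auto simp: F0 cmp_cmp split: if_splits)
    then show False
      using dvd_shift_small[of 0 F0] \<open>\<Omega> dvd F0\<close> F(2) by (simp add: const3_simps)
  qed
  have "n < d" if "C n X \<noteq> 0 \<or> C n Y \<noteq> 0 \<or> C n Z \<noteq> 0" for n
    using that deg[of n] pos by auto
  then have nd: "\<not> (\<Omega> dvd X0 \<and> \<Omega> dvd Y0 \<and> \<Omega> dvd Z0)"
    using e small by blast
  have "lead (-1) q r f f0 \<Longrightarrow> f = 0 \<Longrightarrow> f0 = 0" for r f and f0 :: "'k poly3"
    by (simp add: lead_def)
  then have "pois 0 X0 Y0 Z0"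
    using p lead_pois[OF one q l] unfolding pois_def dvd_0_left_iff by blast
  then have "pois \<Omega> X0 Y0 Z0"
    by (auto simp: pois_def)
  moreover have "\<Omega> dvd sub X0 Y0 Z0 \<Omega>"
  proof -
    have "sub X0 Y0 Z0 \<Omega> = (if q dvd p0 * d then C (p0 * d div q) (const3 J * \<Omega>) else 0)"
      using lead_sub[OF hom_\<Omega> one q l] J by (simp add: lead_def)
    then show ?thesis
      by (simp add: hom_dvd_cmp[OF hom_\<Omega>] dvd_mult)
  qed
  ultimately have inj: "\<Omega> dvd sub X0 Y0 Z0 f \<Longrightarrow> \<Omega> dvd f" for f
    using sub_injective nd by blast
  have ndvarX: "\<not> \<Omega> dvd varX - const3 u" for u
  proof
    have cm: "C n (varX - const3 u) = (if n = int a then varX else 0) - (if n = 0 then const3 u else 0)" for n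
      by (simp add: cmp_hom[OF hom_gen(4)] cmp_hom[OF hom_gen(1)])
    assume "\<Omega> dvd varX - const3 u"
    moreover have "n < d" if "C n (varX - const3 u) \<noteq> 0" for n
      using that d_pos pos unfolding cm by (auto split: if_splits)
    moreover have "\<Omega> - const3 0 = \<Omega>"
      by (simp add: const3_simps)
    ultimately have "varX - const3 u = 0"
      using dvd_shift_small[of 0 "varX - const3 u"] by metis
    then have "C (int a) (varX - const3 u) = 0"
      by simp
    then show False
      using pos unfolding cm by (simp add: varX_def)
  qed
  \<comment> \<open>For p0 = 0 the form X0 would be a constant u, and \<open>varX - const3 u\<close>
    would be killed, against injectivity on the cone.\<close>
  have pp: "p0 > 0"
  proof (rule ccontr)
    assume "\<not> p0 > 0"
    then have "p0 = 0" using p0 by simp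
    then have "X0 = C 0 X"
      using l(1) by (simp add: lead_def)
    then obtain u where "X0 = const3 u"
      using hom_zero_const hom_cmp by metis
    then have "\<Omega> dvd sub X0 Y0 Z0 (varX - const3 u)"
      by simp
    then show False
      using inj ndvarX by blast
  qed
  note sr = sub_red[OF one q pp l inj]
  define P where "P m \<longleftrightarrow> m > 0 \<and> (\<exists>u. red (-1) (int m) u)" for m
  have "C (int a) varX = (varX :: 'k poly3)"
    using hom_gen(1) by (simp only: hom_def)
  then have "red (-1) (int a) varX"
    using ndvarX[of 0] lead_hom[OF hom_gen(1), of 1 "-1"] by (simp add: red_def const3_simps)
  then have "P a"
    using pos by (auto simp: P_def)
  then have LP: "P (LEAST m. P m)" and min: "\<And>m. P m \<Longrightarrow> (LEAST m. P m) \<le> m"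
    by (auto intro: LeastI Least_le)
  define m0 where "m0 = (LEAST m. P m)"
  obtain v where v: "red (-1) (int m0) v" and m0: "m0 > 0"
    using LP by (auto simp: P_def m0_def)
  define N where "N = p0 * int m0 div q"
  have N: "p0 * int m0 = q * N" "red (-1) N (sub X Y Z v)"
    using sr(1)[OF _ v] sr(2)[OF _ v] by (auto simp: N_def)
  have "q * N > 0"
    using N(1) pp m0 by (metis mult_pos_pos of_nat_0_less_iff)
  then have "N > 0"
    using q by (simp add: zero_less_mult_iff)
  then have "P (nat N)"
    using N by (auto simp: P_def)
  then have "int m0 \<le> N"
    using min[of "nat N"] \<open>N > 0\<close> by (simp add: m0_def)
  then have "q * int m0 \<le> p0 * int m0"
    using q N(1) by simp
  then have pq: "q \<le> p0"
    using m0 by simp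
  have bound: "int r \<le> n" if "lead (-1) q (p0 * int r) F F0" "C n F \<noteq> 0" for r F F0 n
  proof -
    have "q * int r \<le> p0 * int r"
      using pq by (simp add: mult_right_mono)
    also have "\<dots> \<le> q * n"
      using lead_int_bound(2) that by blast
    finally show ?thesis
      using q by simp
  qed
  show ?thesis
    using bound[OF l(1)] bound[OF l(2)] bound[OF l(3)] deg by (intro conjI hom_of_bounds order.antisym) blast+
qed

lemma \<Omega>_adic:
  assumes "f \<noteq> 0"
  obtains i g where "f = \<Omega> ^ i * g" "\<not> \<Omega> dvd g"
proof -
  have "\<exists>i g. f = \<Omega> ^ i * g \<and> \<not> \<Omega> dvd g" if "f \<noteq> 0" "degree f \<le> n" for n f
    using that
  proof (induction n arbitrary: f)
    case 0
    then have "\<not> \<Omega> dvd f"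
      using dvd_imp_degree_le[of \<Omega> f] degree_\<Omega> by auto
    then show ?case
      by (intro exI[of _ 0] exI[of _ f]) simp
  next
    case (Suc n)
    show ?case
    proof (cases "\<Omega> dvd f")
      case True
      then obtain h where h: "f = \<Omega> * h" ..
      then have "h \<noteq> 0" "degree h \<le> n"
        using Suc.prems degree_\<Omega> \<Omega>_nz by (auto simp: degree_mult_eq)
      then obtain i g where "h = \<Omega> ^ i * g" "\<not> \<Omega> dvd g"
        using Suc.IH by blast
      then show ?thesis
        using h by (intro exI[of _ "Suc i"] exI[of _ g]) (simp add: mult.assoc)
    next
      case False
      then show ?thesis
        by (intro exI[of _ 0] exI[of _ f]) simp
    qed
  qed
  then show ?thesis
    using assms that by blast
qed

text \<open>Factors of a nonzero homogeneous element are homogeneous, but \<Omega> - 1 has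
  components in the two degrees d and 0.\<close>

lemma hom_not_dvd_shift:
  assumes "hom n f" "\<Omega> - const3 1 dvd f"
  shows "f = 0"
proof (rule ccontr)
  assume "f \<noteq> 0"
  obtain h where h: "f = (\<Omega> - const3 1) * h"
    using assms(2) ..
  then obtain m where m: "hom m (\<Omega> - const3 1)"
    using hom_factor[of n "\<Omega> - const3 1" h] assms \<open>f \<noteq> 0\<close> by auto
  have "C d (\<Omega> - const3 1) \<noteq> 0" "C 0 (\<Omega> - const3 1) \<noteq> 0"
    unfolding cmp_\<Omega>_shift using d_pos \<Omega>_nz by auto
  then have "d = m" "0 = m"
    unfolding cmp_hom[OF m] by (auto split: if_splits)
  then show False
    using d_pos by simp
qed

lemma hom_weight_le:
  assumes "hom n f" "f \<noteq> 0" "n > 0" "\<mu> \<le> int a" "\<mu> \<le> int b" "\<mu> \<le> int c"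
  shows "\<mu> \<le> n"
proof -
  obtain i j k where "coeff3 f i j k \<noteq> 0"
    using assms(2) by (auto simp: poly3_eq_iff)
  then have n: "n = int a * int i + int b * int j + int c * int k"
    using assms(1) by (auto simp: hom_iff)
  then consider "i \<ge> 1" | "j \<ge> 1" | "k \<ge> 1"
    using assms(3) by (cases "i = 0"; cases "j = 0"; cases "k = 0") auto
  then show ?thesis
  proof cases
    case 1
    then have "int a * 1 \<le> int a * int i"
      by (intro mult_left_mono) auto
    then show ?thesis
      using n assms(4) by (simp add: add_increasing2)
  next
    case 2
    then have "int b * 1 \<le> int b * int j"
      by (intro mult_left_mono) auto
    moreover have "0 \<le> int a * int i" "0 \<le> int c * int k"
      by simp_all
    ultimately show ?thesis
      using n assms(5) by linarith
  next
    case 3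
    then have "int c * 1 \<le> int c * int k"
      by (intro mult_left_mono) auto
    moreover have "0 \<le> int a * int i" "0 \<le> int b * int j"
      by simp_all
    ultimately show ?thesis
      using n assms(6) by linarith
  qed
qed

lemma shift_dvd_power: "\<Omega> - const3 1 dvd \<Omega> ^ i - 1"
proof (induction i)
  case (Suc i)
  have "\<Omega> ^ Suc i - 1 = (\<Omega> - const3 1) * \<Omega> ^ i + (\<Omega> ^ i - 1)"
    by (simp add: const3_simps algebra_simps)
  then show ?case
    using Suc by (metis dvd_add dvd_triv_left)
qed simp

text \<open>
  If the leading forms \<open>X0, Y0, Z0\<close> had degree ratio \<open>p0 / q > 1\<close>, then \<open>\<Omega>(X0, Y0, Z0) = 0\<close>, and
  modulo \<open>\<Omega> - 1\<close> there would be no cancellation between the leading forms of the terms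
  \<open>\<Omega>\<^sup>i g(X, Y, Z)\<close>, so that no element of smallest positive degree could be in the image.
\<close>
lemma exact_aut_upper_bound:
  assumes ex: "exact_aut X Y Z X' Y' Z'"
  shows "(\<forall>n. C n X \<noteq> 0 \<longrightarrow> n \<le> int a) \<and> (\<forall>n. C n Y \<noteq> 0 \<longrightarrow> n \<le> int b) \<and> (\<forall>n. C n Z \<noteq> 0 \<longrightarrow> n \<le> int c)"
proof -
  have p: "pois 0 X Y Z"
    using ex by (simp add: exact_aut_def)
  obtain J where J: "J \<noteq> 0" "sub X Y Z \<Omega> = const3 J * \<Omega>"
    using sub_\<Omega>_exact_aut[OF ex] by blast
  have ne: "X \<noteq> 0 \<or> Y \<noteq> 0 \<or> Z \<noteq> 0"
    using exact_aut_nonzero[OF ex] by blast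
  have one: "(1::int) \<noteq> 0" by simp
  obtain p0 q X0 Y0 Z0 where q: "q > 0" and p0: "p0 \<ge> 0"
    and l: "lead 1 q (p0 * int a) X X0" "lead 1 q (p0 * int b) Y Y0" "lead 1 q (p0 * int c) Z Z0"
    and e: "q = int a \<and> lead 1 1 p0 X X0 \<and> X0 \<noteq> 0 \<or> q = int b \<and> lead 1 1 p0 Y Y0 \<and> Y0 \<noteq> 0 \<or>
     q = int c \<and> lead 1 1 p0 Z Z0 \<and> Z0 \<noteq> 0"
    by (rule extremal[OF ne one]) blast
  have pq: "p0 \<le> q"
  proof (rule ccontr)
    assume "\<not> p0 \<le> q"
    then have gt: "p0 > q" by simp
    have "lead 1 q r f f0 \<Longrightarrow> f = 0 \<Longrightarrow> f0 = 0" for r f and f0 :: "'k poly3"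
      by (simp add: lead_def)
    then have p': "pois 0 X0 Y0 Z0"
      using p lead_pois[OF one q l] unfolding pois_def dvd_0_left_iff by blast
    \<comment> \<open>The leading form of \<Omega>(X, Y, Z) is the component of J * \<Omega> in
      degree p0 * d / q, which exceeds d.\<close>
    have \<Omega>0: "sub X0 Y0 Z0 \<Omega> = 0"
    proof -
      have s: "sub X0 Y0 Z0 \<Omega> = (if q dvd p0 * d then C (p0 * d div q) (const3 J * \<Omega>) else 0)"
        using lead_sub[OF hom_\<Omega> one q l] J by (simp add: lead_def)
      have "p0 * d div q \<noteq> d" if "q dvd p0 * d"
      proof
        assume "p0 * d div q = d"
        then have "p0 * d = q * d"
          using that by (metis dvd_mult_div_cancel)
        then show False
          using gt d_pos by simp
      qed
      then show ?thesis
        unfolding s cmp_simps cmp_hom[OF hom_\<Omega>] by auto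
    qed
    have homs: "\<exists>n. hom n F0" if "lead 1 q r F F0" for r F F0
    proof (cases "q dvd r")
      case True
      then show ?thesis
        using that hom_cmp unfolding lead_def by metis
    next
      case False
      then show ?thesis
        using that hom_0 by (auto simp: lead_def)
    qed
    obtain nx ny nz where n: "hom nx X0" "hom ny Y0" "hom nz Z0"
      using homs[OF l(1)] homs[OF l(2)] homs[OF l(3)] by blast
    \<comment> \<open>The brackets are homogeneous, so divisibility by \<Omega> - 1 would make them
      0. The relations would then place (X0, Y0, Z0) at the singular point for all arguments,
      although one of the three forms is nonzero.\<close>
    have br: "\<not> (\<Omega> - const3 1 dvd jacobian3 X0 Y0 \<Omega> \<and> \<Omega> - const3 1 dvd jacobian3 Y0 Z0 \<Omega> \<and>
      \<Omega> - const3 1 dvd jacobian3 Z0 X0 \<Omega>)"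
    proof
      assume "\<Omega> - const3 1 dvd jacobian3 X0 Y0 \<Omega> \<and> \<Omega> - const3 1 dvd jacobian3 Y0 Z0 \<Omega> \<and>
        \<Omega> - const3 1 dvd jacobian3 Z0 X0 \<Omega>"
      then have "jacobian3 X0 Y0 \<Omega> = 0" "jacobian3 Y0 Z0 \<Omega> = 0" "jacobian3 Z0 X0 \<Omega> = 0"
        using hom_not_dvd_shift hom_jacobian3[OF _ _ hom_\<Omega>] n by blast+
      then have "singular \<Omega> (eval3 X0 x y z) (eval3 Y0 x y z) (eval3 Z0 x y z)" for x y z
        using p' unfolding pois_exact singular_def eval3_sub[symmetric] by (metis eval3_simps(7))
      then have "X0 = 0" "Y0 = 0" "Z0 = 0"
        unfolding singular_iff by - (rule eval3_zero_imp_zero; simp)+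
      then show False
        using e by blast
    qed
    have inj: "\<Omega> dvd f" if "\<Omega> - const3 1 dvd sub X0 Y0 Z0 f" for f
      by (rule sub_injective_shift[OF _ that br]) (simp add: \<Omega>0)
    \<comment> \<open>\<open>v\<close> is a variable of smallest weight \<mu>, and \<open>u\<close>
      is its preimage.\<close>
    obtain \<mu> v u where v: "hom \<mu> v" "v \<noteq> 0" and u: "sub X Y Z u = v"
      and \<mu>: "\<mu> \<le> int a" "\<mu> \<le> int b" "\<mu> \<le> int c" "\<mu> > 0"
    proof -
      have "varX \<noteq> (0 :: 'k poly3)" "varY \<noteq> (0 :: 'k poly3)" "varZ \<noteq> (0 :: 'k poly3)"
        by (simp_all add: varX_def varY_def varZ_def)
      moreover have "sub X Y Z X' = varX" "sub X Y Z Y' = varY" "sub X Y Z Z' = varZ"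
        using ex by (simp_all add: exact_aut_def)
      moreover consider "a \<le> b" "a \<le> c" | "b \<le> a" "b \<le> c" | "c \<le> a" "c \<le> b"
        by linarith
      ultimately show ?thesis
        using that[OF hom_gen(1)] that[OF hom_gen(2)] that[OF hom_gen(3)] pos by (metis nat_int_comparison(3) of_nat_0_less_iff order_refl)
    qed
    have "\<forall>n. C n u \<noteq> 0 \<longrightarrow> (\<exists>i g. C n u = \<Omega> ^ i * g \<and> \<not> \<Omega> dvd g)"
      using \<Omega>_adic by metis
    then obtain i g where ig: "\<And>n. C n u \<noteq> 0 \<Longrightarrow> C n u = \<Omega> ^ i n * g n"
      "\<And>n. C n u \<noteq> 0 \<Longrightarrow> \<not> \<Omega> dvd g n"
      by metis
    define e' where "e' n = n - d * int (i n)" for n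
    have hg: "hom (e' n) (g n)" if "C n u \<noteq> 0" for n
    proof -
      have "C n (\<Omega> ^ i n * g n) = \<Omega> ^ i n * C (n - d * int (i n)) (g n)"
        by (rule cmp_mult_hom[OF hom_power[OF hom_\<Omega>]])
      then have "\<Omega> ^ i n * g n = \<Omega> ^ i n * C (e' n) (g n)"
        using ig(1)[OF that] by (metis cmp_cmp e'_def)
      then show ?thesis
        using \<Omega>_nz by (simp add: hom_def)
    qed
    have e'_nonneg: "e' n \<ge> 0" if "C n u \<noteq> 0" for n
      using hom_neg[OF hg[OF that]] ig(2)[OF that] by force
    \<comment> \<open>A factor \<open>\<Omega> ^ i\<close> goes to
      \<open>J ^ i * \<Omega> ^ i\<close> and keeps its degree, while the degree e' of the cofactor
      g is multiplied by p0 / q. \<open>D\<close> is q times the resulting bound and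
      \<open>S\<close> the leading form.\<close>
    define D where "D n = q * (d * int (i n)) + p0 * e' n" for n
    define S where "S n = const3 (J ^ i n) * (\<Omega> ^ i n * sub X0 Y0 Z0 (g n))" for n
    have lead1: "lead 1 q (D n) (sub X Y Z (C n u)) (S n)" if "C n u \<noteq> 0" for n
    proof -
      have "lead 1 q (0 + (q * (d * int (i n)) + p0 * e' n))
          (const3 (J ^ i n) * (\<Omega> ^ i n * sub X Y Z (g n))) (S n)"
        unfolding S_def
        by (intro lead_mult lead_const lead_hom hom_power hom_\<Omega> lead_sub[OF _ one q l] hg that one q)
      then show ?thesis
        by (subst ig(1)[OF that]) (simp add: J D_def power_mult_distrib const3_power mult.assoc)
    qed
    have "u \<noteq> 0"
      using u v by auto
    then have "supp u \<noteq> {}"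
      using sum_cmp[of u] by auto
    define M where "M = Max (D ` supp u)"
    have M: "D n \<le> M" if "n \<in> supp u" for n
      using that by (simp add: M_def)
    have "M \<in> D ` supp u"
      unfolding M_def using \<open>supp u \<noteq> {}\<close> by (intro Max_in) simp_all
    then obtain n0 where n0: "n0 \<in> supp u" "D n0 = M"
      by blast
    define I where "I = {n \<in> supp u. D n = M}"
    have "lead 1 q M (sub X Y Z (C n u)) (if n \<in> I then S n else 0)" if n: "n \<in> supp u" for n
    proof (cases "n \<in> I")
      case True
      then show ?thesis
        using lead1[of n] by (auto simp: I_def supp_def)
    next
      case False
      then have "D n < M"
        using M[OF n] n by (auto simp: I_def)
      then show ?thesis
        using False lead_weaken[OF lead1, of n M] n by (simp add: supp_def)
    qed
    then have "lead 1 q M (\<Sum>n\<in>supp u. sub X Y Z (C n u)) (\<Sum>n\<in>supp u. if n \<in> I then S n else 0)"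
      by (rule lead_sum)
    moreover have "(\<Sum>n\<in>supp u. if n \<in> I then S n else 0) = sum S I"
      by (subst sum.inter_restrict[symmetric]) (auto simp: I_def intro!: sum.cong)
    ultimately have L: "lead 1 q M v (sum S I)"
      by (simp add: sub_sum[symmetric] sum_cmp u)
    \<comment> \<open>No cancellation: modulo \<Omega> - 1 the powers of \<Omega> become 1, and
      injectivity carries a vanishing sum back to \<open>\<Omega> dvd p1\<close>. Within
      \<open>I\<close> all D agree, so equal e' would give equal i and then equal n; hence g n0 is,
      up to a scalar, a component of \<open>p1\<close>, and \<Omega> would divide it.\<close>
    have "sum S I \<noteq> 0"
    proof
      assume S0: "sum S I = 0"
      define p1 where "p1 = (\<Sum>n\<in>I. const3 (J ^ i n) * g n)"
      have "sum S I - sub X0 Y0 Z0 p1 = (\<Sum>n\<in>I. const3 (J ^ i n) * ((\<Omega> ^ i n - 1) * sub X0 Y0 Z0 (g n)))"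
        by (simp add: p1_def S_def sub_sum algebra_simps sum_subtractf)
      also have "\<Omega> - const3 1 dvd \<dots>"
        by (intro dvd_sum dvd_mult dvd_mult2 shift_dvd_power)
      finally have "\<Omega> - const3 1 dvd sub X0 Y0 Z0 p1"
        by (simp add: S0)
      then have "\<Omega> dvd C (e' n0) p1"
        using inj hom_dvd_cmp[OF hom_\<Omega>] by blast
      moreover have "C (e' n0) p1 = (\<Sum>n\<in>I. if n = n0 then const3 (J ^ i n) * g n else 0)"
        unfolding p1_def cmp_sum
      proof (intro sum.cong refl)
        fix n assume n: "n \<in> I"
        then have nz: "C n u \<noteq> 0"
          by (simp add: I_def supp_def)
        have "n = n0" if "e' n = e' n0"
        proof -
          have "D n = D n0"
            using n n0 by (simp add: I_def)
          then have "q * (d * int (i n)) = q * (d * int (i n0))"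
            unfolding D_def that by (simp only: add_right_cancel)
          then have "i n = i n0"
            using q d_pos by simp
          then show ?thesis
            using that by (simp add: e'_def)
        qed
        then show "C (e' n0) (const3 (J ^ i n) * g n) = (if n = n0 then const3 (J ^ i n) * g n else 0)"
          using cmp_hom[OF hg[OF nz]] by auto
      qed
      also have "\<dots> = const3 (J ^ i n0) * g n0"
        using n0 finite_supp[of u] by (simp add: I_def)
      finally have "\<Omega> dvd const3 (J ^ i n0) * g n0"
        by simp
      then have "\<Omega> dvd const3 (J ^ i n0) \<or> \<Omega> dvd g n0"
        by (rule prime_\<Omega>)
      moreover have "\<not> \<Omega> dvd const3 (J ^ i n0)"
        using J const3_dvd_unit[of "J ^ i n0"] irreducible_\<Omega> by (metis dvd_trans irreducible_not_unit power_eq_0_iff)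
      ultimately show False
        using ig(2) n0 by (simp add: supp_def)
    qed
    then have "q dvd M" "M div q = \<mu>"
      using L cmp_hom[OF v(1), of "M div q"] by (auto simp: lead_def split: if_splits)
    then have M\<mu>: "M = q * \<mu>"
      by auto
    \<comment> \<open>As u is not constant, it has a component of positive degree n. The bound
      \<open>D n \<le> q * \<mu>\<close> with \<mu> < d excludes a factor \<Omega> from it and
      leaves \<open>p0 * n \<le> q * \<mu> \<le> q * n\<close>.\<close>
    obtain n where n: "n \<in> supp u" "n > 0"
    proof (rule ccontr)
      assume "\<not> thesis"
      then have "\<And>n. C n u \<noteq> 0 \<Longrightarrow> n = 0"
        using cmp_neg[of _ u] that by (force simp: supp_def)
      then obtain x where "u = const3 x"
        using hom_of_bounds hom_zero_const by blast
      then have "hom 0 v"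
        using u hom_gen(4) by auto
      then show False
        using hom_unique[OF v(1)] v(2) \<mu> by force
    qed
    have nz: "C n u \<noteq> 0"
      using n by (simp add: supp_def)
    have le: "D n \<le> q * \<mu>"
      using M[OF n(1)] M\<mu> by simp
    have "i n = 0"
    proof (rule ccontr)
      assume "i n \<noteq> 0"
      then have "d * 1 \<le> d * int (i n)"
        using d_pos by (intro mult_left_mono) auto
      then have "q * d \<le> q * (d * int (i n))"
        using q by simp
      moreover have "0 \<le> p0 * e' n"
        using p0 e'_nonneg[OF nz] by simp
      ultimately have "q * d \<le> q * \<mu>"
        using le by (simp add: D_def)
      then have "d \<le> \<mu>"
        using q by simp
      then show False
        using \<mu> pos by simp
    qed
    then have "p0 * n \<le> q * \<mu>"
      using le by (simp add: D_def e'_def)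
    moreover have "\<mu> \<le> n"
      using hom_weight_le[OF hom_cmp nz n(2) \<mu>(1-3)] .
    then have "q * \<mu> \<le> q * n"
      using q by simp
    ultimately have "p0 * n \<le> q * n"
      by linarith
    then have "p0 \<le> q"
      by (rule mult_right_le_imp_le) (rule n(2))
    then show False
      using gt by simp
  qed
  have bound: "n \<le> int r" if "lead 1 q (p0 * int r) F F0" "C n F \<noteq> 0" for r F F0 n
  proof -
    have "q * n \<le> p0 * int r"
      using lead_int_bound(1) that by blast
    also have "\<dots> \<le> q * int r"
      using pq by (simp add: mult_right_mono)
    finally show ?thesis
      using q by simp
  qed
  show ?thesis
    using bound[OF l(1)] bound[OF l(2)] bound[OF l(3)] by blast
qed

theorem exact_aut_hom:
  assumes "exact_aut X Y Z X' Y' Z'"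
  shows "hom (int a) X" "hom (int b) Y" "hom (int c) Z"
  using exact_aut_lower_bound[OF assms] exact_aut_upper_bound[OF assms] by blast+

lemma degree_sub_le:
  assumes "\<And>n. C n X \<noteq> 0 \<Longrightarrow> n \<le> int a" "\<And>n. C n Y \<noteq> 0 \<Longrightarrow> n \<le> int b" "\<And>n. C n Z \<noteq> 0 \<Longrightarrow> n \<le> int c"
    and "\<And>n. C n f \<noteq> 0 \<Longrightarrow> n \<le> m" and nz: "C n (sub X Y Z f) \<noteq> 0"
  shows "n \<le> m"
proof -
  have l: "lead 1 1 (1 * int a) X (C (int a) X)" "lead 1 1 (1 * int b) Y (C (int b) Y)" "lead 1 1 (1 * int c) Z (C (int c) Z)"
    using assms by (simp_all add: lead_def)
  have "sub X Y Z f = (\<Sum>i\<in>supp f. sub X Y Z (C i f))"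
    by (simp add: sub_sum[symmetric] sum_cmp)
  then have "(\<Sum>i\<in>supp f. C n (sub X Y Z (C i f))) \<noteq> 0"
    using nz by (simp add: cmp_sum)
  then obtain i where i: "i \<in> supp f" "C n (sub X Y Z (C i f)) \<noteq> 0"
    by (meson sum.neutral)
  have "lead 1 1 (1 * i) (sub X Y Z (C i f)) (sub (C (int a) X) (C (int b) Y) (C (int c) Z) (C i f))"
    by (intro lead_sub hom_cmp l) simp_all
  then have "n \<le> i"
    using lead_int_bound(1) i by fastforce
  then show ?thesis
    using assms(4)[of i] i by (simp add: supp_def)
qed

text \<open>The relations have degrees at most a + b, b + c and c + a, all of them below d.\<close>

lemma exact_pois_of_bounds:
  assumes deg: "\<And>n. C n X \<noteq> 0 \<Longrightarrow> n \<le> int a" "\<And>n. C n Y \<noteq> 0 \<Longrightarrow> n \<le> int b" "\<And>n. C n Z \<noteq> 0 \<Longrightarrow> n \<le> int c"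
    and p: "pois (\<Omega> - const3 \<xi>) X Y Z"
  shows "pois 0 X Y Z"
proof -
  have l: "lead 1 1 (1 * int a) X (C (int a) X)" "lead 1 1 (1 * int b) Y (C (int b) Y)" "lead 1 1 (1 * int c) Z (C (int c) Z)"
    using deg by (simp_all add: lead_def)
  have small: "g = 0" if "lead 1 1 r g g0" "\<Omega> - const3 \<xi> dvd g" "r < d" for r g g0
    using dvd_shift_small[OF that(2)] lead_int_bound(1)[OF that(1)] that(3) by fastforce
  have i: "(1::int) \<noteq> 0" "(0::int) < 1"
    by simp_all
  note lp = lead_pois[OF i l]
  show ?thesis
    using p small[OF lp(1)] small[OF lp(2)] small[OF lp(3)] pos unfolding pois_def by simp
qed

end


section \<open>Automorphisms of the quotients\<close>

lemma A_Omega_simps [simp]: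
  "carrier (A_Omega \<Omega>) = UNIV" "monoid.mult (A_Omega \<Omega>) = (*)" "one (A_Omega \<Omega>) = 1"
  "zero (A_Omega \<Omega>) = 0" "add (A_Omega \<Omega>) = (+)"
  "module.smult (A_Omega \<Omega>) = (\<lambda>t f. const3 t * f)"
  "pbracket (A_Omega \<Omega>) = (\<lambda>f g. jacobian3 f g \<Omega>)"
  by (simp_all add: A_Omega_def)

lemma cring_A_Omega: "cring (A_Omega \<Omega>)"
proof (rule cringI)
  show "abelian_group (A_Omega \<Omega>)"
    by (rule abelian_groupI) (auto simp: add_ac intro: exI[of _ "- _"] left_minus)
  show "Group.comm_monoid (A_Omega \<Omega>)"
    by (rule comm_monoidI) (auto simp: mult_ac)
qed (simp add: ring_distribs)

lemma P_ideal_ideal: "ideal (P_ideal \<Omega> \<xi>) (A_Omega \<Omega>)"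
  unfolding P_ideal_def by (rule cring.cgenideal_ideal[OF cring_A_Omega]) simp

lemma P_Omega_ops:
  "monoid.mult (P_Omega \<Omega> \<xi>) (P_class \<Omega> \<xi> f) (P_class \<Omega> \<xi> g) = P_class \<Omega> \<xi> (f * g)"
  "add (P_Omega \<Omega> \<xi>) (P_class \<Omega> \<xi> f) (P_class \<Omega> \<xi> g) = P_class \<Omega> \<xi> (f + g)"
  "one (P_Omega \<Omega> \<xi>) = P_class \<Omega> \<xi> 1"
  "zero (P_Omega \<Omega> \<xi>) = P_class \<Omega> \<xi> 0"
proof -
  note h = ideal.rcos_ring_hom[OF P_ideal_ideal[of \<Omega> \<xi>]]
  show "monoid.mult (P_Omega \<Omega> \<xi>) (P_class \<Omega> \<xi> f) (P_class \<Omega> \<xi> g) = P_class \<Omega> \<xi> (f * g)"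
    using ring_hom_mult[OF h, of f g] by (simp add: P_Omega_def poisson_quotient_def P_class_def)
  show "add (P_Omega \<Omega> \<xi>) (P_class \<Omega> \<xi> f) (P_class \<Omega> \<xi> g) = P_class \<Omega> \<xi> (f + g)"
    using ring_hom_add[OF h, of f g] by (simp add: P_Omega_def poisson_quotient_def P_class_def)
  show "one (P_Omega \<Omega> \<xi>) = P_class \<Omega> \<xi> 1"
    using ring_hom_one[OF h] by (simp add: P_Omega_def poisson_quotient_def P_class_def)
  have "P_class \<Omega> \<xi> 0 = P_ideal \<Omega> \<xi>"
    using cring.axioms(1)[OF cring_A_Omega[of \<Omega>]] P_ideal_ideal[of \<Omega> \<xi>]
    by (auto simp: P_class_def a_r_coset_def r_coset_def)
  then show "zero (P_Omega \<Omega> \<xi>) = P_class \<Omega> \<xi> 0"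
    by (simp add: P_Omega_def poisson_quotient_def FactRing_def)
qed

lemma P_class_in_carrier [simp]: "P_class \<Omega> \<xi> f \<in> carrier (P_Omega \<Omega> \<xi>)"
  by (simp add: carrier_P_Omega)

lemma pbracket_class: "pbracket (P_Omega \<Omega> \<xi>) (P_class \<Omega> \<xi> f) (P_class \<Omega> \<xi> g) = P_class \<Omega> \<xi> (jacobian3 f g \<Omega>)"
  by (simp add: pbracket_P_Omega)

text \<open>The record carries no axioms. The closure hypotheses allow
  \<open>\<tau> (\<sigma> x) = x\<close> to be applied to results of the operations on values of
  \<tau>.\<close>

lemma poisson_auts_inverse:
  assumes \<sigma>: "\<sigma> \<in> poisson_auts R"
    and cl: "\<And>x y. x \<in> carrier R \<Longrightarrow> y \<in> carrier R \<Longrightarrow> x \<otimes>\<^bsub>R\<^esub> y \<in> carrier R"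
    "\<And>x y. x \<in> carrier R \<Longrightarrow> y \<in> carrier R \<Longrightarrow> x \<oplus>\<^bsub>R\<^esub> y \<in> carrier R" "\<one>\<^bsub>R\<^esub> \<in> carrier R"
    "\<And>t x. x \<in> carrier R \<Longrightarrow> module.smult R t x \<in> carrier R"
    "\<And>x y. x \<in> carrier R \<Longrightarrow> y \<in> carrier R \<Longrightarrow> pbracket R x y \<in> carrier R"
  obtains \<tau> where "\<tau> \<in> poisson_auts R" "\<And>x. x \<in> carrier R \<Longrightarrow> \<sigma> (\<tau> x) = x" "\<And>x. x \<in> carrier R \<Longrightarrow> \<tau> (\<sigma> x) = x"
proof -
  have B: "\<sigma> \<in> Bij (carrier R)" and h: "\<sigma> \<in> Ring.ring_hom R R"
    and s: "\<And>t f. f \<in> carrier R \<Longrightarrow> \<sigma> (module.smult R t f) = module.smult R t (\<sigma> f)"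
    and p: "\<And>f g. f \<in> carrier R \<Longrightarrow> g \<in> carrier R \<Longrightarrow> \<sigma> (pbracket R f g) = pbracket R (\<sigma> f) (\<sigma> g)"
    using \<sigma> by (auto simp: poisson_auts_def)
  then have bij: "bij_betw \<sigma> (carrier R) (carrier R)"
    by (simp add: Bij_def)
  define \<tau> where "\<tau> = (\<lambda>x\<in>carrier R. inv_into (carrier R) \<sigma> x)"
  have B': "\<tau> \<in> Bij (carrier R)"
    unfolding \<tau>_def by (rule restrict_inv_into_Bij[OF B])
  have 1: "\<sigma> (\<tau> x) = x" if "x \<in> carrier R" for x
    using bij that by (simp add: \<tau>_def bij_betw_inv_into_right)
  have 2: "\<tau> (\<sigma> x) = x" if "x \<in> carrier R" for x
    using bij that by (simp add: \<tau>_def bij_betw_inv_into_left bij_betwE)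
  have t: "\<tau> x \<in> carrier R" if "x \<in> carrier R" for x
    using B' that by (auto simp: Bij_def bij_betw_def)
  have "\<tau> \<in> poisson_auts R"
    unfolding poisson_auts_def
  proof (intro CollectI conjI B' allI ballI ring_hom_memI)
    show "\<tau> x \<in> carrier R" if "x \<in> carrier R" for x
      using t that by blast
    show "\<tau> (x \<otimes>\<^bsub>R\<^esub> y) = \<tau> x \<otimes>\<^bsub>R\<^esub> \<tau> y" if "x \<in> carrier R" "y \<in> carrier R" for x y
      using 1[OF that(1)] 1[OF that(2)] 2[OF cl(1)[OF t[OF that(1)] t[OF that(2)]]] ring_hom_mult[OF h t[OF that(1)] t[OF that(2)]]
      by simp
    show "\<tau> (x \<oplus>\<^bsub>R\<^esub> y) = \<tau> x \<oplus>\<^bsub>R\<^esub> \<tau> y" if "x \<in> carrier R" "y \<in> carrier R" for x y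
      using 1[OF that(1)] 1[OF that(2)] 2[OF cl(2)[OF t[OF that(1)] t[OF that(2)]]] ring_hom_add[OF h t[OF that(1)] t[OF that(2)]]
      by simp
    show "\<tau> \<one>\<^bsub>R\<^esub> = \<one>\<^bsub>R\<^esub>"
      using 2[OF cl(3)] ring_hom_one[OF h] by simp
    show "\<tau> (module.smult R u f) = module.smult R u (\<tau> f)" if "f \<in> carrier R" for u f
      using 1[OF that] 2[OF cl(4)[OF t[OF that]], of u] s[OF t[OF that], of u] by simp
    show "\<tau> (pbracket R x y) = pbracket R (\<tau> x) (\<tau> y)" if "x \<in> carrier R" "y \<in> carrier R" for x y
      using 1[OF that(1)] 1[OF that(2)] 2[OF cl(5)[OF t[OF that(1)] t[OF that(2)]]] p[OF t[OF that(1)] t[OF that(2)]]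
      by simp
  qed
  then show ?thesis
    using that 1 2 by blast
qed

type_synonym 'k triple = "'k poly3 \<times> 'k poly3 \<times> 'k poly3"

definition subT :: "'k::comm_ring_1 triple \<Rightarrow> 'k poly3 \<Rightarrow> 'k poly3" where
  "subT T f = (case T of (X, Y, Z) \<Rightarrow> sub X Y Z f)"

text \<open>The order is that of algebra maps, \<open>subT T\<close> after \<open>subT S\<close>;
  for the corresponding maps of points it is reversed.\<close>

definition compT :: "'k::comm_ring_1 triple \<Rightarrow> 'k triple \<Rightarrow> 'k triple" where
  "compT T S = (case S of (X, Y, Z) \<Rightarrow> (subT T X, subT T Y, subT T Z))"

lemma subT_compT: "subT (compT T S) f = subT T (subT S f)"
  by (cases S; cases T) (simp add: subT_def compT_def sub_sub)

text \<open>The restriction to the carrier is there because members of \<open>Bij\<close> are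
  extensional. Independence of the representative is \<open>ind_class\<close>, for triples that
  preserve the ideal of \<Omega> - \<xi>.\<close>

definition ind :: "'k::idom poly3 \<Rightarrow> 'k \<Rightarrow> 'k triple \<Rightarrow> 'k poly3 set \<Rightarrow> 'k poly3 set" where
  "ind \<Omega> \<xi> T = (\<lambda>U\<in>carrier (P_Omega \<Omega> \<xi>). P_class \<Omega> \<xi> (subT T (SOME f. P_class \<Omega> \<xi> f = U)))"

lemma ind_class:
  assumes "\<Omega> - const3 \<xi> dvd subT T (\<Omega> - const3 \<xi>)"
  shows "ind \<Omega> \<xi> T (P_class \<Omega> \<xi> f) = P_class \<Omega> \<xi> (subT T f)"
proof -
  let ?g = "SOME g. P_class \<Omega> \<xi> g = P_class \<Omega> \<xi> f"
  have "P_class \<Omega> \<xi> ?g = P_class \<Omega> \<xi> f"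
    by (rule someI[where x = f]) simp
  then have "\<Omega> - const3 \<xi> dvd ?g - f"
    by (simp add: P_class_eq_iff)
  then have "subT T (\<Omega> - const3 \<xi>) dvd subT T (?g - f)"
    by (cases T) (simp only: subT_def prod.case sub_dvd)
  then have "\<Omega> - const3 \<xi> dvd subT T (?g - f)"
    using assms dvd_trans by blast
  then have "\<Omega> - const3 \<xi> dvd subT T ?g - subT T f"
    by (cases T) (simp add: subT_def)
  then show ?thesis
    by (simp add: ind_def P_class_eq_iff)
qed

context potential
begin

lemma poisson_auts_A_exact:
  assumes "\<sigma> \<in> poisson_auts (A_Omega \<Omega>)"
  obtains X Y Z X' Y' Z' where "exact_aut X Y Z X' Y' Z'" "\<sigma> = sub X Y Z"
proof -
  have *: "\<sigma> = sub (\<sigma> varX) (\<sigma> varY) (\<sigma> varZ) \<and> pois 0 (\<sigma> varX) (\<sigma> varY) (\<sigma> varZ)"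
    if \<sigma>: "\<sigma> \<in> poisson_auts (A_Omega \<Omega>)" for \<sigma>
  proof -
    have h: "\<sigma> \<in> Ring.ring_hom (A_Omega \<Omega>) (A_Omega \<Omega>)"
      and s: "\<sigma> (const3 t * f) = const3 t * \<sigma> f"
      and p: "\<sigma> (jacobian3 f g \<Omega>) = jacobian3 (\<sigma> f) (\<sigma> g) \<Omega>" for t f g
      using \<sigma> by (auto simp: poisson_auts_def)
    have h': "\<sigma> (f * g) = \<sigma> f * \<sigma> g" "\<sigma> (f + g) = \<sigma> f + \<sigma> g" "\<sigma> 1 = 1" for f g
      using ring_hom_mult[OF h] ring_hom_add[OF h] ring_hom_one[OF h] by auto
    have "\<sigma> f = sub (\<sigma> varX) (\<sigma> varY) (\<sigma> varZ) f" for f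
    proof (induction f rule: poly3_induct)
      case (const e)
      show ?case
        using s[of e 1] by (simp add: h')
    qed (simp_all add: h')
    then have eq: "\<sigma> = sub (\<sigma> varX) (\<sigma> varY) (\<sigma> varZ)"
      by (rule ext)
    have "\<sigma> (partial_z \<Omega>) = jacobian3 (\<sigma> varX) (\<sigma> varY) \<Omega>" "\<sigma> (partial_x \<Omega>) = jacobian3 (\<sigma> varY) (\<sigma> varZ) \<Omega>"
      "\<sigma> (partial_y \<Omega>) = jacobian3 (\<sigma> varZ) (\<sigma> varX) \<Omega>"
      using p[of varX varY] p[of varY varZ] p[of varZ varX] pbracket_generators[of \<Omega>] by simp_all
    then have "pois 0 (\<sigma> varX) (\<sigma> varY) (\<sigma> varZ)"
      unfolding pois_exact using fun_cong[OF eq] by metis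
    then show ?thesis
      using eq by blast
  qed
  obtain \<tau> where \<tau>: "\<tau> \<in> poisson_auts (A_Omega \<Omega>)" "\<And>x. \<sigma> (\<tau> x) = x" "\<And>x. \<tau> (\<sigma> x) = x"
    by (rule poisson_auts_inverse[OF assms]) simp_all
  have "exact_aut (\<sigma> varX) (\<sigma> varY) (\<sigma> varZ) (\<tau> varX) (\<tau> varY) (\<tau> varZ)"
    unfolding exact_aut_def using *[OF assms] *[OF \<tau>(1)] \<tau>(2,3) by metis
  then show ?thesis
    using that *[OF assms] by blast
qed

lemma pois_sub_jacobian3:
  assumes "pois 0 X Y Z"
  shows "sub X Y Z (jacobian3 f g \<Omega>) = jacobian3 (sub X Y Z f) (sub X Y Z g) \<Omega>"
proof -
  have e: "sub X Y Z (partial_z \<Omega>) = jacobian3 X Y \<Omega>" "sub X Y Z (partial_x \<Omega>) = jacobian3 Y Z \<Omega>"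
    "sub X Y Z (partial_y \<Omega>) = jacobian3 Z X \<Omega>"
    using assms by (simp_all add: pois_exact)
  show ?thesis
    unfolding jacobian3_def[of f g] sub_simps e
    unfolding jacobian3_def partial_sub by (simp add: algebra_simps)
qed

lemma exact_aut_poisson_auts_A:
  assumes ex: "exact_aut X Y Z X' Y' Z'"
  shows "sub X Y Z \<in> poisson_auts (A_Omega \<Omega>)"
proof -
  have "bij (sub X Y Z)"
    by (rule o_bij[of "sub X' Y' Z'"])
      (use exact_aut_inverse[OF ex] exact_aut_inverse[OF exact_aut_sym[OF ex]] in \<open>auto simp: fun_eq_iff\<close>)
  then have "sub X Y Z \<in> Bij UNIV"
    by (simp add: Bij_def)
  moreover have "sub X Y Z \<in> Ring.ring_hom (A_Omega \<Omega>) (A_Omega \<Omega>)"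
    by (rule ring_hom_memI) simp_all
  moreover have "pois 0 X Y Z"
    using ex by (simp add: exact_aut_def)
  ultimately show ?thesis
    by (simp add: poisson_auts_def pois_sub_jacobian3)
qed

text \<open>By \<open>\<Omega>_shift_dvd_iff\<close> the last condition is void for \<xi> = 0 and
  otherwise says that \<Omega> is fixed. So the same family of sets describes the automorphisms of
  A, of the cone and of the other quotients.\<close>

definition aut_triples :: "'k \<Rightarrow> 'k triple set" where
  "aut_triples \<xi> = {(X, Y, Z). (\<exists>X' Y' Z'. exact_aut X Y Z X' Y' Z') \<and>
     \<Omega> - const3 \<xi> dvd sub X Y Z (\<Omega> - const3 \<xi>)}"

lemma aut_triples_hom:
  assumes "(X, Y, Z) \<in> aut_triples \<xi>"
  shows "hom (int a) X" "hom (int b) Y" "hom (int c) Z"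
  using assms exact_aut_hom by (auto simp: aut_triples_def)

text \<open>Modulo \<Omega> - \<xi> the image of \<Omega> - \<xi> is the constant (J - 1) * \<xi>.
  Kept as a product, the condition covers \<xi> = 0 and \<xi> \<noteq> 0 uniformly;
  \<open>G_cubic\<close> and \<open>G_quartic\<close> inherit this form.\<close>

lemma \<Omega>_shift_dvd_iff:
  assumes "sub X Y Z \<Omega> = const3 J * \<Omega>"
  shows "\<Omega> - const3 \<xi> dvd sub X Y Z (\<Omega> - const3 \<xi>) \<longleftrightarrow> (J - 1) * \<xi> = 0"
proof -
  have "sub X Y Z (\<Omega> - const3 \<xi>) = const3 ((J - 1) * \<xi>) + const3 J * (\<Omega> - const3 \<xi>)"
    by (simp add: assms const3_simps algebra_simps)
  then have "\<Omega> - const3 \<xi> dvd sub X Y Z (\<Omega> - const3 \<xi>) \<longleftrightarrow> \<Omega> - const3 \<xi> dvd const3 ((J - 1) * \<xi>)"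
    by (simp add: dvd_add_left_iff)
  also have "\<dots> \<longleftrightarrow> (J - 1) * \<xi> = 0"
    using const3_dvd_unit[of "(J - 1) * \<xi>"] not_unit_\<Omega>_shift dvd_trans
    by (cases "(J - 1) * \<xi> = 0") (auto simp: const3_simps(1))
  finally show ?thesis .
qed

lemma aut_triples_inverse:
  assumes "exact_aut X Y Z X' Y' Z'" "(X, Y, Z) \<in> aut_triples \<xi>"
  shows "(X', Y', Z') \<in> aut_triples \<xi>"
proof -
  obtain J where J: "J \<noteq> 0" "sub X Y Z \<Omega> = const3 J * \<Omega>"
    using sub_\<Omega>_exact_aut[OF assms(1)] by blast
  obtain J' where J': "J' \<noteq> 0" "sub X' Y' Z' \<Omega> = const3 J' * \<Omega>"
    using sub_\<Omega>_exact_aut[OF exact_aut_sym[OF assms(1)]] by blast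
  have "\<Omega> = const3 (J' * J) * \<Omega>"
    using exact_aut_inverse[OF assms(1), of \<Omega>] by (simp add: J J' const3_simps mult.assoc)
  then have "const3 (J' * J) = const3 1"
    using \<Omega>_nz by (simp add: const3_simps)
  then have "J' * J = 1"
    by (simp only: const3_eq_iff)
  moreover have "(J - 1) * \<xi> = 0"
    using assms(2) \<Omega>_shift_dvd_iff[OF J(2)] by (simp add: aut_triples_def)
  ultimately have "(J' - 1) * \<xi> = 0"
    by auto
  then show ?thesis
    using \<Omega>_shift_dvd_iff[OF J'(2)] exact_aut_sym[OF assms(1)] by (auto simp: aut_triples_def)
qed

lemma aut_triples_compT:
  assumes "T \<in> aut_triples \<xi>" "S \<in> aut_triples \<xi>"
  shows "compT T S \<in> aut_triples \<xi>"
proof -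
  obtain X Y Z where T: "T = (X, Y, Z)" by (cases T)
  obtain U V W where S: "S = (U, V, W)" by (cases S)
  obtain X' Y' Z' where ex: "exact_aut X Y Z X' Y' Z'"
    using assms(1) by (auto simp: T aut_triples_def)
  obtain U' V' W' where ex': "exact_aut U V W U' V' W'"
    using assms(2) by (auto simp: S aut_triples_def)
  have pp: "pois 0 (sub X Y Z U) (sub X Y Z V) (sub X Y Z W)"
    if "pois 0 X Y Z" "pois 0 U V W" for X Y Z U V W
  proof -
    have "jacobian3 (sub X Y Z f) (sub X Y Z g) \<Omega> = sub (sub X Y Z U) (sub X Y Z V) (sub X Y Z W) h"
      if "jacobian3 f g \<Omega> = sub U V W h" for f g h
      using pois_sub_jacobian3[OF \<open>pois 0 X Y Z\<close>, of f g] that by (simp add: sub_sub)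
    then show ?thesis
      using that(2) unfolding pois_exact by blast
  qed
  have "exact_aut (sub X Y Z U) (sub X Y Z V) (sub X Y Z W) (sub U' V' W' X') (sub U' V' W' Y') (sub U' V' W' Z')"
    unfolding exact_aut_def
  proof (intro conjI)
    note i = exact_aut_inverse[OF ex] exact_aut_inverse[OF ex'] exact_aut_inverse[OF exact_aut_sym[OF ex]]
      exact_aut_inverse[OF exact_aut_sym[OF ex']]
    note g = ex[unfolded exact_aut_def] ex'[unfolded exact_aut_def]
    show "pois 0 (sub X Y Z U) (sub X Y Z V) (sub X Y Z W)"
      "pois 0 (sub U' V' W' X') (sub U' V' W' Y') (sub U' V' W' Z')"
      using g pp by blast+
    show "sub (sub X Y Z U) (sub X Y Z V) (sub X Y Z W) (sub U' V' W' X') = varX"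
      "sub (sub X Y Z U) (sub X Y Z V) (sub X Y Z W) (sub U' V' W' Y') = varY"
      "sub (sub X Y Z U) (sub X Y Z V) (sub X Y Z W) (sub U' V' W' Z') = varZ"
      "sub (sub U' V' W' X') (sub U' V' W' Y') (sub U' V' W' Z') (sub X Y Z U) = varX"
      "sub (sub U' V' W' X') (sub U' V' W' Y') (sub U' V' W' Z') (sub X Y Z V) = varY"
      "sub (sub U' V' W' X') (sub U' V' W' Y') (sub U' V' W' Z') (sub X Y Z W) = varZ"
      using g by (simp_all only: sub_sub[symmetric] i)
  qed
  moreover have "\<Omega> - const3 \<xi> dvd sub (sub X Y Z U) (sub X Y Z V) (sub X Y Z W) (\<Omega> - const3 \<xi>)"
  proof -
    have "\<Omega> - const3 \<xi> dvd sub X Y Z (\<Omega> - const3 \<xi>)"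
      using assms(1) by (simp add: T aut_triples_def)
    also have "\<dots> dvd sub X Y Z (sub U V W (\<Omega> - const3 \<xi>))"
      using assms(2) by (intro sub_dvd) (simp add: S aut_triples_def)
    finally show ?thesis
      by (simp only: sub_sub)
  qed
  ultimately show ?thesis
    by (auto simp: T S compT_def subT_def aut_triples_def)
qed

lemma ind_sub:
  "(X, Y, Z) \<in> aut_triples \<xi> \<Longrightarrow> ind \<Omega> \<xi> (X, Y, Z) (P_class \<Omega> \<xi> f) = P_class \<Omega> \<xi> (sub X Y Z f)"
  by (subst ind_class) (auto simp: aut_triples_def subT_def)

lemma ind_compT:
  assumes "T \<in> aut_triples \<xi>" "S \<in> aut_triples \<xi>"
  shows "ind \<Omega> \<xi> (compT T S) = compose (carrier (P_Omega \<Omega> \<xi>)) (ind \<Omega> \<xi> T) (ind \<Omega> \<xi> S)"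
proof
  fix U
  have d: "\<Omega> - const3 \<xi> dvd subT T (\<Omega> - const3 \<xi>)" if "T \<in> aut_triples \<xi>" for T
    using that by (auto simp: aut_triples_def subT_def)
  show "ind \<Omega> \<xi> (compT T S) U = compose (carrier (P_Omega \<Omega> \<xi>)) (ind \<Omega> \<xi> T) (ind \<Omega> \<xi> S) U"
  proof (cases "U \<in> carrier (P_Omega \<Omega> \<xi>)")
    case True
    then obtain f where "U = P_class \<Omega> \<xi> f"
      by (auto simp: carrier_P_Omega)
    then show ?thesis
      using True ind_class[OF d[OF assms(1)]] ind_class[OF d[OF assms(2)]]
        ind_class[OF d[OF aut_triples_compT[OF assms]]]
      by (simp add: compose_def subT_compT)
  next
    case False
    then show ?thesis
      by (simp add: compose_def ind_def)
  qed
qed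

lemma ind_poisson_auts:
  assumes "T \<in> aut_triples \<xi>"
  shows "ind \<Omega> \<xi> T \<in> poisson_auts (P_Omega \<Omega> \<xi>)"
proof -
  obtain X Y Z where T: "T = (X, Y, Z)" by (cases T)
  obtain X' Y' Z' where ex: "exact_aut X Y Z X' Y' Z'"
    using assms by (auto simp: T aut_triples_def)
  have t: "(X, Y, Z) \<in> aut_triples \<xi>" "(X', Y', Z') \<in> aut_triples \<xi>"
    using assms aut_triples_inverse[OF ex] by (auto simp: T)
  let ?P = "P_Omega \<Omega> \<xi>" and ?cl = "P_class \<Omega> \<xi>"
  have c: "carrier ?P = range ?cl"
    by (rule carrier_P_Omega)
  note i = ind_sub[OF t(1)] ind_sub[OF t(2)]
  have "bij_betw (ind \<Omega> \<xi> (X, Y, Z)) (carrier ?P) (carrier ?P)"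
    by (rule bij_betw_byWitness[where f' = "ind \<Omega> \<xi> (X', Y', Z')"])
      (auto simp: c i exact_aut_inverse[OF ex] exact_aut_inverse[OF exact_aut_sym[OF ex]])
  moreover have "ind \<Omega> \<xi> T \<in> extensional (carrier ?P)"
    by (simp add: ind_def)
  ultimately have "ind \<Omega> \<xi> T \<in> Bij (carrier ?P)"
    by (simp add: Bij_def T)
  moreover have "ind \<Omega> \<xi> T \<in> Ring.ring_hom ?P ?P"
    by (rule ring_hom_memI) (auto simp: c i T P_Omega_ops)
  moreover have "pois 0 X Y Z"
    using ex by (simp add: exact_aut_def)
  ultimately show ?thesis
    by (auto simp: poisson_auts_def c T i smult_P_Omega pbracket_class pois_sub_jacobian3)
qed

text \<open>The images of the variables are represented by 0 or by reduced elements, the form in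
  which \<open>degree_bound\<close> measures them.\<close>

lemma poisson_auts_reduced:
  assumes \<sigma>: "\<sigma> \<in> poisson_auts (P_Omega \<Omega> \<xi>)"
  obtains X Y Z where "\<And>f. \<sigma> (P_class \<Omega> \<xi> f) = P_class \<Omega> \<xi> (sub X Y Z f)"
    "pois (\<Omega> - const3 \<xi>) X Y Z" "\<Omega> - const3 \<xi> dvd sub X Y Z (\<Omega> - const3 \<xi>)"
    "\<And>n. C n X \<noteq> 0 \<Longrightarrow> n \<le> int a" "\<And>n. C n Y \<noteq> 0 \<Longrightarrow> n \<le> int b" "\<And>n. C n Z \<noteq> 0 \<Longrightarrow> n \<le> int c"
proof -
  let ?P = "P_Omega \<Omega> \<xi>" and ?cl = "P_class \<Omega> \<xi>"
  have c: "carrier ?P = range ?cl"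
    by (rule carrier_P_Omega)
  have h: "\<sigma> \<in> Ring.ring_hom ?P ?P" and bij: "bij_betw \<sigma> (carrier ?P) (carrier ?P)"
    and s: "\<And>t f. \<sigma> (?cl (const3 t * f)) = module.smult ?P t (\<sigma> (?cl f))"
    and p: "\<And>f g. \<sigma> (?cl (jacobian3 f g \<Omega>)) = pbracket ?P (\<sigma> (?cl f)) (\<sigma> (?cl g))"
    using \<sigma> by (auto simp: poisson_auts_def Bij_def smult_P_Omega[symmetric] pbracket_class[symmetric])
  have h': "\<sigma> (?cl (f * g)) = monoid.mult ?P (\<sigma> (?cl f)) (\<sigma> (?cl g))"
    "\<sigma> (?cl (f + g)) = add ?P (\<sigma> (?cl f)) (\<sigma> (?cl g))" "\<sigma> (?cl 1) = ?cl 1" for f g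
    using ring_hom_mult[OF h, of "?cl f" "?cl g"] ring_hom_add[OF h, of "?cl f" "?cl g"] ring_hom_one[OF h]
    by (auto simp: P_Omega_ops)
  have rep: "\<exists>X. \<sigma> (?cl f) = ?cl X \<and> (X = 0 \<or> (\<exists>n. red 1 n X))" for f
  proof -
    have "\<sigma> (?cl f) \<in> carrier ?P"
      using bij by (auto simp: bij_betw_def)
    then obtain g where g: "\<sigma> (?cl f) = ?cl g"
      by (auto simp: c)
    show ?thesis
    proof (cases "\<Omega> - const3 \<xi> dvd g")
      case True
      then have "?cl g = ?cl 0"
        by (simp add: P_class_eq_iff)
      then show ?thesis
        using g by auto
    next
      case False
      then obtain f' N where "\<Omega> - const3 \<xi> dvd g - f'" "red 1 N f'"
        using red_exists[of \<xi> g] by blast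
      then show ?thesis
        using g P_class_eq_iff[of \<Omega> \<xi> g f'] by auto
    qed
  qed
  obtain X where X: "\<sigma> (?cl varX) = ?cl X" "X = 0 \<or> (\<exists>n. red 1 n X)"
    using rep by blast
  obtain Y where Y: "\<sigma> (?cl varY) = ?cl Y" "Y = 0 \<or> (\<exists>n. red 1 n Y)"
    using rep by blast
  obtain Z where Z: "\<sigma> (?cl varZ) = ?cl Z" "Z = 0 \<or> (\<exists>n. red 1 n Z)"
    using rep by blast
  have \<sigma>sub: "\<sigma> (?cl f) = ?cl (sub X Y Z f)" for f
  proof (induction f rule: poly3_induct)
    case (const e)
    show ?case
      using s[of e 1] by (simp add: h' smult_P_Omega)
  qed (simp_all add: X Y Z h' P_Omega_ops)
  have pz: "pois (\<Omega> - const3 \<xi>) X Y Z"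
    unfolding pois_def P_class_eq_iff[symmetric] \<sigma>sub[symmetric]
    using p[of varX varY] p[of varY varZ] p[of varZ varX] pbracket_generators[of \<Omega>]
    by (simp add: X Y Z pbracket_class)
  have "?cl (\<Omega> - const3 \<xi>) = ?cl 0"
    by (simp add: P_class_eq_iff)
  then have "?cl (sub X Y Z (\<Omega> - const3 \<xi>)) = ?cl (sub X Y Z 0)"
    unfolding \<sigma>sub[symmetric] by simp
  then have w: "\<Omega> - const3 \<xi> dvd sub X Y Z (\<Omega> - const3 \<xi>)"
    unfolding P_class_eq_iff by simp
  have surj: "\<exists>u. \<Omega> - const3 \<xi> dvd sub X Y Z u - v" for v
  proof -
    have "?cl v \<in> \<sigma> ` carrier ?P"
      using bij by (simp add: bij_betw_def)
    then obtain u where "?cl v = \<sigma> (?cl u)"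
      by (auto simp: c)
    then show ?thesis
      using P_class_eq_iff[of \<Omega> \<xi> "sub X Y Z u" v] by (auto simp: \<sigma>sub)
  qed
  show ?thesis
    using that[OF \<sigma>sub pz w] degree_bound[OF pz w surj X(2) Y(2) Z(2)] by blast
qed

text \<open>Both \<sigma> and its inverse are lifted. The composites of the two triples have degrees
  at most a, b, c, all below d, so their congruence to the variables is an equality.\<close>

lemma poisson_auts_P_ind:
  assumes \<sigma>: "\<sigma> \<in> poisson_auts (P_Omega \<Omega> \<xi>)"
  obtains T where "T \<in> aut_triples \<xi>" "\<sigma> = ind \<Omega> \<xi> T"
proof -
  let ?P = "P_Omega \<Omega> \<xi>" and ?cl = "P_class \<Omega> \<xi>"
  have c: "carrier ?P = range ?cl"
    by (rule carrier_P_Omega)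
  obtain \<tau> where \<tau>: "\<tau> \<in> poisson_auts ?P" "\<And>x. x \<in> carrier ?P \<Longrightarrow> \<sigma> (\<tau> x) = x" "\<And>x. x \<in> carrier ?P \<Longrightarrow> \<tau> (\<sigma> x) = x"
    by (rule poisson_auts_inverse[OF \<sigma>]) (auto simp: c P_Omega_ops smult_P_Omega pbracket_class)
  obtain X Y Z where X: "\<And>f. \<sigma> (?cl f) = ?cl (sub X Y Z f)"
    "pois (\<Omega> - const3 \<xi>) X Y Z" "\<Omega> - const3 \<xi> dvd sub X Y Z (\<Omega> - const3 \<xi>)"
    "\<And>n. C n X \<noteq> 0 \<Longrightarrow> n \<le> int a" "\<And>n. C n Y \<noteq> 0 \<Longrightarrow> n \<le> int b" "\<And>n. C n Z \<noteq> 0 \<Longrightarrow> n \<le> int c"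
    by (rule poisson_auts_reduced[OF \<sigma>]) blast
  obtain X' Y' Z' where X': "\<And>f. \<tau> (?cl f) = ?cl (sub X' Y' Z' f)"
    "pois (\<Omega> - const3 \<xi>) X' Y' Z'" "\<Omega> - const3 \<xi> dvd sub X' Y' Z' (\<Omega> - const3 \<xi>)"
    "\<And>n. C n X' \<noteq> 0 \<Longrightarrow> n \<le> int a" "\<And>n. C n Y' \<noteq> 0 \<Longrightarrow> n \<le> int b" "\<And>n. C n Z' \<noteq> 0 \<Longrightarrow> n \<le> int c"
    by (rule poisson_auts_reduced[OF \<tau>(1)]) blast
  have st: "?cl (sub X Y Z (sub X' Y' Z' f)) = ?cl f" "?cl (sub X' Y' Z' (sub X Y Z f)) = ?cl f" for f
    using \<tau>(2)[of "?cl f"] \<tau>(3)[of "?cl f"] by (simp_all add: X(1) X'(1))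
  have eq: "f = g" if "?cl f = ?cl g" "\<And>n. C n f \<noteq> 0 \<Longrightarrow> n \<le> m" "\<And>n. C n g \<noteq> 0 \<Longrightarrow> n \<le> m" "m < d" for f g m
  proof -
    have dv: "\<Omega> - const3 \<xi> dvd f - g"
      using that(1) by (simp only: P_class_eq_iff)
    have "n < d" if nz: "C n (f - g) \<noteq> 0" for n
    proof -
      have "C n f \<noteq> 0 \<or> C n g \<noteq> 0"
        using nz by auto
      then show ?thesis
        using \<open>\<And>n. C n f \<noteq> 0 \<Longrightarrow> n \<le> m\<close>[of n] \<open>\<And>n. C n g \<noteq> 0 \<Longrightarrow> n \<le> m\<close>[of n] \<open>m < d\<close> by linarith
    qed
    then have "f - g = 0"
      by (rule dvd_shift_small[OF dv])
    then show ?thesis by simp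
  qed
  have v: "C n varX \<noteq> 0 \<Longrightarrow> n \<le> int a" "C n varY \<noteq> 0 \<Longrightarrow> n \<le> int b" "C n varZ \<noteq> 0 \<Longrightarrow> n \<le> int c" for n
    using cmp_hom[OF hom_gen(1)] cmp_hom[OF hom_gen(2)] cmp_hom[OF hom_gen(3)] by (metis order_refl)+
  have lt: "int a < d" "int b < d" "int c < d"
    using pos by auto
  have ds: "n \<le> m" if "\<And>n. C n f \<noteq> 0 \<Longrightarrow> n \<le> m" "C n (sub X Y Z f) \<noteq> 0" for f m n
    using degree_sub_le[of X Y Z f m n] X(4-6) that by blast
  have ds': "n \<le> m" if "\<And>n. C n f \<noteq> 0 \<Longrightarrow> n \<le> m" "C n (sub X' Y' Z' f) \<noteq> 0" for f m n
    using degree_sub_le[of X' Y' Z' f m n] X'(4-6) that by blast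
  have "exact_aut X Y Z X' Y' Z'"
    unfolding exact_aut_def
  proof (intro conjI)
    show "pois 0 X Y Z" "pois 0 X' Y' Z'"
      using exact_pois_of_bounds[of X Y Z \<xi>] X(2,4-6) exact_pois_of_bounds[of X' Y' Z' \<xi>] X'(2,4-6) by blast+
    show "sub X Y Z X' = varX"
    proof (rule eq)
      show "?cl (sub X Y Z X') = ?cl varX"
        using st(1)[of varX] by simp
      show "n \<le> int a" if "C n (sub X Y Z X') \<noteq> 0" for n
        using ds[of X' "int a"] X'(4) that by blast
      show "n \<le> int a" if "C n (varX :: 'k poly3) \<noteq> 0" for n
        using v(1) that by blast
    qed (rule lt(1))
    show "sub X Y Z Y' = varY"
    proof (rule eq)
      show "?cl (sub X Y Z Y') = ?cl varY"
        using st(1)[of varY] by simp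
      show "n \<le> int b" if "C n (sub X Y Z Y') \<noteq> 0" for n
        using ds[of Y' "int b"] X'(5) that by blast
      show "n \<le> int b" if "C n (varY :: 'k poly3) \<noteq> 0" for n
        using v(2) that by blast
    qed (rule lt(2))
    show "sub X Y Z Z' = varZ"
    proof (rule eq)
      show "?cl (sub X Y Z Z') = ?cl varZ"
        using st(1)[of varZ] by simp
      show "n \<le> int c" if "C n (sub X Y Z Z') \<noteq> 0" for n
        using ds[of Z' "int c"] X'(6) that by blast
      show "n \<le> int c" if "C n (varZ :: 'k poly3) \<noteq> 0" for n
        using v(3) that by blast
    qed (rule lt(3))
    show "sub X' Y' Z' X = varX"
    proof (rule eq)
      show "?cl (sub X' Y' Z' X) = ?cl varX"
        using st(2)[of varX] by simp
      show "n \<le> int a" if "C n (sub X' Y' Z' X) \<noteq> 0" for n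
        using ds'[of X "int a"] X(4) that by blast
      show "n \<le> int a" if "C n (varX :: 'k poly3) \<noteq> 0" for n
        using v(1) that by blast
    qed (rule lt(1))
    show "sub X' Y' Z' Y = varY"
    proof (rule eq)
      show "?cl (sub X' Y' Z' Y) = ?cl varY"
        using st(2)[of varY] by simp
      show "n \<le> int b" if "C n (sub X' Y' Z' Y) \<noteq> 0" for n
        using ds'[of Y "int b"] X(5) that by blast
      show "n \<le> int b" if "C n (varY :: 'k poly3) \<noteq> 0" for n
        using v(2) that by blast
    qed (rule lt(2))
    show "sub X' Y' Z' Z = varZ"
    proof (rule eq)
      show "?cl (sub X' Y' Z' Z) = ?cl varZ"
        using st(2)[of varZ] by simp
      show "n \<le> int c" if "C n (sub X' Y' Z' Z) \<noteq> 0" for n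
        using ds'[of Z "int c"] X(6) that by blast
      show "n \<le> int c" if "C n (varZ :: 'k poly3) \<noteq> 0" for n
        using v(3) that by blast
    qed (rule lt(3))
  qed
  then have t: "(X, Y, Z) \<in> aut_triples \<xi>"
    using X(3) by (auto simp: aut_triples_def)
  have "\<sigma> = ind \<Omega> \<xi> (X, Y, Z)"
  proof (rule extensionalityI)
    show "\<sigma> \<in> extensional (carrier ?P)"
      using \<sigma> by (simp add: poisson_auts_def Bij_def)
    show "ind \<Omega> \<xi> (X, Y, Z) \<in> extensional (carrier ?P)"
      by (simp add: ind_def)
    show "\<sigma> x = ind \<Omega> \<xi> (X, Y, Z) x" if "x \<in> carrier ?P" for x
      using that by (auto simp: c X(1) ind_sub[OF t])
  qed
  then show ?thesis
    using that t by blast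
qed

text \<open>The coordinates of a triple have degrees a, b, c below d, where congruent elements are
  equal: lifts are unique.\<close>

lemma inj_on_ind: "inj_on (ind \<Omega> \<xi>) (aut_triples \<xi>)"
proof (rule inj_onI)
  fix T S assume T: "T \<in> aut_triples \<xi>" and S: "S \<in> aut_triples \<xi>" and eq: "ind \<Omega> \<xi> T = ind \<Omega> \<xi> S"
  obtain X Y Z where T': "T = (X, Y, Z)" by (cases T)
  obtain U V W where S': "S = (U, V, W)" by (cases S)
  have "P_class \<Omega> \<xi> (sub X Y Z f) = P_class \<Omega> \<xi> (sub U V W f)" for f
    using fun_cong[OF eq, of "P_class \<Omega> \<xi> f"] T S by (simp add: T' S' ind_sub)
  then have dv: "\<Omega> - const3 \<xi> dvd sub X Y Z f - sub U V W f" for f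
    by (simp only: P_class_eq_iff)
  have small: "f = g" if "\<Omega> - const3 \<xi> dvd f - g" "hom n f" "hom n g" "n < d" for f g n
  proof -
    have "C m (f - g) \<noteq> 0 \<Longrightarrow> m < d" for m
      using that(4) cmp_hom[OF hom_diff[OF that(2,3)], of m] by (auto split: if_splits)
    then have "f - g = 0"
      using dvd_shift_small[OF that(1)] by blast
    then show ?thesis by simp
  qed
  have lt: "int a < d" "int b < d" "int c < d"
    using pos by auto
  note ht = aut_triples_hom[OF T[unfolded T']] and hs = aut_triples_hom[OF S[unfolded S']]
  have "X = U" "Y = V" "Z = W"
    using small[OF _ ht(1) hs(1) lt(1)] small[OF _ ht(2) hs(2) lt(2)] small[OF _ ht(3) hs(3) lt(3)]
      dv[of varX] dv[of varY] dv[of varZ] by simp_all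
  then show "T = S"
    by (simp add: T' S')
qed

theorem bij_betw_ind: "bij_betw (ind \<Omega> \<xi>) (aut_triples \<xi>) (poisson_auts (P_Omega \<Omega> \<xi>))"
  unfolding bij_betw_def
proof (intro conjI inj_on_ind equalityI subsetI)
  show "\<sigma> \<in> poisson_auts (P_Omega \<Omega> \<xi>)" if "\<sigma> \<in> ind \<Omega> \<xi> ` aut_triples \<xi>" for \<sigma>
    using that ind_poisson_auts by blast
  show "\<sigma> \<in> ind \<Omega> \<xi> ` aut_triples \<xi>" if \<sigma>: "\<sigma> \<in> poisson_auts (P_Omega \<Omega> \<xi>)" for \<sigma>
    by (rule poisson_auts_P_ind[OF \<sigma>]) blast
qed

lemma poisson_auts_P_degree:
  assumes "\<sigma> \<in> poisson_auts (P_Omega \<Omega> 0)"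
  shows "preserves (P_degree a b c \<Omega>) \<sigma>"
proof -
  obtain T where T: "T \<in> aut_triples 0" "\<sigma> = ind \<Omega> 0 T"
    using poisson_auts_P_ind[OF assms] by blast
  obtain X Y Z where T': "T = (X, Y, Z)" by (cases T)
  note h = aut_triples_hom[OF T(1)[unfolded T']]
  have "\<sigma> (P_class \<Omega> 0 f) \<in> P_degree a b c \<Omega> n" if "f \<in> homogeneous3 a b c n" for f n
    using T hom_sub[OF _ h, of "int n" f] that by (auto simp: T' ind_sub P_degree_def hom_homogeneous3)
  then show ?thesis
    unfolding preserves_def by (auto simp: P_degree_def)
qed

lemma poisson_auts_A_degree:
  assumes "\<sigma> \<in> poisson_auts (A_Omega \<Omega>)"
  shows "preserves (homogeneous3 a b c) \<sigma>"
proof -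
  obtain X Y Z X' Y' Z' where ex: "exact_aut X Y Z X' Y' Z'" "\<sigma> = sub X Y Z"
    using poisson_auts_A_exact[OF assms] by blast
  have "sub X Y Z f \<in> homogeneous3 a b c n" if "f \<in> homogeneous3 a b c n" for f n
    using hom_sub[OF _ exact_aut_hom[OF ex(1)], of "int n" f] that by (simp only: hom_homogeneous3)
  then show ?thesis
    unfolding preserves_def using ex(2) by auto
qed

lemma hom_in_P_filtration:
  assumes "hom m f" "m \<le> int n"
  shows "P_class \<Omega> \<xi> f \<in> P_filtration a b c \<Omega> \<xi> n"
  using assms(1)
proof (induction f rule: hom_induct)
  case zero
  show ?case
    using lin_span.zero[of "P_Omega \<Omega> \<xi>"] unfolding P_filtration_def P_Omega_ops .
next
  case (add f g)
  show ?case
    using lin_span.add[of _ "P_Omega \<Omega> \<xi>"] add unfolding P_filtration_def P_Omega_ops(2)[symmetric] by blast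
next
  case (mon e i j k)
  have "a * i + b * j + c * k \<le> n"
    using mon assms(2) by (simp only: of_nat_le_iff)
  then have "P_class \<Omega> \<xi> (varX ^ i * varY ^ j * varZ ^ k) \<in> P_filtration a b c \<Omega> \<xi> n"
    unfolding P_filtration_def by (intro lin_span.gen) blast
  then have "module.smult (P_Omega \<Omega> \<xi>) e (P_class \<Omega> \<xi> (varX ^ i * varY ^ j * varZ ^ k)) \<in> P_filtration a b c \<Omega> \<xi> n"
    unfolding P_filtration_def by (rule lin_span.smult)
  then show ?case
    by (simp add: smult_P_Omega mon3_eq mult.assoc)
qed

lemma poisson_auts_P_filtration:
  assumes "\<sigma> \<in> poisson_auts (P_Omega \<Omega> \<xi>)"
  shows "preserves (P_filtration a b c \<Omega> \<xi>) \<sigma>"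
proof -
  let ?P = "P_Omega \<Omega> \<xi>"
  obtain T where T: "T \<in> aut_triples \<xi>" "\<sigma> = ind \<Omega> \<xi> T"
    using poisson_auts_P_ind[OF assms] by blast
  obtain X Y Z where T': "T = (X, Y, Z)" by (cases T)
  note h = aut_triples_hom[OF T(1)[unfolded T']]
  have i: "\<sigma> (P_class \<Omega> \<xi> f) = P_class \<Omega> \<xi> (sub X Y Z f)" for f
    using T by (simp add: T' ind_sub)
  have "u \<in> carrier ?P \<and> \<sigma> u \<in> P_filtration a b c \<Omega> \<xi> n" if "u \<in> P_filtration a b c \<Omega> \<xi> n" for u n
    using that unfolding P_filtration_def[of a b c \<Omega> \<xi> n]
  proof (induction rule: lin_span.induct)
    case zero
    then show ?case
      unfolding P_Omega_ops i using lin_span.zero[of "P_Omega \<Omega> \<xi>"] by (simp add: P_Omega_ops)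
  next
    case (gen s)
    then obtain i' j k where s: "s = P_class \<Omega> \<xi> (varX ^ i' * varY ^ j * varZ ^ k)" "a * i' + b * j + c * k \<le> n"
      by blast
    have "hom (int (a * i' + b * j + c * k)) (sub X Y Z (mon3 1 i' j k))"
      by (intro hom_sub hom_mon3 h)
    then have "P_class \<Omega> \<xi> (sub X Y Z (mon3 1 i' j k)) \<in> P_filtration a b c \<Omega> \<xi> n"
      by (rule hom_in_P_filtration) (use s(2) in \<open>simp only: of_nat_le_iff\<close>)
    then show ?case
      by (simp add: s i mon3_eq const3_simps P_filtration_def)
  next
    case (add u v)
    then obtain f g where fg: "u = P_class \<Omega> \<xi> f" "v = P_class \<Omega> \<xi> g"
      by (auto simp: carrier_P_Omega)
    have "\<sigma> (u \<oplus>\<^bsub>?P\<^esub> v) = \<sigma> u \<oplus>\<^bsub>?P\<^esub> \<sigma> v"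
      by (simp add: fg P_Omega_ops i)
    then show ?case
      using add lin_span.add[of "\<sigma> u" ?P _ "\<sigma> v"] by (simp add: fg P_Omega_ops)
  next
    case (smult u t)
    then obtain f where f: "u = P_class \<Omega> \<xi> f"
      by (auto simp: carrier_P_Omega)
    have "\<sigma> (module.smult ?P t u) = module.smult ?P t (\<sigma> u)"
      by (simp add: f smult_P_Omega i)
    then show ?case
      using smult lin_span.smult[of "\<sigma> u" ?P _ t] by (simp add: f smult_P_Omega)
  qed
  then show ?thesis
    unfolding preserves_def by blast
qed

end


section \<open>Automorphism groups\<close>

lemma AutP_simps [simp]:
  "carrier (AutP R) = poisson_auts R"
  by (simp add: AutP_def)

lemma AutP_mult:
  assumes "\<sigma> \<in> poisson_auts R" "\<tau> \<in> poisson_auts R"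
  shows "\<sigma> \<otimes>\<^bsub>AutP R\<^esub> \<tau> = compose (carrier R) \<sigma> \<tau>"
  using assms by (simp add: AutP_def BijGroup_def poisson_auts_def)

lemma AutgrP_eq_AutP:
  "(\<And>\<sigma>. \<sigma> \<in> poisson_auts R \<Longrightarrow> preserves V \<sigma>) \<Longrightarrow> AutgrP R V = AutP R"
proof -
  assume "\<And>\<sigma>. \<sigma> \<in> poisson_auts R \<Longrightarrow> preserves V \<sigma>"
  then have "{\<sigma> \<in> poisson_auts R. preserves V \<sigma>} = poisson_auts R"
    by blast
  then show ?thesis
    by (simp add: AutgrP_def AutP_def)
qed

text \<open>Both claims are read off from one parametrization \<open>F\<close> with the twisted
  multiplication rule: its inverse \<open>G\<close> is the isomorphism,
  \<open>n \<mapsto> F (\<one>, n)\<close> the inclusion, and the first component of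
  \<open>G\<close> the projection.\<close>

lemma semidirect_iso_AutP:
  assumes bij: "bij_betw F (carrier H \<times> carrier N) (poisson_auts R)"
    and mult: "\<And>h n h' n'. h \<in> carrier H \<Longrightarrow> n \<in> carrier N \<Longrightarrow> h' \<in> carrier H \<Longrightarrow> n' \<in> carrier N \<Longrightarrow>
      F (h \<otimes>\<^bsub>H\<^esub> h', n \<otimes>\<^bsub>N\<^esub> \<phi> h n') = compose (carrier R) (F (h, n)) (F (h', n'))"
    and H: "\<And>h h'. h \<in> carrier H \<Longrightarrow> h' \<in> carrier H \<Longrightarrow> h \<otimes>\<^bsub>H\<^esub> h' \<in> carrier H"
      "\<one>\<^bsub>H\<^esub> \<in> carrier H" "\<one>\<^bsub>H\<^esub> \<otimes>\<^bsub>H\<^esub> \<one>\<^bsub>H\<^esub> = \<one>\<^bsub>H\<^esub>"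
    and N: "\<And>h n n'. h \<in> carrier H \<Longrightarrow> n \<in> carrier N \<Longrightarrow> n' \<in> carrier N \<Longrightarrow> n \<otimes>\<^bsub>N\<^esub> \<phi> h n' \<in> carrier N"
      "\<one>\<^bsub>N\<^esub> \<in> carrier N" "\<And>n. n \<in> carrier N \<Longrightarrow> \<phi> \<one>\<^bsub>H\<^esub> n = n"
  shows "AutP R \<cong> semidirect H N \<phi>" "short_exact N (AutP R) H"
proof -
  let ?C = "carrier H \<times> carrier N" and ?S = "semidirect H N \<phi>"
  define G where "G = inv_into ?C F"
  have FG: "F (G \<sigma>) = \<sigma>" "G \<sigma> \<in> ?C" if "\<sigma> \<in> poisson_auts R" for \<sigma>
    using bij that by (simp_all add: G_def bij_betw_inv_into_right bij_betw_def inv_into_into)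
  have GF: "G (F t) = t" if "t \<in> ?C" for t
    using bij that by (simp add: G_def bij_betw_inv_into_left)
  have F: "F t \<in> poisson_auts R" if "t \<in> ?C" for t
    using bij that by (simp add: bij_betwE)
  have Gm: "G (\<sigma> \<otimes>\<^bsub>AutP R\<^esub> \<tau>) = G \<sigma> \<otimes>\<^bsub>?S\<^esub> G \<tau>" if "\<sigma> \<in> poisson_auts R" "\<tau> \<in> poisson_auts R" for \<sigma> \<tau>
  proof -
    obtain h n where 1: "G \<sigma> = (h, n)" "h \<in> carrier H" "n \<in> carrier N"
      using FG(2)[OF \<open>\<sigma> \<in> poisson_auts R\<close>] by (cases "G \<sigma>") auto
    obtain h' n' where 2: "G \<tau> = (h', n')" "h' \<in> carrier H" "n' \<in> carrier N"
      using FG(2)[OF \<open>\<tau> \<in> poisson_auts R\<close>] by (cases "G \<tau>") auto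
    have "\<sigma> \<otimes>\<^bsub>AutP R\<^esub> \<tau> = F (h \<otimes>\<^bsub>H\<^esub> h', n \<otimes>\<^bsub>N\<^esub> \<phi> h n')"
      using mult 1 2 FG(1)[OF that(1)] FG(1)[OF that(2)] by (simp add: AutP_mult that)
    then show ?thesis
      using 1 2 GF[of "(h \<otimes>\<^bsub>H\<^esub> h', n \<otimes>\<^bsub>N\<^esub> \<phi> h n')"] H N by (simp add: semidirect_def)
  qed
  have cS: "carrier ?S = ?C"
    by (simp add: semidirect_def)
  have bG: "bij_betw G (poisson_auts R) ?C"
    using bij by (simp add: G_def bij_betw_inv_into)
  have "G \<in> iso (AutP R) ?S"
    unfolding iso_def Group.hom_def using bG Gm by (auto simp: cS bij_betwE)
  then show "AutP R \<cong> ?S"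
    unfolding is_iso_def by blast
  have m1: "F (\<one>\<^bsub>H\<^esub>, n \<otimes>\<^bsub>N\<^esub> n') = F (\<one>\<^bsub>H\<^esub>, n) \<otimes>\<^bsub>AutP R\<^esub> F (\<one>\<^bsub>H\<^esub>, n')"
    if "n \<in> carrier N" "n' \<in> carrier N" for n n'
    using mult[of "\<one>\<^bsub>H\<^esub>" n "\<one>\<^bsub>H\<^esub>" n'] H N(3) that F by (simp add: AutP_mult)
  have "(\<lambda>n. F (\<one>\<^bsub>H\<^esub>, n)) \<in> mon N (AutP R)"
    unfolding mon_def Group.hom_def using F H m1 bij by (auto simp: bij_betw_def inj_on_def)
  moreover have "(\<lambda>\<sigma>. fst (G \<sigma>)) \<in> epi (AutP R) H"
  proof -
    have "fst (G (\<sigma> \<otimes>\<^bsub>AutP R\<^esub> \<tau>)) = fst (G \<sigma>) \<otimes>\<^bsub>H\<^esub> fst (G \<tau>)"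
      if "\<sigma> \<in> poisson_auts R" "\<tau> \<in> poisson_auts R" for \<sigma> \<tau>
      using Gm[OF that] by (simp add: semidirect_def split: prod.splits)
    moreover have "fst (G \<sigma>) \<in> carrier H" if "\<sigma> \<in> poisson_auts R" for \<sigma>
      using FG(2)[OF that] by auto
    moreover have "h \<in> (\<lambda>\<sigma>. fst (G \<sigma>)) ` poisson_auts R" if "h \<in> carrier H" for h
      using GF[of "(h, \<one>\<^bsub>N\<^esub>)"] F[of "(h, \<one>\<^bsub>N\<^esub>)"] that N(2)
      by (intro image_eqI[of _ _ "F (h, \<one>\<^bsub>N\<^esub>)"]) auto
    ultimately show ?thesis
      by (auto simp: epi_def Group.hom_def)
  qed
  moreover have "(\<lambda>n. F (\<one>\<^bsub>H\<^esub>, n)) ` carrier N = kernel (AutP R) H (\<lambda>\<sigma>. fst (G \<sigma>))"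
  proof (intro equalityI subsetI)
    fix \<sigma> assume "\<sigma> \<in> (\<lambda>n. F (\<one>\<^bsub>H\<^esub>, n)) ` carrier N"
    then show "\<sigma> \<in> kernel (AutP R) H (\<lambda>\<sigma>. fst (G \<sigma>))"
      using F GF H by (auto simp: kernel_def)
  next
    fix \<sigma> assume "\<sigma> \<in> kernel (AutP R) H (\<lambda>\<sigma>. fst (G \<sigma>))"
    then have \<sigma>: "\<sigma> \<in> poisson_auts R" "fst (G \<sigma>) = \<one>\<^bsub>H\<^esub>"
      by (auto simp: kernel_def)
    obtain h n where "G \<sigma> = (h, n)"
      by (cases "G \<sigma>")
    then show "\<sigma> \<in> (\<lambda>n. F (\<one>\<^bsub>H\<^esub>, n)) ` carrier N"
      using FG[OF \<sigma>(1)] \<sigma>(2) by auto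
  qed
  ultimately show "short_exact N (AutP R) H"
    unfolding short_exact_def by blast
qed

context potential
begin

text \<open>\<open>aut_triples 0\<close> parametrizes both groups: every exact automorphism
  preserves the ideal of \<Omega>, and every automorphism of the quotient has a unique lift.\<close>

lemma AutP_A_iso_AutP_P: "AutP (A_Omega \<Omega>) \<cong> AutP (P_Omega \<Omega> 0)"
proof -
  define tr where "tr \<sigma> = (\<sigma> varX, \<sigma> varY, \<sigma> varZ)" for \<sigma> :: "'k poly3 \<Rightarrow> 'k poly3"
  define F where "F \<sigma> = ind \<Omega> 0 (tr \<sigma>)" for \<sigma>
  have ex: "\<exists>X Y Z X' Y' Z'. exact_aut X Y Z X' Y' Z' \<and> \<sigma> = sub X Y Z" if "\<sigma> \<in> poisson_auts (A_Omega \<Omega>)" for \<sigma>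
    by (rule poisson_auts_A_exact[OF that]) blast
  have tr: "tr \<sigma> \<in> aut_triples 0" "subT (tr \<sigma>) = \<sigma>" if \<sigma>: "\<sigma> \<in> poisson_auts (A_Omega \<Omega>)" for \<sigma>
  proof -
    obtain X Y Z X' Y' Z' where e: "exact_aut X Y Z X' Y' Z'" "\<sigma> = sub X Y Z"
      using ex[OF \<sigma>] by blast
    obtain J where J: "sub X Y Z \<Omega> = const3 J * \<Omega>"
      using sub_\<Omega>_exact_aut[OF e(1)] by blast
    show "tr \<sigma> \<in> aut_triples 0"
      using e(1) \<Omega>_shift_dvd_iff[OF J, of 0] by (auto simp: tr_def e(2) aut_triples_def)
    show "subT (tr \<sigma>) = \<sigma>"
      by (simp add: fun_eq_iff subT_def tr_def e(2))
  qed
  have t2: "sub X Y Z \<in> poisson_auts (A_Omega \<Omega>)" if "(X, Y, Z) \<in> aut_triples 0" for X Y Z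
    using that exact_aut_poisson_auts_A by (auto simp: aut_triples_def)
  have "bij_betw tr (poisson_auts (A_Omega \<Omega>)) (aut_triples 0)"
    unfolding bij_betw_def
  proof (intro conjI inj_onI equalityI subsetI)
    show "\<sigma> = \<tau>" if "\<sigma> \<in> poisson_auts (A_Omega \<Omega>)" "\<tau> \<in> poisson_auts (A_Omega \<Omega>)" "tr \<sigma> = tr \<tau>" for \<sigma> \<tau>
      using tr(2)[OF that(1)] tr(2)[OF that(2)] that(3) by metis
    show "T \<in> aut_triples 0" if "T \<in> tr ` poisson_auts (A_Omega \<Omega>)" for T
      using that tr(1) by blast
    show "T \<in> tr ` poisson_auts (A_Omega \<Omega>)" if T: "T \<in> aut_triples 0" for T
    proof -
      obtain X Y Z where "T = (X, Y, Z)" by (cases T)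
      then show ?thesis
        using t2 T by (intro image_eqI[of _ _ "sub X Y Z"]) (auto simp: tr_def)
    qed
  qed
  then have "bij_betw (ind \<Omega> 0 \<circ> tr) (poisson_auts (A_Omega \<Omega>)) (poisson_auts (P_Omega \<Omega> 0))"
    using bij_betw_ind by (rule bij_betw_trans)
  then have bij: "bij_betw F (poisson_auts (A_Omega \<Omega>)) (poisson_auts (P_Omega \<Omega> 0))"
    using F_def by (simp add: comp_def F_def [abs_def])
  have "F (\<sigma> \<otimes>\<^bsub>AutP (A_Omega \<Omega>)\<^esub> \<tau>) = F \<sigma> \<otimes>\<^bsub>AutP (P_Omega \<Omega> 0)\<^esub> F \<tau>"
    if \<sigma>\<tau>: "\<sigma> \<in> poisson_auts (A_Omega \<Omega>)" "\<tau> \<in> poisson_auts (A_Omega \<Omega>)" for \<sigma> \<tau>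
  proof -
    have F: "F \<sigma> \<in> poisson_auts (P_Omega \<Omega> 0)" "F \<tau> \<in> poisson_auts (P_Omega \<Omega> 0)"
      using bij \<sigma>\<tau> by (auto simp: bij_betwE)
    have "tr (compose UNIV \<sigma> \<tau>) = compT (tr \<sigma>) (tr \<tau>)"
      using tr(2)[OF \<sigma>\<tau>(1)] by (simp add: compT_def compose_def) (simp add: tr_def)
    then show ?thesis
      using tr(1) \<sigma>\<tau> by (simp add: AutP_mult F) (simp add: F_def ind_compT)
  qed
  then have "F \<in> iso (AutP (A_Omega \<Omega>)) (AutP (P_Omega \<Omega> 0))"
    unfolding iso_def Group.hom_def using bij by (auto simp: bij_betwE)
  then show ?thesis
    unfolding is_iso_def by blast
qed

lemma semidirect_iso_AutP_P:
  assumes bij: "bij_betw \<Phi> (carrier H \<times> carrier N) (aut_triples \<xi>)"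
    and mult: "\<And>h n h' n'. h \<in> carrier H \<Longrightarrow> n \<in> carrier N \<Longrightarrow> h' \<in> carrier H \<Longrightarrow> n' \<in> carrier N \<Longrightarrow>
      \<Phi> (h \<otimes>\<^bsub>H\<^esub> h', n \<otimes>\<^bsub>N\<^esub> \<phi> h n') = compT (\<Phi> (h, n)) (\<Phi> (h', n'))"
    and H: "\<And>h h'. h \<in> carrier H \<Longrightarrow> h' \<in> carrier H \<Longrightarrow> h \<otimes>\<^bsub>H\<^esub> h' \<in> carrier H"
      "\<one>\<^bsub>H\<^esub> \<in> carrier H" "\<one>\<^bsub>H\<^esub> \<otimes>\<^bsub>H\<^esub> \<one>\<^bsub>H\<^esub> = \<one>\<^bsub>H\<^esub>"
    and N: "\<And>h n n'. h \<in> carrier H \<Longrightarrow> n \<in> carrier N \<Longrightarrow> n' \<in> carrier N \<Longrightarrow> n \<otimes>\<^bsub>N\<^esub> \<phi> h n' \<in> carrier N"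
      "\<one>\<^bsub>N\<^esub> \<in> carrier N" "\<And>n. n \<in> carrier N \<Longrightarrow> \<phi> \<one>\<^bsub>H\<^esub> n = n"
  shows "AutP (P_Omega \<Omega> \<xi>) \<cong> semidirect H N \<phi>" "short_exact N (AutP (P_Omega \<Omega> \<xi>)) H"
proof -
  have b: "bij_betw (\<lambda>t. ind \<Omega> \<xi> (\<Phi> t)) (carrier H \<times> carrier N) (poisson_auts (P_Omega \<Omega> \<xi>))"
    using bij_betw_trans[OF bij bij_betw_ind] by (simp add: comp_def)
  have \<Phi>: "\<Phi> (h, n) \<in> aut_triples \<xi>" if "h \<in> carrier H" "n \<in> carrier N" for h n
    using bij that by (auto simp: bij_betw_def)
  have m: "ind \<Omega> \<xi> (\<Phi> (h \<otimes>\<^bsub>H\<^esub> h', n \<otimes>\<^bsub>N\<^esub> \<phi> h n')) =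
      compose (carrier (P_Omega \<Omega> \<xi>)) (ind \<Omega> \<xi> (\<Phi> (h, n))) (ind \<Omega> \<xi> (\<Phi> (h', n')))"
    if "h \<in> carrier H" "n \<in> carrier N" "h' \<in> carrier H" "n' \<in> carrier N" for h n h' n'
    using that \<Phi> by (simp add: mult ind_compT)
  show "AutP (P_Omega \<Omega> \<xi>) \<cong> semidirect H N \<phi>" "short_exact N (AutP (P_Omega \<Omega> \<xi>)) H"
    using semidirect_iso_AutP[where F = "\<lambda>t. ind \<Omega> \<xi> (\<Phi> t)", OF b m H N] by blast+
qed

end

section \<open>Coefficient comparisons\<close>

text \<open>
  Up to the even permutations of the variables: a matrix compatible with the bracket of a smooth
  cubic in Hesse form is diagonal. Here \<open>\<kappa> = -\<lambda> / 3\<close>.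
\<close>
lemma cubic_monomial:
  fixes a1 a2 a3 b1 b2 b3 c1 c2 c3 \<kappa> :: "'a::field_char_0"
  assumes \<kappa>: "\<kappa> ^ 3 \<noteq> 1" and det: "a1 * (b2 * c3 - b3 * c2) - a2 * (b1 * c3 - b3 * c1) + a3 * (b1 * c2 - b2 * c1) \<noteq> 0"
    and E: "c2 * c3 = \<kappa> * a3 * b2" "c1 * c3 = \<kappa> * a1 * b3" "c1 * c2 = \<kappa> * a2 * b1"
     "a2 * a3 = \<kappa> * b3 * c2" "a1 * a3 = \<kappa> * b1 * c3" "a1 * a2 = \<kappa> * b2 * c1"
     "b2 * b3 = \<kappa> * c3 * a2" "b1 * b3 = \<kappa> * c1 * a3" "b1 * b2 = \<kappa> * c2 * a1"
    and S: "a1^2 - \<kappa> * b1 * c1 = b2 * c3 - b3 * c2" "b3^2 - \<kappa> * c3 * a3 = c1 * a2 - c2 * a1"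
      "c2^2 - \<kappa> * a2 * b2 = a3 * b1 - a1 * b3" "a2^2 - \<kappa> * b2 * c2 = b3 * c1 - b1 * c3"
      "b1^2 - \<kappa> * c1 * a1 = c2 * a3 - c3 * a2" "c3^2 - \<kappa> * a3 * b3 = a1 * b2 - a2 * b1"
      "a3^2 - \<kappa> * b3 * c3 = b1 * c2 - b2 * c1" "b2^2 - \<kappa> * c2 * a2 = c3 * a1 - c1 * a3"
      "c1^2 - \<kappa> * a1 * b1 = a2 * b3 - a3 * b2"
  shows "a2 = 0 \<and> a3 = 0 \<and> b1 = 0 \<and> b3 = 0 \<and> c1 = 0 \<and> c2 = 0 \<or>
    a1 = 0 \<and> a3 = 0 \<and> b1 = 0 \<and> b2 = 0 \<and> c2 = 0 \<and> c3 = 0 \<or>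
    a1 = 0 \<and> a2 = 0 \<and> b2 = 0 \<and> b3 = 0 \<and> c1 = 0 \<and> c3 = 0"
proof (cases "\<kappa> = 0")
  case True
  \<comment> \<open>This excludes the odd permutation matrices: inserting the equations into each
    other yields \<open>p ^ 4 = - (p ^ 4)\<close>.\<close>
  have no_odd: "\<not> (p \<noteq> 0 \<and> p^2 = - (q * r) \<and> q^2 = - (r * p) \<and> r^2 = - (p * q))" for p q r :: 'a
  proof
    assume *: "p \<noteq> 0 \<and> p^2 = - (q * r) \<and> q^2 = - (r * p) \<and> r^2 = - (p * q)"
    then have e: "p^2 = - (q * r)" "q^2 = - (r * p)" "r^2 = - (p * q)"
      by auto
    have "(q * r)^2 = (- (r * p)) * (- (p * q))"
      by (simp only: power_mult_distrib e(2,3))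
    also have "\<dots> = p^2 * (q * r)"
      by (simp add: power2_eq_square)
    also have "q * r = - (p^2)"
      by (simp add: e(1))
    finally have "(p^2)^2 = - ((p^2)^2)"
      by (simp add: power2_eq_square)
    then have "2 * (p^2)^2 = 0"
      by (simp only: eq_neg_iff_add_eq_0 mult_2)
    then have "p = 0"
      by simp
    then show False
      using * by simp
  qed
  \<comment> \<open>For \<kappa> = 0 any two entries of a row have product 0, so a matrix with
    nonzero determinant is monomial, and only the parity of the permutation is left.\<close>
  have z: "c2 * c3 = 0" "c1 * c3 = 0" "c1 * c2 = 0" "a2 * a3 = 0" "a1 * a3 = 0" "a1 * a2 = 0"
    "b2 * b3 = 0" "b1 * b3 = 0" "b1 * b2 = 0"
    using E True by simp_all
  have S': "a1^2 = b2 * c3 - b3 * c2" "b3^2 = c1 * a2 - c2 * a1" "c2^2 = a3 * b1 - a1 * b3"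
    "a2^2 = b3 * c1 - b1 * c3" "b1^2 = c2 * a3 - c3 * a2" "c3^2 = a1 * b2 - a2 * b1"
    "a3^2 = b1 * c2 - b2 * c1" "b2^2 = c3 * a1 - c1 * a3" "c1^2 = a2 * b3 - a3 * b2"
    using S True by simp_all
  consider "a1 \<noteq> 0" "a2 = 0" "a3 = 0" | "a1 = 0" "a2 \<noteq> 0" "a3 = 0" | "a1 = 0" "a2 = 0" "a3 \<noteq> 0"
    using z det by auto
  then show ?thesis
  proof cases
    case 1
    show ?thesis
    proof (cases "b3 * c2 = 0")
      case True
      then have "b2 \<noteq> 0" "c3 \<noteq> 0"
        using S' 1 by auto
      then show ?thesis
        using z 1 by auto
    next
      case False
      then have "b2 = 0" "b1 = 0" "c1 = 0" "c3 = 0"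
        using z by auto
      then have "a1^2 = - (b3 * c2)" "b3^2 = - (c2 * a1)" "c2^2 = - (a1 * b3)"
        using S' 1 by auto
      then show ?thesis
        using no_odd[of a1 b3 c2] 1 by blast
    qed
  next
    case 2
    show ?thesis
    proof (cases "b1 * c3 = 0")
      case True
      then have "b3 \<noteq> 0" "c1 \<noteq> 0"
        using S' 2 by auto
      then show ?thesis
        using z 2 by auto
    next
      case False
      then have "b2 = 0" "b3 = 0" "c1 = 0" "c2 = 0"
        using z by auto
      then have "a2^2 = - (b1 * c3)" "b1^2 = - (c3 * a2)" "c3^2 = - (a2 * b1)"
        using S' 2 by auto
      then show ?thesis
        using no_odd[of a2 b1 c3] 2 by blast
    qed
  next
    case 3
    show ?thesis
    proof (cases "b2 * c1 = 0")
      case True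
      then have "b1 \<noteq> 0" "c2 \<noteq> 0"
        using S' 3 by auto
      then show ?thesis
        using z 3 by auto
    next
      case False
      then have "b1 = 0" "b3 = 0" "c2 = 0" "c3 = 0"
        using z by auto
      then have "a3^2 = - (b2 * c1)" "b2^2 = - (c1 * a3)" "c1^2 = - (a3 * b2)"
        using S' 3 by auto
      then show ?thesis
        using no_odd[of a3 b2 c1] 3 by blast
    qed
  qed
next
  case False
  \<comment> \<open>For \<kappa> \<noteq> 0 the entries on each of the three cyclic diagonals vanish
    together: one zero entry annihilates further products by \<open>E\<close>, and a zero column or
    row is excluded by the determinant.\<close>
  have d0: "a1 = 0 \<Longrightarrow> b2 = 0 \<and> c3 = 0" "b2 = 0 \<Longrightarrow> c3 = 0 \<and> a1 = 0" "c3 = 0 \<Longrightarrow> a1 = 0 \<and> b2 = 0"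
    and d1: "a2 = 0 \<Longrightarrow> b3 = 0 \<and> c1 = 0" "b3 = 0 \<Longrightarrow> c1 = 0 \<and> a2 = 0" "c1 = 0 \<Longrightarrow> a2 = 0 \<and> b3 = 0"
    and d2: "a3 = 0 \<Longrightarrow> b1 = 0 \<and> c2 = 0" "b1 = 0 \<Longrightarrow> c2 = 0 \<and> a3 = 0" "c2 = 0 \<Longrightarrow> a3 = 0 \<and> b1 = 0"
    using E False det by auto
  \<comment> \<open>Three of the equations \<open>E\<close> multiplied together have the same
    product of two diagonals on both sides, up to the factor \<open>\<kappa> ^ 3\<close>. So at most
    one diagonal survives.\<close>
  have "(c1 * c3) * (a1 * a2) * (b2 * b3) = (\<kappa> * a1 * b3) * (\<kappa> * b2 * c1) * (\<kappa> * c3 * a2)"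
    "(c2 * c3) * (a1 * a3) * (b1 * b2) = (\<kappa> * a3 * b2) * (\<kappa> * b1 * c3) * (\<kappa> * c2 * a1)"
    "(a2 * a3) * (b1 * b3) * (c1 * c2) = (\<kappa> * b3 * c2) * (\<kappa> * c1 * a3) * (\<kappa> * a2 * b1)"
    by (simp_all only: E)
  then have "(1 - \<kappa> ^ 3) * ((a1 * b2 * c3) * (a2 * b3 * c1)) = 0"
    "(1 - \<kappa> ^ 3) * ((a1 * b2 * c3) * (a3 * b1 * c2)) = 0"
    "(1 - \<kappa> ^ 3) * ((a2 * b3 * c1) * (a3 * b1 * c2)) = 0"
    by (simp_all add: power3_eq_cube algebra_simps)
  then have "a1 * b2 * c3 = 0 \<or> a2 * b3 * c1 = 0" "a1 * b2 * c3 = 0 \<or> a3 * b1 * c2 = 0"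
    "a2 * b3 * c1 = 0 \<or> a3 * b1 * c2 = 0"
    using \<kappa> by auto
  moreover have "a1 * b2 * c3 = 0 \<Longrightarrow> a1 = 0 \<and> b2 = 0 \<and> c3 = 0"
    "a2 * b3 * c1 = 0 \<Longrightarrow> a2 = 0 \<and> b3 = 0 \<and> c1 = 0"
    "a3 * b1 * c2 = 0 \<Longrightarrow> a3 = 0 \<and> b1 = 0 \<and> c2 = 0"
    using d0 d1 d2 by (metis mult_eq_0_iff)+
  ultimately show ?thesis
    by blast
qed

text \<open>The coefficient at \<open>x\<^sup>4\<close> of the Hessian of the binary quartic \<open>F(p x + q y, r x + s y)\<close>.\<close>
lemma quartic_hessian:
  fixes p q r s m :: "'a::field_char_0"
  assumes D: "p * s - q * r \<noteq> 0" and m: "m^2 \<noteq> 4"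
    and F: "\<And>x y. (p * x + q * y)^4 + (r * x + s * y)^4 + m * (p * x + q * y)^2 * (r * x + s * y)^2
       = (p * s - q * r)^2 * (x^4 + y^4 + m * x^2 * y^2)"
  shows "p * r = 0"
proof -
  define D where "D = (p * s - q * r)^2"
  define c0 where "c0 = q^4 + s^4 + m * q^2 * s^2 - D"
  define c1 where "c1 = 4 * p * q^3 + 4 * r * s^3 + m * (2 * p * q * s^2 + 2 * q^2 * r * s)"
  define c2 where "c2 = 6 * p^2 * q^2 + 6 * r^2 * s^2 + m * (p^2 * s^2 + q^2 * r^2 + 4 * p * q * r * s) - D * m"
  define c3 where "c3 = 4 * p^3 * q + 4 * r^3 * s + m * (2 * p * q * r^2 + 2 * p^2 * r * s)"
  define c4 where "c4 = p^4 + r^4 + m * p^2 * r^2 - D"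
  have "poly [:c0, c1, c2, c3, c4:] x = 0" for x
  proof -
    have "poly [:c0, c1, c2, c3, c4:] x = ((p * x + q * 1)^4 + (r * x + s * 1)^4 +
        m * (p * x + q * 1)^2 * (r * x + s * 1)^2) - (p * s - q * r)^2 * (x^4 + 1^4 + m * x^2 * 1^2)"
      unfolding c0_def c1_def c2_def c3_def c4_def D_def poly_pCons poly_0
      by (simp add: power4_eq_xxxx power3_eq_cube power2_eq_square algebra_simps)
    then show ?thesis
      unfolding F by simp
  qed
  then have "[:c0, c1, c2, c3, c4:] = 0"
    by (simp only: poly_all_0_iff_0[symmetric]) simp
  then have c: "c2 = 0" "c3 = 0" "c4 = 0"
    by simp_all
  \<comment> \<open>The Hessian of X^4 + Y^4 + m X^2 Y^2 is 24 m times the quartic plus (144 - 36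
    m^2) X^2 Y^2, and a substitution multiplies it by the square D of the determinant. The
    substituted quartic has the coefficients c4 + D, c3, c2 + D * m at x^4, x^3 y, x^2 y^2, so its
    Hessian has 24 (c4 + D) (c2 + D * m) - 9 c3^2 at x^4.\<close>
  have "D * ((144 - 36 * m^2) * (p * r)^2) =
      24 * c4 * (c2 + D * m) + 24 * D * c2 - 9 * c3^2 - 24 * m * D * c4"
    unfolding c4_def c3_def c2_def D_def
    by (simp add: power4_eq_xxxx power3_eq_cube power2_eq_square algebra_simps)
  then have "D * ((144 - 36 * m^2) * (p * r)^2) = 0"
    by (simp add: c)
  moreover have "144 - 36 * m^2 \<noteq> 0"
  proof
    assume "144 - 36 * m^2 = 0"
    then have "36 * (4 - m^2) = 0"
      by simp
    then show False
      using m by simp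
  qed
  ultimately show ?thesis
    using D by (simp add: D_def)
qed


text \<open>The hypothesis is the relation for {X, Y} of linear forms, as an identity of values. The
  difference \<open>Q\<close> of its sides is a quadratic form: unit vectors give the square
  coefficients, polarization gives the mixed ones. Cyclic renaming of the rows covers the other two
  relations.\<close>

lemma cubic_coefficients:
  fixes lam :: "'a::field_char_0"
  assumes id: "\<And>x y z. (a1 * b2 - a2 * b1) * (3 * z^2 + lam * x * y) + (a2 * b3 - a3 * b2) * (3 * x^2 + lam * y * z)
      + (a3 * b1 - a1 * b3) * (3 * y^2 + lam * x * z)
    = 3 * (c1 * x + c2 * y + c3 * z)^2 + lam * (a1 * x + a2 * y + a3 * z) * (b1 * x + b2 * y + b3 * z)"
    and \<kappa>: "\<kappa> = - lam / 3"
  shows "c2 * c3 = \<kappa> * a3 * b2" "c1 * c3 = \<kappa> * a1 * b3" "c1 * c2 = \<kappa> * a2 * b1"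
    "c1^2 - \<kappa> * a1 * b1 = a2 * b3 - a3 * b2" "c2^2 - \<kappa> * a2 * b2 = a3 * b1 - a1 * b3"
    "c3^2 - \<kappa> * a3 * b3 = a1 * b2 - a2 * b1"
proof -
  have l: "lam = - 3 * \<kappa>"
    by (simp add: \<kappa>)
  define Q where "Q x y z = 3 * (c1 * x + c2 * y + c3 * z)^2 + lam * (a1 * x + a2 * y + a3 * z) * (b1 * x + b2 * y + b3 * z)
    - ((a1 * b2 - a2 * b1) * (3 * z^2 + lam * x * y) + (a2 * b3 - a3 * b2) * (3 * x^2 + lam * y * z)
      + (a3 * b1 - a1 * b3) * (3 * y^2 + lam * x * z))" for x y z
  have Q: "Q x y z = 0" for x y z
    by (simp only: Q_def id diff_self)
  have "6 * (c2 * c3 - \<kappa> * a3 * b2) = Q 0 1 1 - Q 0 1 0 - Q 0 0 1" "6 * (c1 * c3 - \<kappa> * a1 * b3) = Q 1 0 1 - Q 1 0 0 - Q 0 0 1"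
    "6 * (c1 * c2 - \<kappa> * a2 * b1) = Q 1 1 0 - Q 1 0 0 - Q 0 1 0"
    unfolding Q_def l by (simp_all add: power2_eq_square algebra_simps)
  then show "c2 * c3 = \<kappa> * a3 * b2" "c1 * c3 = \<kappa> * a1 * b3" "c1 * c2 = \<kappa> * a2 * b1"
    by (simp_all add: Q)
  have "3 * (c1^2 - \<kappa> * a1 * b1 - (a2 * b3 - a3 * b2)) = Q 1 0 0" "3 * (c2^2 - \<kappa> * a2 * b2 - (a3 * b1 - a1 * b3)) = Q 0 1 0"
    "3 * (c3^2 - \<kappa> * a3 * b3 - (a1 * b2 - a2 * b1)) = Q 0 0 1"
    unfolding Q_def l by (simp_all add: power2_eq_square algebra_simps)
  then show "c1^2 - \<kappa> * a1 * b1 = a2 * b3 - a3 * b2" "c2^2 - \<kappa> * a2 * b2 = a3 * b1 - a1 * b3"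
    "c3^2 - \<kappa> * a3 * b3 = a1 * b2 - a2 * b1"
    unfolding Q mult_eq_0_iff by simp_all
qed

text \<open>The triple of \<open>n h\<^sup>i\<close> for \<open>n = (\<alpha>1, \<alpha>2, \<alpha>3)\<close> and \<open>h\<close> the substitution \<open>x \<mapsto> z, y \<mapsto> x, z \<mapsto> y\<close>.\<close>
definition cubic_triple :: "int \<times> 'k \<times> 'k \<times> 'k \<Rightarrow> 'k::comm_ring_1 triple" where
  "cubic_triple t = (case t of (i, \<alpha>1, \<alpha>2, \<alpha>3) \<Rightarrow>
     if i = 0 then (const3 \<alpha>1 * varX, const3 \<alpha>2 * varY, const3 \<alpha>3 * varZ)
     else if i = 1 then (const3 \<alpha>3 * varZ, const3 \<alpha>1 * varX, const3 \<alpha>2 * varY)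
     else (const3 \<alpha>2 * varY, const3 \<alpha>3 * varZ, const3 \<alpha>1 * varX))"

text \<open>Both groups at once: \<xi> = 0 gives \<open>G_111\<close> and \<xi> = 1 gives
  \<open>G'_111\<close>.\<close>

definition G_cubic :: "'k::field \<Rightarrow> ('k \<times> 'k \<times> 'k) set" where
  "G_cubic \<xi> = {(\<alpha>1, \<alpha>2, \<alpha>3). \<alpha>1 \<noteq> 0 \<and> \<alpha>2 \<noteq> 0 \<and> \<alpha>3 \<noteq> 0 \<and> \<alpha>1 ^ 3 = \<alpha>2 ^ 3 \<and> \<alpha>2 ^ 3 = \<alpha>3 ^ 3 \<and>
     \<alpha>3 ^ 3 = \<alpha>1 * \<alpha>2 * \<alpha>3 \<and> (\<alpha>1 * \<alpha>2 * \<alpha>3 - 1) * \<xi> = 0}"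

text \<open>The quadratic equations are the form in which the bracket relations of a diagonal triple
  appear.\<close>

lemma G_cubic_iff:
  "(\<alpha>1, \<alpha>2, \<alpha>3) \<in> G_cubic \<xi> \<longleftrightarrow> \<alpha>1 \<noteq> 0 \<and> \<alpha>2 \<noteq> 0 \<and> \<alpha>3 \<noteq> 0 \<and> \<alpha>1^2 = \<alpha>2 * \<alpha>3 \<and> \<alpha>2^2 = \<alpha>3 * \<alpha>1 \<and>
     \<alpha>3^2 = \<alpha>1 * \<alpha>2 \<and> (\<alpha>1 * \<alpha>2 * \<alpha>3 - 1) * \<xi> = 0"
proof -
  have "x ^ 3 = x * y * z \<longleftrightarrow> x^2 = y * z" if "x \<noteq> 0" for x y z :: 'a
    using that by (simp add: power3_eq_cube power2_eq_square mult.assoc)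
  from this[of \<alpha>1 \<alpha>2 \<alpha>3] this[of \<alpha>2 \<alpha>3 \<alpha>1] this[of \<alpha>3 \<alpha>1 \<alpha>2] show ?thesis
    by (auto simp: G_cubic_def mult_ac)
qed

section \<open>Weights (1, 1, 1): automorphisms for the Hesse cubic\<close>

locale cubic = potential 1 1 1 \<Omega> for \<Omega> :: "'k::{alg_closed_field, field_char_0} poly3" +
  fixes lam :: 'k
  assumes \<Omega>_eq: "\<Omega> = varX ^ 3 + varY ^ 3 + varZ ^ 3 + const3 lam * varX * varY * varZ"
    and lam: "(- lam) ^ 3 \<noteq> 27"
begin

lemma partial_\<Omega>:
  "partial_x \<Omega> = const3 3 * varX ^ 2 + const3 lam * varY * varZ"
  "partial_y \<Omega> = const3 3 * varY ^ 2 + const3 lam * varX * varZ"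
  "partial_z \<Omega> = const3 3 * varZ ^ 2 + const3 lam * varX * varY"
  unfolding \<Omega>_eq power3_eq_cube power2_eq_square
  by (simp_all add: partial_derivation partial_generators const3_numeral algebra_simps)

lemma pois_diagonal:
  assumes "\<alpha>1^2 = \<alpha>2 * \<alpha>3" "\<alpha>2^2 = \<alpha>3 * \<alpha>1" "\<alpha>3^2 = \<alpha>1 * \<alpha>2"
  shows "pois 0 (const3 \<alpha>1 * varX) (const3 \<alpha>2 * varY) (const3 \<alpha>3 * varZ)"
proof -
  have e: "const3 \<alpha>1 * const3 \<alpha>1 = const3 \<alpha>2 * const3 \<alpha>3" "const3 \<alpha>2 * const3 \<alpha>2 = const3 \<alpha>3 * const3 \<alpha>1"
    "const3 \<alpha>3 * const3 \<alpha>3 = const3 \<alpha>1 * const3 \<alpha>2"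
    using assms by (simp_all only: const3_simps(6)[symmetric] power2_eq_square)
  have sq: "const3 \<alpha>1 * f * (const3 \<alpha>1 * f) = const3 \<alpha>2 * const3 \<alpha>3 * (f * f)"
    "const3 \<alpha>2 * f * (const3 \<alpha>2 * f) = const3 \<alpha>3 * const3 \<alpha>1 * (f * f)"
    "const3 \<alpha>3 * f * (const3 \<alpha>3 * f) = const3 \<alpha>1 * const3 \<alpha>2 * (f * f)" for f
    unfolding e[symmetric] by (simp_all only: mult_ac)
  show ?thesis
    unfolding pois_exact jacobian3_def partial_\<Omega> partial_derivation partial_generators partial_const3
      sub_simps power2_eq_square sq
    by (simp add: algebra_simps)
qed

lemma diagonal_in_aut_triples:
  assumes "(\<alpha>1, \<alpha>2, \<alpha>3) \<in> G_cubic \<xi>"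
  shows "(const3 \<alpha>1 * varX, const3 \<alpha>2 * varY, const3 \<alpha>3 * varZ) \<in> aut_triples \<xi>"
proof -
  have nz: "\<alpha>1 \<noteq> 0" "\<alpha>2 \<noteq> 0" "\<alpha>3 \<noteq> 0" and e: "\<alpha>1^2 = \<alpha>2 * \<alpha>3" "\<alpha>2^2 = \<alpha>3 * \<alpha>1" "\<alpha>3^2 = \<alpha>1 * \<alpha>2"
    and \<xi>: "(\<alpha>1 * \<alpha>2 * \<alpha>3 - 1) * \<xi> = 0"
    using assms by (auto simp: G_cubic_iff)
  have i: "const3 \<alpha> * (const3 (1 / \<alpha>) * f) = f" "const3 (1 / \<alpha>) * (const3 \<alpha> * f) = f" if "\<alpha> \<noteq> 0" for \<alpha> :: 'k and f
    using that by (simp_all add: mult.assoc[symmetric] const3_simps(6)[symmetric] const3_simps(2))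
  have "pois 0 (const3 (1 / \<alpha>1) * varX) (const3 (1 / \<alpha>2) * varY) (const3 (1 / \<alpha>3) * varZ)"
    by (rule pois_diagonal) (use nz e in \<open>simp_all add: power_divide\<close>)
  then have "exact_aut (const3 \<alpha>1 * varX) (const3 \<alpha>2 * varY) (const3 \<alpha>3 * varZ)
      (const3 (1 / \<alpha>1) * varX) (const3 (1 / \<alpha>2) * varY) (const3 (1 / \<alpha>3) * varZ)"
    using pois_diagonal[OF e] nz by (simp add: exact_aut_def i)
  moreover have "sub (const3 \<alpha>1 * varX) (const3 \<alpha>2 * varY) (const3 \<alpha>3 * varZ) \<Omega> = const3 (\<alpha>1 * \<alpha>2 * \<alpha>3) * \<Omega>"
  proof -
    have "\<alpha>1 ^ 3 = \<alpha>1 * \<alpha>2 * \<alpha>3" "\<alpha>2 ^ 3 = \<alpha>1 * \<alpha>2 * \<alpha>3" "\<alpha>3 ^ 3 = \<alpha>1 * \<alpha>2 * \<alpha>3"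
      using assms by (auto simp: G_cubic_def)
    then have "const3 \<alpha>1 ^ 3 = const3 (\<alpha>1 * \<alpha>2 * \<alpha>3)" "const3 \<alpha>2 ^ 3 = const3 (\<alpha>1 * \<alpha>2 * \<alpha>3)"
      "const3 \<alpha>3 ^ 3 = const3 (\<alpha>1 * \<alpha>2 * \<alpha>3)"
      by (metis const3_power)+
    then show ?thesis
      unfolding \<Omega>_eq sub_simps power_mult_distrib by (simp add: const3_simps(6) algebra_simps)
  qed
  ultimately show ?thesis
    using \<Omega>_shift_dvd_iff \<xi> by (auto simp: aut_triples_def)
qed

lemma shift_in_aut_triples: "(varZ, varX, varY) \<in> aut_triples \<xi>"
proof -
  have "pois 0 varZ varX varY" "pois 0 varY varZ varX"
    unfolding pois_exact jacobian3_def partial_\<Omega> partial_generators by (simp_all add: algebra_simps)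
  then have "exact_aut varZ varX varY varY varZ varX"
    by (simp add: exact_aut_def)
  moreover have "sub varZ varX varY \<Omega> = const3 1 * \<Omega>"
    unfolding \<Omega>_eq by (simp add: const3_simps(2) algebra_simps)
  ultimately show ?thesis
    using \<Omega>_shift_dvd_iff by (auto simp: aut_triples_def)
qed

lemma cubic_triple_in_aut_triples:
  assumes "(\<alpha>1, \<alpha>2, \<alpha>3) \<in> G_cubic \<xi>"
  shows "cubic_triple (i, \<alpha>1, \<alpha>2, \<alpha>3) \<in> aut_triples \<xi>"
proof -
  let ?D = "(const3 \<alpha>1 * varX, const3 \<alpha>2 * varY, const3 \<alpha>3 * varZ)" and ?s = "(varZ, varX, varY) :: 'k triple"
  note D = diagonal_in_aut_triples[OF assms]
  have "cubic_triple (i, \<alpha>1, \<alpha>2, \<alpha>3) = ?D \<or> cubic_triple (i, \<alpha>1, \<alpha>2, \<alpha>3) = compT ?D ?s \<or>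
      cubic_triple (i, \<alpha>1, \<alpha>2, \<alpha>3) = compT (compT ?D ?s) ?s"
    by (simp add: cubic_triple_def compT_def subT_def)
  then show ?thesis
    using D aut_triples_compT shift_in_aut_triples by metis
qed

lemma linear_form:
  fixes f :: "'k poly3"
  assumes "hom 1 f"
  obtains p q r where "f = const3 p * varX + const3 q * varY + const3 r * varZ"
proof
  have *: "i = 1 \<and> j = 0 \<and> k = 0 \<or> i = 0 \<and> j = 1 \<and> k = 0 \<or> i = 0 \<and> j = 0 \<and> k = 1" if "coeff3 f i j k \<noteq> 0" for i j k
  proof -
    have "int (1 * i + 1 * j + 1 * k) = 1"
      using assms that unfolding hom_iff by blast
    then show ?thesis by arith
  qed
  have "f = mon3 (coeff3 f 1 0 0) 1 0 0 + mon3 (coeff3 f 0 1 0) 0 1 0 + mon3 (coeff3 f 0 0 1) 0 0 1"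
  proof (rule poly3_eqI)
    show "coeff3 f i j k = coeff3 (mon3 (coeff3 f 1 0 0) 1 0 0 + mon3 (coeff3 f 0 1 0) 0 1 0 + mon3 (coeff3 f 0 0 1) 0 0 1) i j k" for i j k
      using *[of i j k] by (cases "coeff3 f i j k = 0") (auto simp: coeff3_mon3)
  qed
  then show "f = const3 (coeff3 f 1 0 0) * varX + const3 (coeff3 f 0 1 0) * varY + const3 (coeff3 f 0 0 1) * varZ"
    by (simp add: mon3_eq)
qed

text \<open>The triple is linear, so it is a matrix with rows a, b, c. The bracket relations provide
  the equations of \<open>cubic_monomial\<close>; the condition on lam says that
  \<open>\<kappa> ^ 3 \<noteq> 1\<close>.\<close>

lemma aut_triples_cubic:
  assumes T: "(X, Y, Z) \<in> aut_triples \<xi>"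
  shows "\<exists>i\<in>{0, 1, 2}. \<exists>\<alpha>\<in>G_cubic \<xi>. (X, Y, Z) = cubic_triple (i, \<alpha>)"
proof -
  obtain X' Y' Z' where ex: "exact_aut X Y Z X' Y' Z'"
    using T by (auto simp: aut_triples_def)
  have h: "hom 1 X" "hom 1 Y" "hom 1 Z"
    using aut_triples_hom[OF T] by simp_all
  obtain a1 a2 a3 where X: "X = const3 a1 * varX + const3 a2 * varY + const3 a3 * varZ"
    using linear_form[OF h(1)] by blast
  obtain b1 b2 b3 where Y: "Y = const3 b1 * varX + const3 b2 * varY + const3 b3 * varZ"
    using linear_form[OF h(2)] by blast
  obtain c1 c2 c3 where Z: "Z = const3 c1 * varX + const3 c2 * varY + const3 c3 * varZ"
    using linear_form[OF h(3)] by blast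
  have p: "jacobian3 X Y \<Omega> = sub X Y Z (partial_z \<Omega>)" "jacobian3 Y Z \<Omega> = sub X Y Z (partial_x \<Omega>)"
    "jacobian3 Z X \<Omega> = sub X Y Z (partial_y \<Omega>)"
    using ex by (simp_all add: exact_aut_def pois_exact)
  have id1: "(a1 * b2 - a2 * b1) * (3 * z^2 + lam * x * y) + (a2 * b3 - a3 * b2) * (3 * x^2 + lam * y * z)
      + (a3 * b1 - a1 * b3) * (3 * y^2 + lam * x * z)
    = 3 * (c1 * x + c2 * y + c3 * z)^2 + lam * (a1 * x + a2 * y + a3 * z) * (b1 * x + b2 * y + b3 * z)" for x y z
  proof -
    have "eval3 (jacobian3 X Y \<Omega>) x y z = eval3 (sub X Y Z (partial_z \<Omega>)) x y z"
      by (simp only: p)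
    then show ?thesis
      unfolding eval3_sub jacobian3_def partial_\<Omega> X Y Z partial_derivation partial_generators partial_const3
      by (simp add: algebra_simps)
  qed
  have id2: "(b1 * c2 - b2 * c1) * (3 * z^2 + lam * x * y) + (b2 * c3 - b3 * c2) * (3 * x^2 + lam * y * z)
      + (b3 * c1 - b1 * c3) * (3 * y^2 + lam * x * z)
    = 3 * (a1 * x + a2 * y + a3 * z)^2 + lam * (b1 * x + b2 * y + b3 * z) * (c1 * x + c2 * y + c3 * z)" for x y z
  proof -
    have "eval3 (jacobian3 Y Z \<Omega>) x y z = eval3 (sub X Y Z (partial_x \<Omega>)) x y z"
      by (simp only: p)
    then show ?thesis
      unfolding eval3_sub jacobian3_def partial_\<Omega> X Y Z partial_derivation partial_generators partial_const3
      by (simp add: algebra_simps)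
  qed
  have id3: "(c1 * a2 - c2 * a1) * (3 * z^2 + lam * x * y) + (c2 * a3 - c3 * a2) * (3 * x^2 + lam * y * z)
      + (c3 * a1 - c1 * a3) * (3 * y^2 + lam * x * z)
    = 3 * (b1 * x + b2 * y + b3 * z)^2 + lam * (c1 * x + c2 * y + c3 * z) * (a1 * x + a2 * y + a3 * z)" for x y z
  proof -
    have "eval3 (jacobian3 Z X \<Omega>) x y z = eval3 (sub X Y Z (partial_y \<Omega>)) x y z"
      by (simp only: p)
    then show ?thesis
      unfolding eval3_sub jacobian3_def partial_\<Omega> X Y Z partial_derivation partial_generators partial_const3
      by (simp add: algebra_simps)
  qed
  define \<kappa> where "\<kappa> = - lam / 3"
  note eq1 = cubic_coefficients[OF id1 \<kappa>_def]
  note eq2 = cubic_coefficients[OF id2 \<kappa>_def]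
  note eq3 = cubic_coefficients[OF id3 \<kappa>_def]
  obtain J where J: "J \<noteq> 0" "sub X Y Z \<Omega> = const3 J * \<Omega>" "jac_det X Y Z = const3 J"
    using sub_\<Omega>_exact_aut[OF ex] by blast
  have Jd: "J = a1 * (b2 * c3 - b3 * c2) - a2 * (b1 * c3 - b3 * c1) + a3 * (b1 * c2 - b2 * c1)"
    using arg_cong[OF J(3), of "\<lambda>f. eval3 f 0 0 0"]
    unfolding jac_det_def jacobian3_def X Y Z partial_derivation partial_generators partial_const3 by simp
  have J\<xi>: "(J - 1) * \<xi> = 0"
    using T \<Omega>_shift_dvd_iff[OF J(2)] by (simp add: aut_triples_def)
  have "\<kappa> ^ 3 \<noteq> 1"
  proof
    assume "\<kappa> ^ 3 = 1"
    have "- lam = 3 * \<kappa>"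
      by (simp add: \<kappa>_def)
    then have "(- lam) ^ 3 = (3 * \<kappa>) ^ 3"
      by (simp only:)
    also have "\<dots> = 27"
      using \<open>\<kappa> ^ 3 = 1\<close> by (simp add: power_mult_distrib)
    finally show False
      using lam by blast
  qed
  then consider "a2 = 0" "a3 = 0" "b1 = 0" "b3 = 0" "c1 = 0" "c2 = 0" |
    "a1 = 0" "a3 = 0" "b1 = 0" "b2 = 0" "c2 = 0" "c3 = 0" |
    "a1 = 0" "a2 = 0" "b2 = 0" "b3 = 0" "c1 = 0" "c3 = 0"
    using cubic_monomial[OF _ J(1)[unfolded Jd] eq1(1-3) eq2(1-3) eq3(1-3) eq2(4) eq3(6) eq1(5) eq2(5) eq3(4) eq1(6) eq2(6) eq3(5) eq1(4)] by blast
  then show ?thesis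
  proof cases
    case 1
    then have "(a1, b2, c3) \<in> G_cubic \<xi>"
      using Jd J(1) J\<xi> eq1(6) eq2(4) eq3(5) by (auto simp: G_cubic_iff mult_ac)
    moreover have "(X, Y, Z) = cubic_triple (0, a1, b2, c3)"
      using 1 by (simp add: X Y Z cubic_triple_def const3_simps(1))
    ultimately show ?thesis
      by blast
  next
    case 2
    \<comment> \<open>\<open>\<alpha>1\<close>, \<open>\<alpha>2\<close>, \<open>\<alpha>3\<close>
      are the scalars of x, y, z, so the surviving entries are listed by columns.\<close>
    then have "(c1, a2, b3) \<in> G_cubic \<xi>"
      using Jd J(1) J\<xi> eq1(4) eq2(5) eq3(6) by (auto simp: G_cubic_iff mult_ac)
    moreover have "(X, Y, Z) = cubic_triple (2, c1, a2, b3)"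
      using 2 by (simp add: X Y Z cubic_triple_def const3_simps(1))
    ultimately show ?thesis
      by blast
  next
    case 3
    then have "(b1, c2, a3) \<in> G_cubic \<xi>"
      using Jd J(1) J\<xi> eq3(4) eq1(5) eq2(6) by (auto simp: G_cubic_iff mult_ac)
    moreover have "(X, Y, Z) = cubic_triple (1, b1, c2, a3)"
      using 3 by (simp add: X Y Z cubic_triple_def const3_simps(1))
    ultimately show ?thesis
      by blast
  qed
qed

lemma bij_betw_cubic_triple: "bij_betw cubic_triple ({0, 1, 2} \<times> G_cubic \<xi>) (aut_triples \<xi>)"
  unfolding bij_betw_def
proof (intro conjI inj_onI equalityI subsetI)
  show "s = t" if "s \<in> {0, 1, 2} \<times> G_cubic \<xi>" "t \<in> {0, 1, 2} \<times> G_cubic \<xi>" "cubic_triple s = cubic_triple t" for s t :: "int \<times> 'k \<times> 'k \<times> 'k"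
    using that by (cases s; cases t)
      (auto simp: cubic_triple_def G_cubic_iff const3_def varX_def varY_def varZ_def split: if_splits)
  show "T \<in> aut_triples \<xi>" if "T \<in> cubic_triple ` ({0, 1, 2} \<times> G_cubic \<xi>)" for T
    using that cubic_triple_in_aut_triples by auto
  show "T \<in> cubic_triple ` ({0, 1, 2} \<times> G_cubic \<xi>)" if "T \<in> aut_triples \<xi>" for T
    using that aut_triples_cubic by (cases T) blast
qed

text \<open>Pulling a diagonal triple past a power of the shift permutes its scalars cyclically;
  this is the action in the semidirect product.\<close>

lemma cubic_triple_mult:
  assumes "h \<in> {0, 1, 2}" "h' \<in> {0, 1, 2}" "cyclic3 h (\<beta>1, \<beta>2, \<beta>3) = (\<gamma>1, \<gamma>2, \<gamma>3)"
  shows "cubic_triple ((h + h') mod 3, \<alpha>1 * \<gamma>1, \<alpha>2 * \<gamma>2, \<alpha>3 * \<gamma>3) =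
    compT (cubic_triple (h, \<alpha>1, \<alpha>2, \<alpha>3)) (cubic_triple (h', \<beta>1, \<beta>2, \<beta>3))"
  using assms by (auto simp: cubic_triple_def compT_def subT_def cyclic3_def const3_simps numeral_2_eq_2 mult_ac)

lemma cubic_groups:
  fixes N :: "('k \<times> 'k \<times> 'k) monoid"
  assumes N: "carrier N = G_cubic \<xi>" "one N = (1, 1, 1)"
    "\<And>\<alpha>1 \<alpha>2 \<alpha>3 \<beta>1 \<beta>2 \<beta>3. monoid.mult N (\<alpha>1, \<alpha>2, \<alpha>3) (\<beta>1, \<beta>2, \<beta>3) = (\<alpha>1 * \<beta>1, \<alpha>2 * \<beta>2, \<alpha>3 * \<beta>3)"
  shows "AutP (P_Omega \<Omega> \<xi>) \<cong> semidirect (integer_mod_group 3) N cyclic3"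
    "short_exact N (AutP (P_Omega \<Omega> \<xi>)) (integer_mod_group 3)"
proof -
  have c: "carrier (integer_mod_group 3) = {0, 1, 2}"
    by (auto simp: carrier_integer_mod_group)
  have cy: "\<exists>\<gamma>1 \<gamma>2 \<gamma>3. cyclic3 h \<beta> = (\<gamma>1, \<gamma>2, \<gamma>3) \<and> (\<gamma>1, \<gamma>2, \<gamma>3) \<in> G_cubic \<xi>"
    if "h \<in> {0, 1, 2}" "\<beta> \<in> G_cubic \<xi>" for h \<beta>
    using that by (cases \<beta>) (auto simp: cyclic3_def G_cubic_iff numeral_2_eq_2 mult_ac)
  have G: "(\<alpha>1 * \<beta>1, \<alpha>2 * \<beta>2, \<alpha>3 * \<beta>3) \<in> G_cubic \<xi>"
    if g: "(\<alpha>1, \<alpha>2, \<alpha>3) \<in> G_cubic \<xi>" "(\<beta>1, \<beta>2, \<beta>3) \<in> G_cubic \<xi>" for \<alpha>1 \<alpha>2 \<alpha>3 \<beta>1 \<beta>2 \<beta>3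
  proof -
    have "(\<alpha>1 * \<beta>1 * (\<alpha>2 * \<beta>2) * (\<alpha>3 * \<beta>3) - 1) * \<xi> =
        \<alpha>1 * \<alpha>2 * \<alpha>3 * ((\<beta>1 * \<beta>2 * \<beta>3 - 1) * \<xi>) + (\<alpha>1 * \<alpha>2 * \<alpha>3 - 1) * \<xi>"
      by (simp add: algebra_simps)
    also have "\<dots> = 0"
      using g by (auto simp: G_cubic_iff)
    finally show ?thesis
      using g by (simp add: G_cubic_iff power_mult_distrib mult_ac)
  qed
  have bij: "bij_betw cubic_triple (carrier (integer_mod_group 3) \<times> carrier N) (aut_triples \<xi>)"
    using bij_betw_cubic_triple by (simp add: c N)
  have m: "cubic_triple (h \<otimes>\<^bsub>integer_mod_group 3\<^esub> h', n \<otimes>\<^bsub>N\<^esub> cyclic3 h n') = compT (cubic_triple (h, n)) (cubic_triple (h', n'))"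
    if "h \<in> carrier (integer_mod_group 3)" "n \<in> carrier N" "h' \<in> carrier (integer_mod_group 3)" "n' \<in> carrier N" for h n h' n'
  proof -
    obtain \<gamma>1 \<gamma>2 \<gamma>3 where "cyclic3 h n' = (\<gamma>1, \<gamma>2, \<gamma>3)"
      using cy[of h n'] \<open>h \<in> _\<close> \<open>n' \<in> _\<close> by (auto simp: c N)
    then show ?thesis
      using \<open>h \<in> _\<close> \<open>h' \<in> _\<close> cubic_triple_mult[of h h'] by (cases n; cases n') (simp add: c N)
  qed
  have cl: "n \<otimes>\<^bsub>N\<^esub> cyclic3 h n' \<in> carrier N"
    if "h \<in> carrier (integer_mod_group 3)" "n \<in> carrier N" "n' \<in> carrier N" for h n n'
    using cy[of h n'] that G by (cases n) (auto simp: c N)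
  have H: "h \<otimes>\<^bsub>integer_mod_group 3\<^esub> h' \<in> carrier (integer_mod_group 3)" for h h'
    by (simp add: carrier_integer_mod_group)
  have o: "\<one>\<^bsub>N\<^esub> \<in> carrier N"
    by (simp add: N G_cubic_iff)
  have \<phi>: "cyclic3 \<one>\<^bsub>integer_mod_group 3\<^esub> n = n" for n :: "'k \<times> 'k \<times> 'k"
    by (simp add: cyclic3_def)
  note S = semidirect_iso_AutP_P[where \<Phi> = cubic_triple, OF bij m]
  show "AutP (P_Omega \<Omega> \<xi>) \<cong> semidirect (integer_mod_group 3) N cyclic3"
    by (rule S(1); (rule H cl o \<phi> | simp add: carrier_integer_mod_group))
  show "short_exact N (AutP (P_Omega \<Omega> \<xi>)) (integer_mod_group 3)"
    by (rule S(2); (rule H cl o \<phi> | simp add: carrier_integer_mod_group))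
qed

end


text \<open>A diagonal triple multiplies \<Omega> by \<open>(\<alpha>1 * \<alpha>2)^2\<close>. As
  \<open>\<alpha>1^2 = \<alpha>2^2\<close>, this equals both fourth powers, which identifies the set
  for \<xi> = 1 with the carrier of \<open>G'_112\<close>.\<close>

definition G_quartic :: "'k::field \<Rightarrow> ('k \<times> 'k) set" where
  "G_quartic \<xi> = {(\<alpha>1, \<alpha>2). \<alpha>1 \<noteq> 0 \<and> \<alpha>2 \<noteq> 0 \<and> \<alpha>1^2 = \<alpha>2^2 \<and> ((\<alpha>1 * \<alpha>2)^2 - 1) * \<xi> = 0}"

text \<open>
  The triple of \<open>n h\<^sup>i\<close> for \<open>n = (\<alpha>1, \<alpha>2)\<close> and \<open>h\<close> the involution
  \<open>x \<mapsto> y, y \<mapsto> x, z \<mapsto> -z - \<lambda> x y\<close>.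
\<close>
definition quartic_triple :: "'k \<Rightarrow> int \<times> 'k \<times> 'k \<Rightarrow> 'k::comm_ring_1 triple" where
  "quartic_triple lam t = (case t of (i, \<alpha>1, \<alpha>2) \<Rightarrow>
     if i = 0 then (const3 \<alpha>1 * varX, const3 \<alpha>2 * varY, const3 (\<alpha>1 * \<alpha>2) * varZ)
     else (const3 \<alpha>2 * varY, const3 \<alpha>1 * varX,
       - (const3 (\<alpha>1 * \<alpha>2) * varZ) - const3 (lam * \<alpha>1 * \<alpha>2) * varX * varY))"

section \<open>Weights (1, 1, 2): automorphisms for the quartic\<close>

locale quartic = potential 1 1 2 \<Omega> for \<Omega> :: "'k::{alg_closed_field, field_char_0} poly3" +
  fixes lam :: 'k
  assumes \<Omega>_eq: "\<Omega> = varX ^ 4 + varY ^ 4 + varZ ^ 2 + const3 lam * varX * varY * varZ"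
    and lam: "(- lam) ^ 4 \<noteq> 64"
begin

lemma partial_\<Omega>:
  "partial_x \<Omega> = const3 4 * varX ^ 3 + const3 lam * varY * varZ"
  "partial_y \<Omega> = const3 4 * varY ^ 3 + const3 lam * varX * varZ"
  "partial_z \<Omega> = const3 2 * varZ + const3 lam * varX * varY"
  unfolding \<Omega>_eq power4_eq_xxxx power3_eq_cube power2_eq_square
  by (simp_all add: partial_derivation partial_generators const3_numeral algebra_simps)

lemma pois_diagonal:
  assumes "\<alpha>1^2 = \<alpha>2^2"
  shows "pois 0 (const3 \<alpha>1 * varX) (const3 \<alpha>2 * varY) (const3 (\<alpha>1 * \<alpha>2) * varZ)"
proof -
  have e: "const3 \<alpha>1 * const3 \<alpha>1 = const3 \<alpha>2 * const3 \<alpha>2"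
    using assms by (simp only: const3_simps(6)[symmetric] power2_eq_square)
  have c: "(const3 \<alpha>1 * f) ^ 3 = const3 \<alpha>1 * (const3 \<alpha>2 * const3 \<alpha>2) * f ^ 3"
    "(const3 \<alpha>2 * f) ^ 3 = const3 \<alpha>2 * (const3 \<alpha>1 * const3 \<alpha>1) * f ^ 3" for f
    unfolding e[symmetric] power_mult_distrib by (simp_all only: e[symmetric] power3_eq_cube mult_ac)
  show ?thesis
    unfolding pois_exact jacobian3_def partial_\<Omega> partial_derivation partial_generators partial_const3
      sub_simps c const3_simps(6)
    by (simp add: algebra_simps)
qed

lemma diagonal_in_aut_triples:
  assumes "(\<alpha>1, \<alpha>2) \<in> G_quartic \<xi>"
  shows "(const3 \<alpha>1 * varX, const3 \<alpha>2 * varY, const3 (\<alpha>1 * \<alpha>2) * varZ) \<in> aut_triples \<xi>"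
proof -
  have nz: "\<alpha>1 \<noteq> 0" "\<alpha>2 \<noteq> 0" "\<alpha>1 * \<alpha>2 \<noteq> 0" and e: "\<alpha>1^2 = \<alpha>2^2" and \<xi>: "((\<alpha>1 * \<alpha>2)^2 - 1) * \<xi> = 0"
    using assms by (auto simp: G_quartic_def)
  have i: "const3 \<alpha> * (const3 (1 / \<alpha>) * f) = f" "const3 (1 / \<alpha>) * (const3 \<alpha> * f) = f" if "\<alpha> \<noteq> 0" for \<alpha> :: 'k and f
    using that by (simp_all add: mult.assoc[symmetric] const3_simps(6)[symmetric] const3_simps(2))
  have "pois 0 (const3 (1 / \<alpha>1) * varX) (const3 (1 / \<alpha>2) * varY) (const3 (1 / \<alpha>1 * (1 / \<alpha>2)) * varZ)"
    by (rule pois_diagonal) (use e in \<open>simp add: power_divide\<close>)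
  then have "pois 0 (const3 (1 / \<alpha>1) * varX) (const3 (1 / \<alpha>2) * varY) (const3 (1 / (\<alpha>1 * \<alpha>2)) * varZ)"
    by simp
  then have "exact_aut (const3 \<alpha>1 * varX) (const3 \<alpha>2 * varY) (const3 (\<alpha>1 * \<alpha>2) * varZ)
      (const3 (1 / \<alpha>1) * varX) (const3 (1 / \<alpha>2) * varY) (const3 (1 / (\<alpha>1 * \<alpha>2)) * varZ)"
    using pois_diagonal[OF e] i[OF nz(1)] i[OF nz(2)] i[OF nz(3)] unfolding exact_aut_def sub_simps by blast
  moreover have "sub (const3 \<alpha>1 * varX) (const3 \<alpha>2 * varY) (const3 (\<alpha>1 * \<alpha>2) * varZ) \<Omega> = const3 ((\<alpha>1 * \<alpha>2)^2) * \<Omega>"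
  proof -
    have p4: "\<alpha>1 ^ 4 = \<alpha>1^2 * \<alpha>1^2" "\<alpha>2 ^ 4 = \<alpha>2^2 * \<alpha>2^2"
      by (simp_all flip: power_add)
    have "\<alpha>1 ^ 4 = (\<alpha>1 * \<alpha>2)^2" "\<alpha>2 ^ 4 = (\<alpha>1 * \<alpha>2)^2"
      unfolding p4 power_mult_distrib by (simp_all only: e)
    then have "const3 \<alpha>1 ^ 4 = const3 ((\<alpha>1 * \<alpha>2)^2)" "const3 \<alpha>2 ^ 4 = const3 ((\<alpha>1 * \<alpha>2)^2)"
      by (metis const3_power)+
    then show ?thesis
      unfolding \<Omega>_eq sub_simps power_mult_distrib[of "const3 _"]
      by (simp add: const3_power const3_simps(6) power2_eq_square algebra_simps)
  qed
  ultimately show ?thesis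
    using \<Omega>_shift_dvd_iff \<xi> by (auto simp: aut_triples_def)
qed

text \<open>Exchanging x and y reverses {x, y}, so 2 z + lam x y has to change its sign; this
  dictates the image of z.\<close>

lemma swap_in_aut_triples: "(varY, varX, - varZ - const3 lam * varX * varY) \<in> aut_triples \<xi>"
proof -
  have "pois 0 varY varX (- varZ - const3 lam * varX * varY)"
    unfolding pois_exact jacobian3_def partial_\<Omega> partial_minus partial_derivation partial_generators partial_const3 sub_simps
    by (simp add: const3_numeral power2_eq_square algebra_simps)
  then have "exact_aut varY varX (- varZ - const3 lam * varX * varY) varY varX (- varZ - const3 lam * varX * varY)"
    by (simp add: exact_aut_def mult_ac)
  moreover have "sub varY varX (- varZ - const3 lam * varX * varY) \<Omega> = const3 1 * \<Omega>"
    unfolding \<Omega>_eq by (simp add: const3_simps(2) power2_eq_square algebra_simps)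
  ultimately show ?thesis
    using \<Omega>_shift_dvd_iff by (auto simp: aut_triples_def)
qed

lemma quartic_triple_in_aut_triples:
  assumes "(\<alpha>1, \<alpha>2) \<in> G_quartic \<xi>"
  shows "quartic_triple lam (i, \<alpha>1, \<alpha>2) \<in> aut_triples \<xi>"
proof -
  let ?D = "(const3 \<alpha>1 * varX, const3 \<alpha>2 * varY, const3 (\<alpha>1 * \<alpha>2) * varZ)"
    and ?s = "(varY, varX, - varZ - const3 lam * varX * varY) :: 'k triple"
  note D = diagonal_in_aut_triples[OF assms]
  have "quartic_triple lam (i, \<alpha>1, \<alpha>2) = ?D \<or> quartic_triple lam (i, \<alpha>1, \<alpha>2) = compT ?D ?s"
    by (simp add: quartic_triple_def compT_def subT_def const3_simps mult_ac)
  then show ?thesis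
    using D aut_triples_compT[OF D swap_in_aut_triples] by metis
qed

lemma linear_form:
  fixes f :: "'k poly3"
  assumes "hom 1 f"
  obtains p q where "f = const3 p * varX + const3 q * varY"
proof
  have *: "i = 1 \<and> j = 0 \<and> k = 0 \<or> i = 0 \<and> j = 1 \<and> k = 0" if "coeff3 f i j k \<noteq> 0" for i j k
  proof -
    have "int (1 * i + 1 * j + 2 * k) = 1"
      using assms that unfolding hom_iff by blast
    then show ?thesis by arith
  qed
  have "f = mon3 (coeff3 f 1 0 0) 1 0 0 + mon3 (coeff3 f 0 1 0) 0 1 0"
  proof (rule poly3_eqI)
    show "coeff3 f i j k = coeff3 (mon3 (coeff3 f 1 0 0) 1 0 0 + mon3 (coeff3 f 0 1 0) 0 1 0) i j k" for i j k
      using *[of i j k] by (cases "coeff3 f i j k = 0") (auto simp: coeff3_mon3)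
  qed
  then show "f = const3 (coeff3 f 1 0 0) * varX + const3 (coeff3 f 0 1 0) * varY"
    by (simp add: mon3_eq)
qed

lemma aut_triples_quartic:
  assumes T: "(X, Y, Z) \<in> aut_triples \<xi>"
  shows "\<exists>i\<in>{0, 1}. \<exists>\<alpha>\<in>G_quartic \<xi>. (X, Y, Z) = quartic_triple lam (i, \<alpha>)"
proof -
  obtain X' Y' Z' where ex: "exact_aut X Y Z X' Y' Z'"
    using T by (auto simp: aut_triples_def)
  have h: "hom 1 X" "hom 1 Y"
    using aut_triples_hom[OF T] by simp_all
  obtain p q where X: "X = const3 p * varX + const3 q * varY"
    using linear_form[OF h(1)] by blast
  obtain r s where Y: "Y = const3 r * varX + const3 s * varY"
    using linear_form[OF h(2)] by blast
  define D where "D = p * s - q * r"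
  have "jacobian3 X Y \<Omega> = sub X Y Z (partial_z \<Omega>)"
    using ex by (simp add: exact_aut_def pois_exact)
  moreover have "jacobian3 X Y \<Omega> = const3 D * partial_z \<Omega>"
    unfolding jacobian3_def X Y partial_derivation partial_generators partial_const3 D_def
    by (simp add: const3_simps algebra_simps)
  \<comment> \<open>The relation for {X, Y} contains Z only through 2 * Z, so X and Y determine
    Z.\<close>
  ultimately have Z2: "const3 2 * Z = const3 D * (const3 2 * varZ + const3 lam * varX * varY) - const3 lam * X * Y"
    by (simp add: partial_\<Omega>)
  have Zev: "2 * eval3 Z x y z = D * (2 * z + lam * x * y) - lam * (p * x + q * y) * (r * x + s * y)" for x y z
    using arg_cong[OF Z2, of "\<lambda>f. eval3 f x y z"] by (simp add: X Y)
  obtain J where J: "J \<noteq> 0" "sub X Y Z \<Omega> = const3 J * \<Omega>"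
    using sub_\<Omega>_exact_aut[OF ex] by blast
  have \<Omega>ev: "(p * x + q * y)^4 + (r * x + s * y)^4 + (eval3 Z x y z)^2 + lam * (p * x + q * y) * (r * x + s * y) * eval3 Z x y z
      = J * (x^4 + y^4 + z^2 + lam * x * y * z)" for x y z
    using arg_cong[OF J(2), of "\<lambda>f. eval3 f x y z"] unfolding eval3_sub by (simp add: \<Omega>_eq X Y)
  have "eval3 Z 0 0 1 = D"
    using Zev[of 0 0 1] by simp
  then have JD: "J = D^2"
    using \<Omega>ev[of 0 0 1] by simp
  have D: "p * s - q * r \<noteq> 0"
    using J(1) JD by (auto simp: D_def)
  \<comment> \<open>Completing the square, 4 \<Omega> = 4 (x^4 + y^4 + m x^2 y^2) + (2 z + lam x
    y)^2. The square is multiplied by D^2 and so is \<Omega>, hence also the binary quartic. The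
    value m^2 = 4 would mean lam^4 = 64.\<close>
  define m where "m = - (lam^2) / 4"
  have m: "m^2 \<noteq> 4"
  proof
    assume "m^2 = 4"
    then have "(- lam) ^ 4 = 64"
      by (simp add: m_def power_divide field_simps)
    then show False
      using lam by blast
  qed
  have F: "(p * x + q * y)^4 + (r * x + s * y)^4 + m * (p * x + q * y)^2 * (r * x + s * y)^2
       = (p * s - q * r)^2 * (x^4 + y^4 + m * x^2 * y^2)" for x y
  proof -
    define U V W where "U = p * x + q * y" and "V = r * x + s * y" and "W = eval3 Z x y 0"
    have 1: "2 * W + lam * U * V = D * lam * x * y"
      using Zev[of x y 0] by (simp add: U_def V_def W_def)
    have 2: "U^4 + V^4 + W^2 + lam * U * V * W = D^2 * (x^4 + y^4)"
      using \<Omega>ev[of x y 0] by (simp add: U_def V_def W_def JD)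
    have l: "lam^2 = - 4 * m"
      by (simp add: m_def)
    have "4 * (U^4 + V^4 + W^2 + lam * U * V * W) = 4 * U^4 + 4 * V^4 + (2 * W + lam * U * V)^2 - lam^2 * U^2 * V^2"
      by (simp add: power2_eq_square algebra_simps)
    then have "4 * (D^2 * (x^4 + y^4)) = 4 * U^4 + 4 * V^4 + (D * lam * x * y)^2 - lam^2 * U^2 * V^2"
      by (simp only: 1 2)
    then have "4 * (D^2 * (x^4 + y^4)) = 4 * U^4 + 4 * V^4 + D^2 * (- 4 * m) * x^2 * y^2 - (- 4 * m) * U^2 * V^2"
      by (simp only: power_mult_distrib l)
    then have "4 * (U^4 + V^4 + m * U^2 * V^2) = 4 * (D^2 * (x^4 + y^4 + m * x^2 * y^2))"
      by (simp add: algebra_simps)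
    moreover have "4 * u = 4 * v \<Longrightarrow> u = v" for u v :: 'k
      by simp
    ultimately have "U^4 + V^4 + m * U^2 * V^2 = D^2 * (x^4 + y^4 + m * x^2 * y^2)"
      by blast
    then show ?thesis
      by (simp add: U_def V_def D_def)
  qed
  have pr: "p * r = 0"
    by (rule quartic_hessian[OF D m F])
  \<comment> \<open>The same argument after exchanging x and y, that is, for the coefficient of the
    Hessian at y^4.\<close>
  have "q * s = 0"
  proof (rule quartic_hessian[OF _ m])
    show "q * r - p * s \<noteq> 0"
      using D by auto
    show "(q * x + p * y)^4 + (s * x + r * y)^4 + m * (q * x + p * y)^2 * (s * x + r * y)^2
       = (q * r - p * s)^2 * (x^4 + y^4 + m * x^2 * y^2)" for x y
      using F[of y x] by (simp add: power2_commute[of "q * r"] mult_ac add_ac)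
  qed
  then consider "q = 0" "r = 0" | "p = 0" "s = 0"
    using pr D by auto
  then show ?thesis
  proof cases
    case 1
    have "p^4 = (p * s)^2"
      using F[of 1 0] 1 by simp
    then have "p^2 * p^2 = p^2 * s^2"
      by (simp add: power_mult_distrib flip: power_add)
    then have "p^2 = 0 \<or> p^2 = s^2"
      by (simp only: mult_cancel_left)
    moreover have "p \<noteq> 0"
      using D 1 by auto
    ultimately have "p^2 = s^2"
      by simp
    moreover have "((p * s)^2 - 1) * \<xi> = 0"
      using T \<Omega>_shift_dvd_iff[OF J(2)] 1 by (simp add: aut_triples_def JD D_def)
    ultimately have "(p, s) \<in> G_quartic \<xi>"
      using D 1 by (auto simp: G_quartic_def)
    moreover have "const3 2 * Z = const3 2 * (const3 (p * s) * varZ)"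
      unfolding Z2 X Y using 1 by (simp add: D_def const3_simps algebra_simps)
    then have "Z = const3 (p * s) * varZ"
      by simp
    then have "(X, Y, Z) = quartic_triple lam (0, p, s)"
      using 1 by (simp add: X Y quartic_triple_def const3_simps(1))
    ultimately show ?thesis
      by blast
  next
    case 2
    have "r^4 = (q * r)^2"
      using F[of 1 0] 2 by simp
    then have "r^2 * r^2 = r^2 * q^2"
      by (simp add: power_mult_distrib mult.commute flip: power_add)
    then have "r^2 = 0 \<or> r^2 = q^2"
      by (simp only: mult_cancel_left)
    moreover have "r \<noteq> 0"
      using D 2 by auto
    ultimately have "r^2 = q^2"
      by simp
    moreover have "((r * q)^2 - 1) * \<xi> = 0"
      using T \<Omega>_shift_dvd_iff[OF J(2)] 2 by (simp add: aut_triples_def JD D_def mult.commute)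
    ultimately have "(r, q) \<in> G_quartic \<xi>"
      using D 2 by (auto simp: G_quartic_def)
    moreover have "const3 2 * Z = const3 2 * (- (const3 (r * q) * varZ) - const3 (lam * r * q) * varX * varY)"
      unfolding Z2 X Y using 2 by (simp add: D_def const3_numeral const3_simps algebra_simps)
    then have "Z = - (const3 (r * q) * varZ) - const3 (lam * r * q) * varX * varY"
      by (simp only: mult_cancel_left const3_eq_iff) simp
    then have "(X, Y, Z) = quartic_triple lam (1, r, q)"
      using 2 by (simp add: X Y quartic_triple_def const3_simps(1))
    ultimately show ?thesis
      by blast
  qed
qed

lemma bij_betw_quartic_triple: "bij_betw (quartic_triple lam) ({0, 1} \<times> G_quartic \<xi>) (aut_triples \<xi>)"
  unfolding bij_betw_def
proof (intro conjI inj_onI equalityI subsetI)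
  show "s = t" if "s \<in> {0, 1} \<times> G_quartic \<xi>" "t \<in> {0, 1} \<times> G_quartic \<xi>" "quartic_triple lam s = quartic_triple lam t" for s t :: "int \<times> 'k \<times> 'k"
    using that by (cases s; cases t)
      (auto simp: quartic_triple_def G_quartic_def const3_def varX_def varY_def varZ_def split: if_splits)
  show "T \<in> aut_triples \<xi>" if "T \<in> quartic_triple lam ` ({0, 1} \<times> G_quartic \<xi>)" for T
    using that quartic_triple_in_aut_triples by auto
  show "T \<in> quartic_triple lam ` ({0, 1} \<times> G_quartic \<xi>)" if "T \<in> aut_triples \<xi>" for T
    using that aut_triples_quartic by (cases T) blast
qed

lemma quartic_triple_mult:
  assumes "h \<in> {0, 1}" "h' \<in> {0, 1}" "cyclic2 h (\<beta>1, \<beta>2) = (\<gamma>1, \<gamma>2)"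
  shows "quartic_triple lam ((h + h') mod 2, \<alpha>1 * \<gamma>1, \<alpha>2 * \<gamma>2) =
    compT (quartic_triple lam (h, \<alpha>1, \<alpha>2)) (quartic_triple lam (h', \<beta>1, \<beta>2))"
  using assms by (auto simp: quartic_triple_def compT_def subT_def cyclic2_def const3_simps algebra_simps)

lemma quartic_groups:
  fixes N :: "('k \<times> 'k) monoid"
  assumes N: "carrier N = G_quartic \<xi>" "one N = (1, 1)"
    "\<And>\<alpha>1 \<alpha>2 \<beta>1 \<beta>2. monoid.mult N (\<alpha>1, \<alpha>2) (\<beta>1, \<beta>2) = (\<alpha>1 * \<beta>1, \<alpha>2 * \<beta>2)"
  shows "AutP (P_Omega \<Omega> \<xi>) \<cong> semidirect (integer_mod_group 2) N cyclic2"
    "short_exact N (AutP (P_Omega \<Omega> \<xi>)) (integer_mod_group 2)"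
proof -
  have c: "carrier (integer_mod_group 2) = {0, 1}"
    by (auto simp: carrier_integer_mod_group)
  have cy: "\<exists>\<gamma>1 \<gamma>2. cyclic2 h \<beta> = (\<gamma>1, \<gamma>2) \<and> (\<gamma>1, \<gamma>2) \<in> G_quartic \<xi>"
    if "h \<in> {0, 1}" "\<beta> \<in> G_quartic \<xi>" for h \<beta>
    using that by (cases \<beta>) (auto simp: cyclic2_def G_quartic_def mult_ac)
  have G: "(\<alpha>1 * \<beta>1, \<alpha>2 * \<beta>2) \<in> G_quartic \<xi>"
    if g: "(\<alpha>1, \<alpha>2) \<in> G_quartic \<xi>" "(\<beta>1, \<beta>2) \<in> G_quartic \<xi>" for \<alpha>1 \<alpha>2 \<beta>1 \<beta>2
  proof -
    have "((\<alpha>1 * \<beta>1 * (\<alpha>2 * \<beta>2))^2 - 1) * \<xi> =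
        (\<alpha>1 * \<alpha>2)^2 * (((\<beta>1 * \<beta>2)^2 - 1) * \<xi>) + ((\<alpha>1 * \<alpha>2)^2 - 1) * \<xi>"
      by (simp add: power_mult_distrib algebra_simps)
    also have "\<dots> = 0"
      using g by (auto simp: G_quartic_def)
    finally show ?thesis
      using g by (simp add: G_quartic_def power_mult_distrib)
  qed
  have bij: "bij_betw (quartic_triple lam) (carrier (integer_mod_group 2) \<times> carrier N) (aut_triples \<xi>)"
    using bij_betw_quartic_triple by (simp add: c N)
  have m: "quartic_triple lam (h \<otimes>\<^bsub>integer_mod_group 2\<^esub> h', n \<otimes>\<^bsub>N\<^esub> cyclic2 h n') =
      compT (quartic_triple lam (h, n)) (quartic_triple lam (h', n'))"
    if "h \<in> carrier (integer_mod_group 2)" "n \<in> carrier N" "h' \<in> carrier (integer_mod_group 2)" "n' \<in> carrier N" for h n h' n'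
  proof -
    obtain \<gamma>1 \<gamma>2 where "cyclic2 h n' = (\<gamma>1, \<gamma>2)"
      using cy[of h n'] \<open>h \<in> _\<close> \<open>n' \<in> _\<close> by (auto simp: c N)
    then show ?thesis
      using \<open>h \<in> _\<close> \<open>h' \<in> _\<close> quartic_triple_mult[of h h'] by (cases n; cases n') (simp add: c N)
  qed
  have cl: "n \<otimes>\<^bsub>N\<^esub> cyclic2 h n' \<in> carrier N"
    if "h \<in> carrier (integer_mod_group 2)" "n \<in> carrier N" "n' \<in> carrier N" for h n n'
    using cy[of h n'] that G by (cases n) (auto simp: c N)
  have H: "h \<otimes>\<^bsub>integer_mod_group 2\<^esub> h' \<in> carrier (integer_mod_group 2)" for h h'
    by (simp add: carrier_integer_mod_group)
  have o: "\<one>\<^bsub>N\<^esub> \<in> carrier N"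
    by (simp add: N G_quartic_def)
  have \<phi>: "cyclic2 \<one>\<^bsub>integer_mod_group 2\<^esub> n = n" for n :: "'k \<times> 'k"
    by (simp add: cyclic2_def)
  note S = semidirect_iso_AutP_P[where \<Phi> = "quartic_triple lam", OF bij m]
  show "AutP (P_Omega \<Omega> \<xi>) \<cong> semidirect (integer_mod_group 2) N cyclic2"
    by (rule S(1); (rule H cl o \<phi> | simp add: carrier_integer_mod_group))
  show "short_exact N (AutP (P_Omega \<Omega> \<xi>)) (integer_mod_group 2)"
    by (rule S(2); (rule H cl o \<phi> | simp add: carrier_integer_mod_group))
qed

end

section \<open>Weights (1, 2, 3): automorphisms for the sextic\<close>

locale sextic = potential 1 2 3 \<Omega> for \<Omega> :: "'k::{alg_closed_field, field_char_0} poly3" +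
  fixes lam :: 'k
  assumes \<Omega>_eq: "\<Omega> = varX ^ 6 + varY ^ 3 + varZ ^ 2 + const3 lam * varX * varY * varZ"
begin

lemma partial_\<Omega>:
  "partial_y \<Omega> = const3 3 * varY ^ 2 + const3 lam * varX * varZ"
  "partial_z \<Omega> = const3 2 * varZ + const3 lam * varX * varY"
proof -
  have x6: "varX ^ 6 = (varX * varX * varX) * (varX * varX * varX :: 'k poly3)"
    by (simp add: eval_nat_numeral)
  show "partial_y \<Omega> = const3 3 * varY ^ 2 + const3 lam * varX * varZ"
    "partial_z \<Omega> = const3 2 * varZ + const3 lam * varX * varY"
    unfolding \<Omega>_eq x6 power3_eq_cube power2_eq_square
    by (simp_all add: partial_derivation partial_generators const3_numeral algebra_simps)
qed

lemma form_1:
  fixes f :: "'k poly3"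
  assumes "hom 1 f"
  obtains p where "f = const3 p * varX"
proof
  have *: "i = 1 \<and> j = 0 \<and> k = 0" if "coeff3 f i j k \<noteq> 0" for i j k
  proof -
    have "int (1 * i + 2 * j + 3 * k) = 1"
      using assms that unfolding hom_iff by blast
    then show ?thesis by arith
  qed
  have "f = mon3 (coeff3 f 1 0 0) 1 0 0"
  proof (rule poly3_eqI)
    show "coeff3 f i j k = coeff3 (mon3 (coeff3 f 1 0 0) 1 0 0) i j k" for i j k
      using *[of i j k] by (cases "coeff3 f i j k = 0") (auto simp: coeff3_mon3)
  qed
  then show "f = const3 (coeff3 f 1 0 0) * varX"
    by (simp add: mon3_eq)
qed

lemma form_2:
  fixes f :: "'k poly3"
  assumes "hom 2 f"
  obtains p q where "f = const3 p * varY + const3 q * varX ^ 2"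
proof
  have *: "i = 0 \<and> j = 1 \<and> k = 0 \<or> i = 2 \<and> j = 0 \<and> k = 0" if "coeff3 f i j k \<noteq> 0" for i j k
  proof -
    have "int (1 * i + 2 * j + 3 * k) = 2"
      using assms that unfolding hom_iff by blast
    then show ?thesis by arith
  qed
  have "f = mon3 (coeff3 f 0 1 0) 0 1 0 + mon3 (coeff3 f 2 0 0) 2 0 0"
  proof (rule poly3_eqI)
    show "coeff3 f i j k = coeff3 (mon3 (coeff3 f 0 1 0) 0 1 0 + mon3 (coeff3 f 2 0 0) 2 0 0) i j k" for i j k
      using *[of i j k] by (cases "coeff3 f i j k = 0") (auto simp: coeff3_mon3)
  qed
  then show "f = const3 (coeff3 f 0 1 0) * varY + const3 (coeff3 f 2 0 0) * varX ^ 2"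
    by (simp add: mon3_eq)
qed

text \<open>For reasons of degree X is a multiple of x, and Y is a combination of y and x^2. The
  relation for {X, Y} then determines Z, and the one for {Z, X} fixes the scalar of y and removes
  the term x^2.\<close>

lemma aut_triples_sextic:
  assumes T: "(X, Y, Z) \<in> aut_triples \<xi>"
  shows "\<exists>\<zeta>. \<zeta> \<noteq> 0 \<and> X = const3 \<zeta> * varX \<and> Y = const3 (\<zeta> ^ 2) * varY \<and> Z = const3 (\<zeta> ^ 3) * varZ \<and>
    (\<zeta> ^ 6 - 1) * \<xi> = 0"
proof -
  obtain X' Y' Z' where ex: "exact_aut X Y Z X' Y' Z'"
    using T by (auto simp: aut_triples_def)
  have h: "hom 1 X" "hom 2 Y"
    using aut_triples_hom[OF T] by simp_all
  obtain p where X: "X = const3 p * varX"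
    using form_1[OF h(1)] by blast
  obtain q r where Y: "Y = const3 q * varY + const3 r * (varX * varX)"
    using form_2[OF h(2)] by (metis power2_eq_square)
  have jz: "jacobian3 X Y \<Omega> = sub X Y Z (partial_z \<Omega>)" and jy: "jacobian3 Z X \<Omega> = sub X Y Z (partial_y \<Omega>)"
    using ex by (simp_all add: exact_aut_def pois_exact)
  have "jacobian3 X Y \<Omega> = const3 (p * q) * partial_z \<Omega>"
    unfolding jacobian3_def X Y partial_derivation partial_generators partial_const3
    by (simp add: const3_simps algebra_simps)
  then have "const3 2 * Z = const3 (p * q) * (const3 2 * varZ + const3 lam * varX * varY) - const3 lam * X * Y"
    using jz by (simp add: partial_\<Omega> eq_diff_eq)
  also have "\<dots> = const3 2 * (const3 (p * q) * varZ - const3 (lam * p * r / 2) * (varX * varX * varX))"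
    unfolding X Y by (simp add: const3_simps algebra_simps flip: const3_simps(6))
  finally have Z: "Z = const3 (p * q) * varZ - const3 (lam * p * r / 2) * (varX * varX * varX)"
    by (simp only: mult_cancel_left const3_eq_iff) simp
  have "jacobian3 Z X \<Omega> = const3 (p * q * p) * partial_y \<Omega>"
    unfolding jacobian3_def X Z partial_minus partial_derivation partial_generators partial_const3
    by (simp add: const3_simps algebra_simps)
  then have e: "const3 (p * q * p) * partial_y \<Omega> = sub X Y Z (partial_y \<Omega>)"
    using jy by simp
  have ev: "p * q * p * (3 * y^2 + lam * x * z) = 3 * (q * y + r * x^2)^2 + lam * (p * x) * (p * q * z - lam * p * r / 2 * x^3)" for x y z
    using arg_cong[OF e, of "\<lambda>f. eval3 f x y z"]
    unfolding eval3_sub partial_\<Omega> X Y Z by (simp add: power2_eq_square power3_eq_cube)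
  obtain J where J: "J \<noteq> 0" "sub X Y Z \<Omega> = const3 J * \<Omega>" "jac_det X Y Z = const3 J"
    using sub_\<Omega>_exact_aut[OF ex] by blast
  have Jd: "J = p * q * (p * q)"
    using arg_cong[OF J(3), of "\<lambda>f. eval3 f 0 0 0"]
    unfolding jac_det_def jacobian3_def X Y Z partial_minus partial_derivation partial_generators partial_const3
    by (simp add: mult_ac)
  then have nz: "p \<noteq> 0" "q \<noteq> 0"
    using J(1) by auto
  \<comment> \<open>\<open>of\<close> fills in the variables in the order y, x, z of their
    occurrence, so this is the value at y = 1, x = 0, z = 0.\<close>
  have "p * q * p * 3 = 3 * q^2"
    using ev[of 1 0 0] by simp
  then have "3 * (q * (p * p)) = 3 * (q * q)"
    by (simp add: power2_eq_square mult_ac)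
  then have q: "q = p^2"
    using nz by (auto simp: power2_eq_square)
  \<comment> \<open>The values at y = 1 and y = -1 for x = 1, z = 0 share the left-hand side;
    comparing them isolates the mixed term with x^2 y.\<close>
  have "3 * (q + r)^2 = 3 * (r - q)^2"
    using ev[of 1 1 0] ev[of "- 1" 1 0] by simp
  then have "12 * (q * r) = 0"
    by (simp add: power2_eq_square algebra_simps)
  then have "r = 0"
    using nz by simp
  have "J = p ^ 6"
    by (simp add: Jd q eval_nat_numeral mult_ac)
  then have "(p ^ 6 - 1) * \<xi> = 0"
    using T \<Omega>_shift_dvd_iff[OF J(2)] by (simp add: aut_triples_def)
  then show ?thesis
    using nz \<open>r = 0\<close> by (intro exI[of _ p]) (simp add: X Y Z q const3_simps(1) power2_eq_square power3_eq_cube mult_ac)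
qed

lemma poisson_auts_sextic:
  assumes "\<sigma> \<in> poisson_auts (P_Omega \<Omega> \<xi>)"
  shows "\<exists>\<zeta>. \<zeta> \<noteq> 0 \<and> (\<zeta> ^ 6 - 1) * \<xi> = 0 \<and>
     \<sigma> (P_class \<Omega> \<xi> varX) = P_class \<Omega> \<xi> (const3 \<zeta> * varX) \<and>
     \<sigma> (P_class \<Omega> \<xi> varY) = P_class \<Omega> \<xi> (const3 (\<zeta> ^ 2) * varY) \<and>
     \<sigma> (P_class \<Omega> \<xi> varZ) = P_class \<Omega> \<xi> (const3 (\<zeta> ^ 3) * varZ)"
proof -
  obtain X Y Z where T: "(X, Y, Z) \<in> aut_triples \<xi>" "\<sigma> = ind \<Omega> \<xi> (X, Y, Z)"
    using poisson_auts_P_ind[OF assms] by (metis prod_cases3)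
  obtain \<zeta> where "\<zeta> \<noteq> 0" "X = const3 \<zeta> * varX" "Y = const3 (\<zeta> ^ 2) * varY" "Z = const3 (\<zeta> ^ 3) * varZ"
    "(\<zeta> ^ 6 - 1) * \<xi> = 0"
    using aut_triples_sextic[OF T(1)] by blast
  then show ?thesis
    using T by (intro exI[of _ \<zeta>]) (simp add: ind_sub)
qed

end

section \<open>The groups of the statement and the conclusion\<close>

lemma G_groups:
  "carrier (G_111 :: ('k::field \<times> 'k \<times> 'k) monoid) = G_cubic 0"
  "carrier (G'_111 :: ('k \<times> 'k \<times> 'k) monoid) = G_cubic 1"
  "one (G_111 :: ('k \<times> 'k \<times> 'k) monoid) = (1, 1, 1)" "one (G'_111 :: ('k \<times> 'k \<times> 'k) monoid) = (1, 1, 1)"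
  "carrier (G_112 :: ('k \<times> 'k) monoid) = G_quartic 0" "carrier (G'_112 :: ('k \<times> 'k) monoid) = G_quartic 1"
  "one (G_112 :: ('k \<times> 'k) monoid) = (1, 1)" "one (G'_112 :: ('k \<times> 'k) monoid) = (1, 1)"
proof -
  have e: "x ^ 4 = (x * y)^2 \<and> y ^ 4 = (x * y)^2" if "x^2 = y^2" for x y :: 'k
  proof -
    have "x ^ 4 = x^2 * x^2" "y ^ 4 = y^2 * y^2"
      by (simp_all flip: power_add)
    then show ?thesis
      by (simp only: power_mult_distrib that)
  qed
  have "(x, y) \<in> carrier G'_112 \<longleftrightarrow> (x, y) \<in> G_quartic 1" for x y :: 'k
    using e[of x y] by (auto simp: G'_112_def G_quartic_def)
  then show "carrier (G'_112 :: ('k \<times> 'k) monoid) = G_quartic 1"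
    by auto
qed (auto simp: G_111_def G'_111_def G_112_def G'_112_def G_cubic_def G_quartic_def unit_group_def)

lemma G_groups_mult:
  fixes \<alpha>1 \<alpha>2 \<alpha>3 \<beta>1 \<beta>2 \<beta>3 :: "'k::field"
  shows "monoid.mult G_111 (\<alpha>1, \<alpha>2, \<alpha>3) (\<beta>1, \<beta>2, \<beta>3) = (\<alpha>1 * \<beta>1, \<alpha>2 * \<beta>2, \<alpha>3 * \<beta>3)"
    "monoid.mult G'_111 (\<alpha>1, \<alpha>2, \<alpha>3) (\<beta>1, \<beta>2, \<beta>3) = (\<alpha>1 * \<beta>1, \<alpha>2 * \<beta>2, \<alpha>3 * \<beta>3)"
    "monoid.mult G_112 (\<alpha>1, \<alpha>2) (\<beta>1, \<beta>2) = (\<alpha>1 * \<beta>1, \<alpha>2 * \<beta>2)"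
    "monoid.mult G'_112 (\<alpha>1, \<alpha>2) (\<beta>1, \<beta>2) = (\<alpha>1 * \<beta>1, \<alpha>2 * \<beta>2)"
  by (simp_all add: G_111_def G'_111_def G_112_def G'_112_def unit_group_def DirProd_def)

theorem theorem0p5:
  fixes \<Omega> :: "'k::{alg_closed_field, field_char_0} poly3"
    and a b c :: nat
  assumes "a > 0" and "b > 0" and "c > 0"
    and "\<Omega> \<in> homogeneous3 a b c (a + b + c)"
    and "isolated_singularity \<Omega>"
  shows
    "(\<forall>\<sigma>\<in>carrier (AutP (P_Omega \<Omega> 0)). preserves (P_degree a b c \<Omega>) \<sigma>) \<and>
     (\<forall>\<xi>. \<xi> \<noteq> 0 \<longrightarrow>
        (\<forall>\<sigma>\<in>carrier (AutP (P_Omega \<Omega> \<xi>)). preserves (P_filtration a b c \<Omega> \<xi>) \<sigma>)) \<and>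
     (\<forall>\<sigma>\<in>carrier (AutP (A_Omega \<Omega>)). preserves (homogeneous3 a b c) \<sigma>) \<and>
     AutP (A_Omega \<Omega>) \<cong> AutgrP (A_Omega \<Omega>) (homogeneous3 a b c) \<and>
     AutgrP (A_Omega \<Omega>) (homogeneous3 a b c) \<cong> AutgrP (P_Omega \<Omega> 0) (P_degree a b c \<Omega>) \<and>
     AutgrP (P_Omega \<Omega> 0) (P_degree a b c \<Omega>) \<cong> AutP (P_Omega \<Omega> 0) \<and>
     (\<forall>lam. a = 1 \<and> b = 1 \<and> c = 1 \<and>
        \<Omega> = varX ^ 3 + varY ^ 3 + varZ ^ 3 + const3 lam * varX * varY * varZ \<and>
        (- lam) ^ 3 \<noteq> 27 \<longrightarrow>
          short_exact (G_111 :: ('k \<times> 'k \<times> 'k) monoid) (AutP (P_Omega \<Omega> 0))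
            (integer_mod_group 3) \<and>
          short_exact (G'_111 :: ('k \<times> 'k \<times> 'k) monoid) (AutP (P_Omega \<Omega> 1))
            (integer_mod_group 3) \<and>
          AutP (P_Omega \<Omega> 0) \<cong>
            semidirect (integer_mod_group 3) (G_111 :: ('k \<times> 'k \<times> 'k) monoid) cyclic3 \<and>
          AutP (P_Omega \<Omega> 1) \<cong>
            semidirect (integer_mod_group 3) (G'_111 :: ('k \<times> 'k \<times> 'k) monoid) cyclic3) \<and>
     (\<forall>lam. a = 1 \<and> b = 1 \<and> c = 2 \<and>
        \<Omega> = varX ^ 4 + varY ^ 4 + varZ ^ 2 + const3 lam * varX * varY * varZ \<and>
        (- lam) ^ 4 \<noteq> 64 \<longrightarrow>
          short_exact (G_112 :: ('k \<times> 'k) monoid) (AutP (P_Omega \<Omega> 0))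
            (integer_mod_group 2) \<and>
          short_exact (G'_112 :: ('k \<times> 'k) monoid) (AutP (P_Omega \<Omega> 1))
            (integer_mod_group 2) \<and>
          AutP (P_Omega \<Omega> 0) \<cong>
            semidirect (integer_mod_group 2) (G_112 :: ('k \<times> 'k) monoid) cyclic2 \<and>
          AutP (P_Omega \<Omega> 1) \<cong>
            semidirect (integer_mod_group 2) (G'_112 :: ('k \<times> 'k) monoid) cyclic2) \<and>
     (\<forall>lam. a = 1 \<and> b = 2 \<and> c = 3 \<and>
        \<Omega> = varX ^ 6 + varY ^ 3 + varZ ^ 2 + const3 lam * varX * varY * varZ \<and>
        (- lam) ^ 6 \<noteq> 432 \<longrightarrow>
          (\<forall>\<sigma>\<in>carrier (AutP (P_Omega \<Omega> 0)). \<exists>\<zeta>. \<zeta> \<noteq> 0 \<and>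
             \<sigma> (P_class \<Omega> 0 varX) = P_class \<Omega> 0 (const3 \<zeta> * varX) \<and>
             \<sigma> (P_class \<Omega> 0 varY) = P_class \<Omega> 0 (const3 (\<zeta> ^ 2) * varY) \<and>
             \<sigma> (P_class \<Omega> 0 varZ) = P_class \<Omega> 0 (const3 (\<zeta> ^ 3) * varZ)) \<and>
          (\<forall>\<sigma>\<in>carrier (AutP (P_Omega \<Omega> 1)). \<exists>\<zeta>. \<zeta> \<noteq> 0 \<and> \<zeta> ^ 6 = 1 \<and>
             \<sigma> (P_class \<Omega> 1 varX) = P_class \<Omega> 1 (const3 \<zeta> * varX) \<and>
             \<sigma> (P_class \<Omega> 1 varY) = P_class \<Omega> 1 (const3 (\<zeta> ^ 2) * varY) \<and>
             \<sigma> (P_class \<Omega> 1 varZ) = P_class \<Omega> 1 (const3 (\<zeta> ^ 3) * varZ)))"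
proof -
  interpret potential a b c \<Omega>
    using assms by unfold_locales
  \<comment> \<open>Every automorphism being graded, the graded groups are equal to the full ones,
    so the outer two isomorphisms are identities.\<close>
  have A: "AutgrP (A_Omega \<Omega>) (homogeneous3 a b c) = AutP (A_Omega \<Omega>)"
    "AutgrP (P_Omega \<Omega> 0) (P_degree a b c \<Omega>) = AutP (P_Omega \<Omega> 0)"
    by (intro AutgrP_eq_AutP poisson_auts_A_degree poisson_auts_P_degree; assumption)+
  have pres: "\<sigma> \<in> carrier (AutP (P_Omega \<Omega> 0)) \<Longrightarrow> preserves (P_degree a b c \<Omega>) \<sigma>"
    "\<tau> \<in> carrier (AutP (P_Omega \<Omega> \<xi>)) \<Longrightarrow> preserves (P_filtration a b c \<Omega> \<xi>) \<tau>"
    "\<rho> \<in> carrier (AutP (A_Omega \<Omega>)) \<Longrightarrow> preserves (homogeneous3 a b c) \<rho>" for \<sigma> \<tau> \<rho> \<xi>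
    using poisson_auts_P_degree poisson_auts_P_filtration poisson_auts_A_degree by simp_all
  have i: "short_exact (G_111 :: ('k \<times> 'k \<times> 'k) monoid) (AutP (P_Omega \<Omega> 0)) (integer_mod_group 3) \<and>
    short_exact (G'_111 :: ('k \<times> 'k \<times> 'k) monoid) (AutP (P_Omega \<Omega> 1)) (integer_mod_group 3) \<and>
    AutP (P_Omega \<Omega> 0) \<cong> semidirect (integer_mod_group 3) (G_111 :: ('k \<times> 'k \<times> 'k) monoid) cyclic3 \<and>
    AutP (P_Omega \<Omega> 1) \<cong> semidirect (integer_mod_group 3) (G'_111 :: ('k \<times> 'k \<times> 'k) monoid) cyclic3"
    if "a = 1 \<and> b = 1 \<and> c = 1 \<and>
        \<Omega> = varX ^ 3 + varY ^ 3 + varZ ^ 3 + const3 lam * varX * varY * varZ \<and> (- lam) ^ 3 \<noteq> 27" for lam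
  proof -
    have L: "cubic \<Omega> lam"
      using potential_axioms that by (simp add: cubic_def cubic_axioms_def)
    show ?thesis
      using cubic.cubic_groups[OF L G_groups(1,3) G_groups_mult(1)] cubic.cubic_groups[OF L G_groups(2,4) G_groups_mult(2)] by blast
  qed
  have ii: "short_exact (G_112 :: ('k \<times> 'k) monoid) (AutP (P_Omega \<Omega> 0)) (integer_mod_group 2) \<and>
    short_exact (G'_112 :: ('k \<times> 'k) monoid) (AutP (P_Omega \<Omega> 1)) (integer_mod_group 2) \<and>
    AutP (P_Omega \<Omega> 0) \<cong> semidirect (integer_mod_group 2) (G_112 :: ('k \<times> 'k) monoid) cyclic2 \<and>
    AutP (P_Omega \<Omega> 1) \<cong> semidirect (integer_mod_group 2) (G'_112 :: ('k \<times> 'k) monoid) cyclic2"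
    if "a = 1 \<and> b = 1 \<and> c = 2 \<and>
        \<Omega> = varX ^ 4 + varY ^ 4 + varZ ^ 2 + const3 lam * varX * varY * varZ \<and> (- lam) ^ 4 \<noteq> 64" for lam
  proof -
    have L: "quartic \<Omega> lam"
      using potential_axioms that by (simp add: quartic_def quartic_axioms_def)
    show ?thesis
      using quartic.quartic_groups[OF L G_groups(5,7) G_groups_mult(3)] quartic.quartic_groups[OF L G_groups(6,8) G_groups_mult(4)] by blast
  qed
  have iii: "\<exists>\<zeta>. \<zeta> \<noteq> 0 \<and> (\<zeta> ^ 6 - 1) * \<xi> = 0 \<and>
     \<sigma> (P_class \<Omega> \<xi> varX) = P_class \<Omega> \<xi> (const3 \<zeta> * varX) \<and>
     \<sigma> (P_class \<Omega> \<xi> varY) = P_class \<Omega> \<xi> (const3 (\<zeta> ^ 2) * varY) \<and>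
     \<sigma> (P_class \<Omega> \<xi> varZ) = P_class \<Omega> \<xi> (const3 (\<zeta> ^ 3) * varZ)"
    if "a = 1 \<and> b = 2 \<and> c = 3 \<and>
        \<Omega> = varX ^ 6 + varY ^ 3 + varZ ^ 2 + const3 lam * varX * varY * varZ \<and> (- lam) ^ 6 \<noteq> 432"
      and "\<sigma> \<in> poisson_auts (P_Omega \<Omega> \<xi>)" for lam \<xi> \<sigma>
  proof -
    have L: "sextic \<Omega> lam"
      using potential_axioms that(1) by (simp add: sextic_def sextic_axioms_def)
    show ?thesis
      by (rule sextic.poisson_auts_sextic[OF L that(2)])
  qed
  show ?thesis
  proof (intro conjI allI impI ballI)
    show "AutP (A_Omega \<Omega>) \<cong> AutgrP (A_Omega \<Omega>) (homogeneous3 a b c)"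
      unfolding A by (rule iso_refl)
    show "AutgrP (A_Omega \<Omega>) (homogeneous3 a b c) \<cong> AutgrP (P_Omega \<Omega> 0) (P_degree a b c \<Omega>)"
      unfolding A by (rule AutP_A_iso_AutP_P)
    show "AutgrP (P_Omega \<Omega> 0) (P_degree a b c \<Omega>) \<cong> AutP (P_Omega \<Omega> 0)"
      unfolding A by (rule iso_refl)
  next
    fix \<sigma> lam
    assume "a = 1 \<and> b = 2 \<and> c = 3 \<and>
        \<Omega> = varX ^ 6 + varY ^ 3 + varZ ^ 2 + const3 lam * varX * varY * varZ \<and> (- lam) ^ 6 \<noteq> 432"
      and "\<sigma> \<in> carrier (AutP (P_Omega \<Omega> 1))"
    then show "\<exists>\<zeta>. \<zeta> \<noteq> 0 \<and> \<zeta> ^ 6 = 1 \<and>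
             \<sigma> (P_class \<Omega> 1 varX) = P_class \<Omega> 1 (const3 \<zeta> * varX) \<and>
             \<sigma> (P_class \<Omega> 1 varY) = P_class \<Omega> 1 (const3 (\<zeta> ^ 2) * varY) \<and>
             \<sigma> (P_class \<Omega> 1 varZ) = P_class \<Omega> 1 (const3 (\<zeta> ^ 3) * varZ)"
      using iii[of lam \<sigma> 1] by simp
  next
    fix \<sigma> lam
    assume "a = 1 \<and> b = 2 \<and> c = 3 \<and>
        \<Omega> = varX ^ 6 + varY ^ 3 + varZ ^ 2 + const3 lam * varX * varY * varZ \<and> (- lam) ^ 6 \<noteq> 432"
      and "\<sigma> \<in> carrier (AutP (P_Omega \<Omega> 0))"
    then show "\<exists>\<zeta>. \<zeta> \<noteq> 0 \<and>
             \<sigma> (P_class \<Omega> 0 varX) = P_class \<Omega> 0 (const3 \<zeta> * varX) \<and>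
             \<sigma> (P_class \<Omega> 0 varY) = P_class \<Omega> 0 (const3 (\<zeta> ^ 2) * varY) \<and>
             \<sigma> (P_class \<Omega> 0 varZ) = P_class \<Omega> 0 (const3 (\<zeta> ^ 3) * varZ)"
      using iii[of lam \<sigma> 0] by simp
  qed (use i ii pres in blast)+
qed

end
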